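(* For every $n\in\mathbb{N}$, the ordered abelian groups $\mathbb{Z}^n$ and $\mathbb{Z}^n\times\mathbb{R}$ (with the lexicographic ordering) are uniformly stably embedded, and each of them is, up to isomorphism, the unique model of its own complete theory which is stably embedded.
   Context: Ordered abelian groups are structures in the language $\{0,+,-,<\}$. The products carry the lexicographic ordering in which the first coordinate is dominant, so that $\{0\}^n\times\mathbb{R}$ is a convex subgroup of $\mathbb{Z}^n\times\mathbb{R}$. For an elementary extension $\mathcal M\preccurlyeq\mathcal N$ of $\mathcal{L}$-structures, $\mathcal M$ is stably embedded in $\mathcal N$ if for every $\mathcal{L}$-formula $\phi(\bar x,\bar y)$ and tuple $\bar a$ from $N$ there are an $\mathcal{L}$-formula $\psi(\bar x,\bar z)$ and a tuple $\bar b$ from $M$ with $\phi(N^m,\bar a)\cap M^m=\psi(M^m,\bar b)$, where $m=|\bar x|$. If $\psi(\bar x,\bar z)$ can be chosen depending only on $\phi(\bar x,\bar y)$ and not on $\bar a$, then $\mathcal M$ is uniformly stably embedded in $\mathcal N$. $\mathcal M$ is (uniformly) stably embedded if it is (uniformly) stably embedded in every elementary extension. *)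

theory Defs
  imports Complex_Main
begin

section \<open>First-order logic in the language of ordered abelian groups\<close>

text \<open>
  The language is \<open>{0, +, -, <}\<close> with equality, where \<open>-\<close> is the unary inverse.
  Variables are de Bruijn indices and environments are lists: \<open>TVar i\<close> denotes the
  \<open>i\<close>-th entry of the environment, and a quantifier pushes its witness to the front.
\<close>

datatype tm = TVar nat | TZero | TPlus tm tm | TNeg tm

datatype fm = FEq tm tm | FLess tm tm | FNot fm | FAnd fm fm | FEx fm

record 'a lstruct =
  Dom :: "'a set"
  zero_of :: 'a
  plus_of :: "'a \<Rightarrow> 'a \<Rightarrow> 'a"
  neg_of :: "'a \<Rightarrow> 'a"
  less_of :: "'a \<Rightarrow> 'a \<Rightarrow> bool"

definition is_lstruct :: "'a lstruct \<Rightarrow> bool" where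
  "is_lstruct M \<longleftrightarrow>
     zero_of M \<in> Dom M \<and>
     (\<forall>x\<in>Dom M. \<forall>y\<in>Dom M. plus_of M x y \<in> Dom M) \<and>
     (\<forall>x\<in>Dom M. neg_of M x \<in> Dom M)"

text \<open>The set \<open>M\<^sup>k\<close> of \<open>k\<close>-tuples.\<close>

definition tuples :: "'a lstruct \<Rightarrow> nat \<Rightarrow> 'a list set" where
  "tuples M k = {xs. length xs = k \<and> set xs \<subseteq> Dom M}"

fun tm_in :: "nat \<Rightarrow> tm \<Rightarrow> bool" where
  "tm_in k (TVar i) \<longleftrightarrow> i < k"
| "tm_in k TZero \<longleftrightarrow> True"
| "tm_in k (TPlus s t) \<longleftrightarrow> tm_in k s \<and> tm_in k t"
| "tm_in k (TNeg t) \<longleftrightarrow> tm_in k t"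

text \<open>
  \<open>fm_in k \<phi>\<close>: the free variables of \<open>\<phi>\<close> are among the first \<open>k\<close>. A formula
  \<open>\<phi>(x, y)\<close> with \<open>|x| = m\<close> and \<open>|y| = k\<close> is a \<open>\<phi>\<close> with \<open>fm_in (m + k) \<phi>\<close>, evaluated in
  the environment \<open>x @ y\<close>.
\<close>

fun fm_in :: "nat \<Rightarrow> fm \<Rightarrow> bool" where
  "fm_in k (FEq s t) \<longleftrightarrow> tm_in k s \<and> tm_in k t"
| "fm_in k (FLess s t) \<longleftrightarrow> tm_in k s \<and> tm_in k t"
| "fm_in k (FNot p) \<longleftrightarrow> fm_in k p"
| "fm_in k (FAnd p q) \<longleftrightarrow> fm_in k p \<and> fm_in k q"
| "fm_in k (FEx p) \<longleftrightarrow> fm_in (Suc k) p"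

fun tm_val :: "'a lstruct \<Rightarrow> 'a list \<Rightarrow> tm \<Rightarrow> 'a" where
  "tm_val M e (TVar i) = e ! i"
| "tm_val M e TZero = zero_of M"
| "tm_val M e (TPlus s t) = plus_of M (tm_val M e s) (tm_val M e t)"
| "tm_val M e (TNeg t) = neg_of M (tm_val M e t)"

fun sat :: "'a lstruct \<Rightarrow> 'a list \<Rightarrow> fm \<Rightarrow> bool" where
  "sat M e (FEq s t) \<longleftrightarrow> tm_val M e s = tm_val M e t"
| "sat M e (FLess s t) \<longleftrightarrow> less_of M (tm_val M e s) (tm_val M e t)"
| "sat M e (FNot p) \<longleftrightarrow> \<not> sat M e p"
| "sat M e (FAnd p q) \<longleftrightarrow> sat M e p \<and> sat M e q"
| "sat M e (FEx p) \<longleftrightarrow> (\<exists>x\<in>Dom M. sat M (x # e) p)"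

text \<open>The complete theory of a structure, as a set of sentences, and models of a theory.\<close>

definition Th :: "'a lstruct \<Rightarrow> fm set" where
  "Th M = {\<phi>. fm_in 0 \<phi> \<and> sat M [] \<phi>}"

definition is_model :: "'a lstruct \<Rightarrow> fm set \<Rightarrow> bool" where
  "is_model M T \<longleftrightarrow> is_lstruct M \<and> (\<forall>\<phi>\<in>T. sat M [] \<phi>)"

definition isomorphic :: "'a lstruct \<Rightarrow> 'b lstruct \<Rightarrow> bool" where
  "isomorphic M N \<longleftrightarrow> (\<exists>h. bij_betw h (Dom M) (Dom N) \<and>
     h (zero_of M) = zero_of N \<and>
     (\<forall>x\<in>Dom M. \<forall>y\<in>Dom M. h (plus_of M x y) = plus_of N (h x) (h y)) \<and>
     (\<forall>x\<in>Dom M. h (neg_of M x) = neg_of N (h x)) \<and>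
     (\<forall>x\<in>Dom M. \<forall>y\<in>Dom M. less_of M x y \<longleftrightarrow> less_of N (h x) (h y)))"


section \<open>Stable embeddedness\<close>

text \<open>
  An elementary extension of \<open>M\<close> is given as a structure \<open>N\<close>, possibly over another type,
  together with an elementary embedding \<open>h\<close> of \<open>M\<close> into \<open>N\<close>, along which \<open>M\<close> is identified
  with its image.
\<close>

definition elementary_extension ::
    "'a lstruct \<Rightarrow> ('a \<Rightarrow> 'b) \<Rightarrow> 'b lstruct \<Rightarrow> bool" where
  "elementary_extension M h N \<longleftrightarrow>
     is_lstruct M \<and> is_lstruct N \<and> h ` Dom M \<subseteq> Dom N \<and>
     (\<forall>k \<phi>. fm_in k \<phi> \<longrightarrow> (\<forall>e\<in>tuples M k. sat M e \<phi> \<longleftrightarrow> sat N (map h e) \<phi>))"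

text \<open>
  The trace on \<open>M\<^sup>m\<close> of the set that \<open>\<phi>(x, a)\<close> defines in \<open>N\<close>; for \<open>N = M\<close> and \<open>h = id\<close>
  this is the definable set \<open>\<phi>(M\<^sup>m, a)\<close>.
\<close>

definition trace ::
    "nat \<Rightarrow> 'a lstruct \<Rightarrow> ('a \<Rightarrow> 'b) \<Rightarrow> 'b lstruct \<Rightarrow> fm \<Rightarrow> 'b list \<Rightarrow> 'a list set" where
  "trace m M h N \<phi> a = {x \<in> tuples M m. sat N (map h x @ a) \<phi>}"

definition definable_set :: "nat \<Rightarrow> 'a lstruct \<Rightarrow> fm \<Rightarrow> 'a list \<Rightarrow> 'a list set" where
  "definable_set m M \<psi> b = {x \<in> tuples M m. sat M (x @ b) \<psi>}"

definition stably_embedded_in ::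
    "'a lstruct \<Rightarrow> ('a \<Rightarrow> 'b) \<Rightarrow> 'b lstruct \<Rightarrow> bool" where
  "stably_embedded_in M h N \<longleftrightarrow>
     (\<forall>m k \<phi>. fm_in (m + k) \<phi> \<longrightarrow>
       (\<forall>a\<in>tuples N k. \<exists>l \<psi>. fm_in (m + l) \<psi> \<and>
         (\<exists>b\<in>tuples M l. trace m M h N \<phi> a = definable_set m M \<psi> b)))"

definition uniformly_stably_embedded_in ::
    "'a lstruct \<Rightarrow> ('a \<Rightarrow> 'b) \<Rightarrow> 'b lstruct \<Rightarrow> bool" where
  "uniformly_stably_embedded_in M h N \<longleftrightarrow>
     (\<forall>m k \<phi>. fm_in (m + k) \<phi> \<longrightarrow>
       (\<exists>l \<psi>. fm_in (m + l) \<psi> \<and>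
         (\<forall>a\<in>tuples N k. \<exists>b\<in>tuples M l.
           trace m M h N \<phi> a = definable_set m M \<psi> b)))"

text \<open>
  HOL cannot quantify over types inside a formula, so the type \<open>'u\<close> from which the domains
  of the elementary extensions are drawn is a parameter. Nothing is lost as soon as \<open>'u\<close> is
  infinite and \<open>M\<close> injects into it: if \<open>M\<close> fails to be stably embedded in \<open>N\<close>, as
  witnessed by \<open>\<phi>\<close> and \<open>a\<close>, then it also fails in any elementary substructure of \<open>N\<close>
  containing \<open>M\<close> and \<open>a\<close>, and by Loewenheim-Skolem there is one of cardinality at most that
  of \<open>M\<close> plus aleph-zero. For such \<open>'u\<close>, \<open>stably_embedded\<close> is thus equivalent to being
  stably embedded in the elementary extensions over all types.
\<close>

definition stably_embedded :: "'u itself \<Rightarrow> 'a lstruct \<Rightarrow> bool" where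
  "stably_embedded (U :: 'u itself) M \<longleftrightarrow>
     (\<forall>(N :: 'u lstruct) h. elementary_extension M h N \<longrightarrow> stably_embedded_in M h N)"

definition uniformly_stably_embedded :: "'u itself \<Rightarrow> 'a lstruct \<Rightarrow> bool" where
  "uniformly_stably_embedded (U :: 'u itself) M \<longleftrightarrow>
     (\<forall>(N :: 'u lstruct) h.
        elementary_extension M h N \<longrightarrow> uniformly_stably_embedded_in M h N)"


section \<open>The ordered abelian groups\<close>

text \<open>Lists of length \<open>n\<close>; \<open>lex\<close> compares lists of equal length, the head being dominant.\<close>

definition Z_pow :: "nat \<Rightarrow> int list lstruct" where
  "Z_pow n =
     \<lparr> Dom = {xs. length xs = n},
       zero_of = replicate n 0,
       plus_of = map2 (+),
       neg_of = map uminus,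
       less_of = (\<lambda>xs ys. (xs, ys) \<in> lex {(a, b). a < b}) \<rparr>"

definition R_grp :: "real lstruct" where
  "R_grp = \<lparr> Dom = UNIV, zero_of = 0, plus_of = (+), neg_of = uminus, less_of = (<) \<rparr>"

definition lex_times :: "'a lstruct \<Rightarrow> 'b lstruct \<Rightarrow> ('a \<times> 'b) lstruct" where
  "lex_times G H =
     \<lparr> Dom = Dom G \<times> Dom H,
       zero_of = (zero_of G, zero_of H),
       plus_of = (\<lambda>(x, y) (x', y'). (plus_of G x x', plus_of H y y')),
       neg_of = (\<lambda>(x, y). (neg_of G x, neg_of H y)),
       less_of = (\<lambda>(x, y) (x', y'). less_of G x x' \<or> x = x' \<and> less_of H y y') \<rparr>"

end

theory Submission
  imports Defs "HOL-Library.Countable" "HOL-Algebra.Generated_Groups"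
begin

text \<open>
  Both groups are groups of integer vectors with a last coordinate from \<open>T = {0}\<close> or
  \<open>T = \<real>\<close>, ordered lexicographically. A back-and-forth argument shows that in such a group the
  truth of a formula is determined by finitely many order comparisons and congruences between
  integer combinations of the variables and integer vectors. Therefore the trace of an
  externally definable set is a Boolean combination, of a shape that depends only on the
  formula, of residue classes and preimages of upward closed sets under integer linear maps.
  Every upward closed set is trivial or of the form \<open>g < 2y\<close> or \<open>g \<le> 2y\<close>: the factor \<open>2\<close>
  also catches the cuts at the cosets of the convex subgroups. This gives uniform stable
  embeddedness.

  For uniqueness, the convex subgroups are defined in every model from parameters \<open>e\<^sub>i\<close> by
  \<open>- e\<^sub>i < 2x < e\<^sub>i\<close>. A cut of countable cofinality is realised in an ultrapower, restricted to
  the sequences named by Skolem terms in order to bound its cardinality. In a stably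
  embedded model such a cut is therefore definable, hence has a supremum modulo the next
  convex subgroup, as definable cuts do in the standard model. Applied to the multiples of
  an element this makes the successive quotients archimedean, so that they are infinite
  cyclic and split off, and the divisible convex subgroup is complete, hence isomorphic
  to \<open>\<real>\<close>.
\<close>


section \<open>Formulas\<close>

text \<open>Nothing is proved about the inner structure of an elementary extension. For finitely
  many formulas with parameters in the standard group, a tuple of the extension is imitated by a
  tuple of the standard group, and all order arithmetic happens there. Uniformity comes from
  counting: a formula has a bound \<open>B\<close>, only finitely many integer vectors are bounded
  by \<open>B\<close>, and so the tuple influences the trace only through a fixed finite number of
  cuts, each coded by one group element. For uniqueness, the obstacle is that the theory does not
  name the convex subgroups: a model offers some frame, not a canonical one. Hence the facts about
  the standard group are proved for all its frames, which turn out to define the same subgroups.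
  There every cut has a supremum modulo the next level, but only for definable cuts is this a schema
  of axioms; stable embeddedness brings externally given cuts of a model under that schema. The size
  of the extension matters because stable embeddedness speaks of extensions on one type, here the
  type of the model itself.\<close>

abbreviation FAll :: "fm \<Rightarrow> fm" where "FAll p \<equiv> FNot (FEx (FNot p))"
abbreviation FImp :: "fm \<Rightarrow> fm \<Rightarrow> fm" where "FImp p q \<equiv> FNot (FAnd p (FNot q))"
abbreviation FOr :: "fm \<Rightarrow> fm \<Rightarrow> fm" where "FOr p q \<equiv> FNot (FAnd (FNot p) (FNot q))"

definition FConj :: "fm list \<Rightarrow> fm" where
  "FConj ps = foldr FAnd ps (FEq TZero TZero)"

lemma sat_FConj [simp]: "sat M e (FConj ps) \<longleftrightarrow> (\<forall>p\<in>set ps. sat M e p)"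
  unfolding FConj_def by (induction ps) auto

lemma fm_in_FConj [simp]: "fm_in k (FConj ps) \<longleftrightarrow> (\<forall>p\<in>set ps. fm_in k p)"
  unfolding FConj_def by (induction ps) auto

fun tren :: "(nat \<Rightarrow> nat) \<Rightarrow> tm \<Rightarrow> tm" where
  "tren f (TVar i) = TVar (f i)"
| "tren f TZero = TZero"
| "tren f (TPlus s t) = TPlus (tren f s) (tren f t)"
| "tren f (TNeg t) = TNeg (tren f t)"

fun ren :: "(nat \<Rightarrow> nat) \<Rightarrow> fm \<Rightarrow> fm" where
  "ren f (FEq s t) = FEq (tren f s) (tren f t)"
| "ren f (FLess s t) = FLess (tren f s) (tren f t)"
| "ren f (FNot p) = FNot (ren f p)"
| "ren f (FAnd p q) = FAnd (ren f p) (ren f q)"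
| "ren f (FEx p) = FEx (ren (case_nat 0 (\<lambda>i. Suc (f i))) p)"

lemma tm_val_tren:
  assumes "tm_in k t" "\<And>i. i < k \<Longrightarrow> e' ! f i = e ! i"
  shows "tm_val M e' (tren f t) = tm_val M e t"
  using assms by (induction t) auto

text \<open>The common tool for moving, inserting and permuting parameters: \<open>f\<close> has to
  be right only on the variables below \<open>k\<close>, so the two environments may have different
  lengths.\<close>

lemma sat_ren:
  assumes "fm_in k p" "\<And>i. i < k \<Longrightarrow> e' ! f i = e ! i"
  shows "sat M e' (ren f p) \<longleftrightarrow> sat M e p"
  using assms
proof (induction p arbitrary: k e e' f)
  case (FEx p)
  have "sat M (x # e') (ren (case_nat 0 (\<lambda>i. Suc (f i))) p) \<longleftrightarrow> sat M (x # e) p" for x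
    by (rule FEx.IH[of "Suc k"]) (use FEx.prems in \<open>auto split: nat.split\<close>)
  then show ?case by simp
qed (auto simp: tm_val_tren)

lemma tm_in_tren: "tm_in k t \<Longrightarrow> (\<And>i. i < k \<Longrightarrow> f i < k') \<Longrightarrow> tm_in k' (tren f t)"
  by (induction t) auto

lemma fm_in_ren: "fm_in k p \<Longrightarrow> (\<And>i. i < k \<Longrightarrow> f i < k') \<Longrightarrow> fm_in k' (ren f p)"
proof (induction p arbitrary: k k' f)
  case (FEx p)
  have "fm_in (Suc k') (ren (case_nat 0 (\<lambda>i. Suc (f i))) p)"
    by (rule FEx.IH[of "Suc k"]) (use FEx.prems in \<open>auto split: nat.split\<close>)
  then show ?case by simp
qed (auto simp: tm_in_tren)

lemma sat_cong:
  assumes "fm_in k p" "\<And>i. i < k \<Longrightarrow> e' ! i = e ! i"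
  shows "sat M e' p \<longleftrightarrow> sat M e p"
  using sat_ren[of k p e' id e' M] sat_ren[of k p e' id e M] assms by simp

lemma tm_in_mono: "tm_in k t \<Longrightarrow> k \<le> k' \<Longrightarrow> tm_in k' t"
  by (induction t) auto

lemma fm_in_mono: "fm_in k p \<Longrightarrow> k \<le> k' \<Longrightarrow> fm_in k' p"
  by (induction p arbitrary: k k') (auto intro: tm_in_mono)

lemma tm_val_in_Dom:
  assumes "is_lstruct M" "tm_in (length e) t" "set e \<subseteq> Dom M"
  shows "tm_val M e t \<in> Dom M"
  using assms(2) by (induction t) (use assms(1,3) in \<open>auto simp: is_lstruct_def\<close>)

lemma tuples_0 [simp]: "tuples M 0 = {[]}"
  by (auto simp: tuples_def)

lemma tuples_append: "xs \<in> tuples M j \<Longrightarrow> ys \<in> tuples M k \<Longrightarrow> xs @ ys \<in> tuples M (j + k)"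
  by (auto simp: tuples_def)

lemma tuples_length: "xs \<in> tuples M k \<Longrightarrow> length xs = k"
  by (auto simp: tuples_def)

lemma sat_FEx_pow: "sat M e ((FEx ^^ k) p) \<longleftrightarrow> (\<exists>a\<in>tuples M k. sat M (a @ e) p)"
proof (induction k arbitrary: e)
  case (Suc k)
  have "sat M e ((FEx ^^ Suc k) p) \<longleftrightarrow> (\<exists>x\<in>Dom M. \<exists>a\<in>tuples M k. sat M (a @ x # e) p)"
    by (simp add: Suc.IH)
  also have "\<dots> \<longleftrightarrow> (\<exists>a\<in>tuples M (Suc k). sat M (a @ e) p)"
  proof
    assume "\<exists>x\<in>Dom M. \<exists>a\<in>tuples M k. sat M (a @ x # e) p"
    then obtain x a where "x \<in> Dom M" "a \<in> tuples M k" "sat M (a @ x # e) p" by blast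
    \<comment> \<open>The witness of the outermost quantifier is pushed first and therefore ends up
      last in the tuple.\<close>
    then show "\<exists>a\<in>tuples M (Suc k). sat M (a @ e) p"
      by (intro bexI[of _ "a @ [x]"]) (auto simp: tuples_def)
  next
    assume "\<exists>a\<in>tuples M (Suc k). sat M (a @ e) p"
    then obtain a where a: "a \<in> tuples M (Suc k)" "sat M (a @ e) p" by blast
    then obtain a' x where "a = a' @ [x]" by (cases a rule: rev_cases) (auto simp: tuples_def)
    with a show "\<exists>x\<in>Dom M. \<exists>a\<in>tuples M k. sat M (a @ x # e) p"
      by (intro bexI[of _ x] bexI[of _ a']) (auto simp: tuples_def)
  qed
  finally show ?case .
qed simp

lemma fm_in_FEx_pow: "fm_in j ((FEx ^^ k) p) \<longleftrightarrow> fm_in (k + j) p"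
  by (induction k arbitrary: j) auto

lemma model_Th_iff:
  assumes "is_model M (Th G)" "fm_in 0 p"
  shows "sat M [] p \<longleftrightarrow> sat G [] p"
proof -
  have "sat G [] q \<Longrightarrow> sat M [] q" if "fm_in 0 q" for q
    using assms(1) that by (auto simp: is_model_def Th_def)
  from this[of p] this[of "FNot p"] assms(2) show ?thesis by auto
qed

lemma model_Th_ex:
  assumes "is_model M (Th G)" "fm_in k p"
  shows "(\<exists>e\<in>tuples M k. sat M e p) \<longleftrightarrow> (\<exists>e\<in>tuples G k. sat G e p)"
  using model_Th_iff[OF assms(1), of "(FEx ^^ k) p"] assms(2)
  by (simp add: sat_FEx_pow fm_in_FEx_pow)

lemma model_Th_all:
  assumes "is_model M (Th G)" "fm_in k p" "\<And>e. e \<in> tuples G k \<Longrightarrow> sat G e p" "e \<in> tuples M k"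
  shows "sat M e p"
  using model_Th_ex[OF assms(1), of k "FNot p"] assms by auto

section \<open>Isomorphisms\<close>

definition struct_iso :: "('a \<Rightarrow> 'b) \<Rightarrow> 'a lstruct \<Rightarrow> 'b lstruct \<Rightarrow> bool" where
  "struct_iso h M N \<longleftrightarrow> bij_betw h (Dom M) (Dom N) \<and>
     h (zero_of M) = zero_of N \<and>
     (\<forall>x\<in>Dom M. \<forall>y\<in>Dom M. h (plus_of M x y) = plus_of N (h x) (h y)) \<and>
     (\<forall>x\<in>Dom M. h (neg_of M x) = neg_of N (h x)) \<and>
     (\<forall>x\<in>Dom M. \<forall>y\<in>Dom M. less_of M x y \<longleftrightarrow> less_of N (h x) (h y))"

lemma isomorphic_iff: "isomorphic M N \<longleftrightarrow> (\<exists>h. struct_iso h M N)"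
  by (simp add: isomorphic_def struct_iso_def)

lemma tm_val_iso:
  assumes "struct_iso h M N" "is_lstruct M" "tm_in (length e) t" "set e \<subseteq> Dom M"
  shows "tm_val N (map h e) t = h (tm_val M e t)"
  using assms(3)
proof (induction t)
  case (TPlus s t)
  then show ?case
    using assms tm_val_in_Dom[OF assms(2) _ assms(4)] by (simp add: struct_iso_def)
next
  case (TNeg t)
  then show ?case
    using assms tm_val_in_Dom[OF assms(2) _ assms(4)] by (simp add: struct_iso_def)
qed (use assms in \<open>auto simp: struct_iso_def\<close>)

lemma sat_iso:
  assumes "struct_iso h M N" "is_lstruct M" "fm_in (length e) p" "set e \<subseteq> Dom M"
  shows "sat N (map h e) p \<longleftrightarrow> sat M e p"
  using assms(3,4)
proof (induction p arbitrary: e)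
  case (FEq s t)
  then show ?case
    using tm_val_iso[OF assms(1,2)] tm_val_in_Dom[OF assms(2)] assms(1)
    by (auto simp: struct_iso_def bij_betw_def inj_on_def)
next
  case (FLess s t)
  then show ?case
    using tm_val_iso[OF assms(1,2)] tm_val_in_Dom[OF assms(2)] assms(1)
    by (auto simp: struct_iso_def)
next
  case (FEx p)
  have "h ` Dom M = Dom N" using assms(1) by (auto simp: struct_iso_def bij_betw_def)
  from this[symmetric] have "sat N (map h e) (FEx p) \<longleftrightarrow> (\<exists>x\<in>Dom M. sat N (map h (x # e)) p)"
    by simp
  also have "\<dots> \<longleftrightarrow> (\<exists>x\<in>Dom M. sat M (x # e) p)"
    using FEx by (intro bex_cong refl FEx.IH) auto
  finally show ?case by simp
qed auto

lemma is_lstruct_iso: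
  assumes "struct_iso h M N" "is_lstruct M"
  shows "is_lstruct N"
proof -
  have D: "Dom N = h ` Dom M" using assms(1) by (simp add: struct_iso_def bij_betw_def)
  have z: "zero_of N = h (zero_of M)" using assms(1) by (simp add: struct_iso_def)
  have P: "plus_of N (h x) (h y) = h (plus_of M x y)" if "x \<in> Dom M" "y \<in> Dom M" for x y
    using assms(1) that by (simp add: struct_iso_def)
  have n: "neg_of N (h x) = h (neg_of M x)" if "x \<in> Dom M" for x
    using assms(1) that by (simp add: struct_iso_def)
  show ?thesis using assms(2) unfolding is_lstruct_def D z by (simp add: P n)
qed

lemma struct_iso_inv:
  assumes "struct_iso h M N" "is_lstruct M"
  shows "struct_iso (inv_into (Dom M) h) N M"
proof -
  let ?g = "inv_into (Dom M) h"
  have bij: "bij_betw h (Dom M) (Dom N)" using assms(1) by (simp add: struct_iso_def)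
  then have D: "Dom N = h ` Dom M" by (simp add: bij_betw_def)
  have g: "?g (h x) = x" if "x \<in> Dom M" for x
    using bij that by (simp add: bij_betw_def)
  have M: "zero_of M \<in> Dom M" "\<And>x y. x \<in> Dom M \<Longrightarrow> y \<in> Dom M \<Longrightarrow> plus_of M x y \<in> Dom M"
    "\<And>x. x \<in> Dom M \<Longrightarrow> neg_of M x \<in> Dom M"
    using assms(2) by (simp_all add: is_lstruct_def)
  have H: "zero_of N = h (zero_of M)"
    "\<And>x y. x \<in> Dom M \<Longrightarrow> y \<in> Dom M \<Longrightarrow> plus_of N (h x) (h y) = h (plus_of M x y)"
    "\<And>x. x \<in> Dom M \<Longrightarrow> neg_of N (h x) = h (neg_of M x)"
    "\<And>x y. x \<in> Dom M \<Longrightarrow> y \<in> Dom M \<Longrightarrow> less_of N (h x) (h y) \<longleftrightarrow> less_of M x y"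
    using assms(1) by (simp_all add: struct_iso_def)
  have "bij_betw ?g (h ` Dom M) (Dom M)" using bij_betw_inv_into[OF bij] D by simp
  then show ?thesis unfolding struct_iso_def D by (simp add: g M H)
qed

lemma struct_iso_comp:
  assumes "struct_iso h M N" "struct_iso g N P"
  shows "struct_iso (g \<circ> h) M P"
proof -
  have "\<And>x. x \<in> Dom M \<Longrightarrow> h x \<in> Dom N" using assms(1) by (auto simp: struct_iso_def bij_betw_def)
  then show ?thesis using assms bij_betw_trans[of h "Dom M" "Dom N" g "Dom P"]
    unfolding struct_iso_def by auto
qed

lemma Th_iso:
  assumes "struct_iso h M N" "is_lstruct M"
  shows "Th N = Th M"
  using sat_iso[OF assms, of "[]"] by (auto simp: Th_def)

lemma map_tuples_iso:
  assumes "struct_iso h M N"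
  shows "map h ` tuples M k = tuples N k"
proof -
  have h: "h ` Dom M = Dom N" using assms by (auto simp: struct_iso_def bij_betw_def)
  show ?thesis
  proof (intro equalityI subsetI)
    fix ys assume "ys \<in> tuples N k"
    then have "length ys = k" "set ys \<subseteq> h ` Dom M" by (auto simp: tuples_def h)
    then have "map h (map (inv_into (Dom M) h) ys) = ys"
      unfolding map_map by (intro map_idI) (auto simp: f_inv_into_f)
    moreover have "map (inv_into (Dom M) h) ys \<in> tuples M k"
      using \<open>length ys = k\<close> \<open>set ys \<subseteq> h ` Dom M\<close> by (auto simp: tuples_def intro: inv_into_into)
    ultimately show "ys \<in> map h ` tuples M k" by (simp add: image_iff) (metis (no_types, lifting) map_map)
  qed (auto simp: tuples_def subset_iff simp flip: h)
qed

lemma elementary_extension_iso: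
  assumes "struct_iso f N M" "is_lstruct N" "elementary_extension M h P"
  shows "elementary_extension N (h \<circ> f) P"
proof -
  have f: "map f ` tuples N k = tuples M k" for k by (rule map_tuples_iso[OF assms(1)])
  have D: "f ` Dom N = Dom M" using assms(1) by (auto simp: struct_iso_def bij_betw_def)
  have "sat N e p \<longleftrightarrow> sat P (map (h \<circ> f) e) p" if "fm_in k p" "e \<in> tuples N k" for k p e
  proof -
    have "sat N e p \<longleftrightarrow> sat M (map f e) p"
      using that by (intro sat_iso[OF assms(1,2), symmetric]) (auto simp: tuples_def)
    also have "\<dots> \<longleftrightarrow> sat P (map h (map f e)) p"
      using assms(3) that f[of k] unfolding elementary_extension_def by blast
    finally show ?thesis by simp
  qed
  then show ?thesis using assms(2,3) D unfolding elementary_extension_def by fastforce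
qed

section \<open>Uniformly definable families\<close>

definition unif :: "nat \<Rightarrow> 'a lstruct \<Rightarrow> 'a list set set \<Rightarrow> bool" where
  "unif m M F \<longleftrightarrow> (\<exists>l p. fm_in (m + l) p \<and>
     (\<forall>X\<in>F. \<exists>b\<in>tuples M l. X = definable_set m M p b))"

lemma uniformly_stably_embedded_in_iff:
  "uniformly_stably_embedded_in M h N \<longleftrightarrow>
    (\<forall>m k p. fm_in (m + k) p \<longrightarrow> unif m M (trace m M h N p ` tuples N k))"
  by (simp add: uniformly_stably_embedded_in_def unif_def)

lemma unifI:
  assumes "fm_in (m + l) p" "\<And>X. X \<in> F \<Longrightarrow> \<exists>b\<in>tuples M l. X = definable_set m M p b"
  shows "unif m M F"
  using assms by (auto simp: unif_def)

lemma unif_mono: "unif m M F \<Longrightarrow> F' \<subseteq> F \<Longrightarrow> unif m M F'"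
  unfolding unif_def by (meson subsetD)

lemma unif_subset: "unif m M F \<Longrightarrow> X \<in> F \<Longrightarrow> X \<subseteq> tuples M m"
  by (auto simp: unif_def definable_set_def)

lemma unif_Diff:
  assumes "unif m M F"
  shows "unif m M ((\<lambda>X. tuples M m - X) ` F)"
proof -
  obtain l p where "fm_in (m + l) p" "\<forall>X\<in>F. \<exists>b\<in>tuples M l. X = definable_set m M p b"
    using assms by (auto simp: unif_def)
  then show ?thesis
    by (intro unifI[of m l "FNot p"]) (fastforce simp: definable_set_def)+
qed

lemma unif_Int:
  assumes "unif m M F" "unif m M F'"
  shows "unif m M {X \<inter> Y | X Y. X \<in> F \<and> Y \<in> F'}"
proof -
  obtain l p where p: "fm_in (m + l) p" "\<forall>X\<in>F. \<exists>b\<in>tuples M l. X = definable_set m M p b"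
    using assms by (auto simp: unif_def)
  obtain k q where q: "fm_in (m + k) q" "\<forall>X\<in>F'. \<exists>b\<in>tuples M k. X = definable_set m M q b"
    using assms by (auto simp: unif_def)
  \<comment> \<open>The parameters of \<open>q\<close> are placed behind the \<open>l\<close>
    parameters of \<open>p\<close>.\<close>
  define f where "f i = (if i < m then i else i + l)" for i
  show ?thesis
  proof (rule unifI)
    show "fm_in (m + (l + k)) (FAnd p (ren f q))"
      using p(1) q(1) by (auto intro: fm_in_mono intro!: fm_in_ren simp: f_def)
    fix Z assume "Z \<in> {X \<inter> Y | X Y. X \<in> F \<and> Y \<in> F'}"
    then obtain X Y where Z: "Z = X \<inter> Y" "X \<in> F" "Y \<in> F'" by blast
    obtain b where b: "b \<in> tuples M l" "X = definable_set m M p b" using Z p by blast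
    obtain c where c: "c \<in> tuples M k" "Y = definable_set m M q c" using Z q by blast
    have "sat M (x @ b @ c) p \<longleftrightarrow> sat M (x @ b) p" if "x \<in> tuples M m" for x
      using that b(1) by (intro sat_cong[OF p(1)]) (auto simp: tuples_def nth_append)
    moreover have "sat M (x @ b @ c) (ren f q) \<longleftrightarrow> sat M (x @ c) q" if "x \<in> tuples M m" for x
      using that b(1) by (intro sat_ren[OF q(1)]) (auto simp: tuples_def nth_append f_def)
    ultimately have "Z = definable_set m M (FAnd p (ren f q)) (b @ c)"
      unfolding Z(1) b(2) c(2) definable_set_def by (intro Set.set_eqI) (simp; blast)
    then show "\<exists>d\<in>tuples M (l + k). Z = definable_set m M (FAnd p (ren f q)) d"
      using tuples_append[OF b(1) c(1)] by blast
  qed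
qed

text \<open>Definition by cases: \<open>X\<close> on \<open>A\<close> and \<open>Y\<close> off
  \<open>A\<close>. It is written with complements and intersections alone, so that the two
  preceding closure properties give it. Unions of families and Boolean combinations are both
  obtained from it.\<close>

lemma unif_mix:
  assumes "unif m M S" "unif m M F" "unif m M F'"
  shows "unif m M {(A \<inter> X) \<union> (Y - A) | A X Y. A \<in> S \<and> X \<in> F \<and> Y \<in> F'}"
proof -
  let ?T = "tuples M m"
  define G1 where "G1 = (\<lambda>Z. ?T - Z) ` {A \<inter> X | A X. A \<in> S \<and> X \<in> F}"
  define S' where "S' = (\<lambda>Z. ?T - Z) ` S"
  define G2 where "G2 = (\<lambda>Z. ?T - Z) ` {A \<inter> X | A X. A \<in> S' \<and> X \<in> F'}"
  define G where "G = (\<lambda>Z. ?T - Z) ` {A \<inter> X | A X. A \<in> G1 \<and> X \<in> G2}"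
  have "unif m M G1" unfolding G1_def by (rule unif_Diff[OF unif_Int[OF assms(1,2)]])
  moreover have "unif m M S'" unfolding S'_def by (rule unif_Diff[OF assms(1)])
  then have "unif m M G2" unfolding G2_def by (rule unif_Diff[OF unif_Int[OF _ assms(3)]])
  ultimately have G: "unif m M G" unfolding G_def by (intro unif_Diff unif_Int)
  have "(A \<inter> X) \<union> (Y - A) \<in> G" if h: "A \<in> S" "X \<in> F" "Y \<in> F'" for A X Y
  proof -
    have T: "A \<subseteq> ?T" "X \<subseteq> ?T" "Y \<subseteq> ?T"
      using unif_subset[OF assms(1) h(1)] unif_subset[OF assms(2) h(2)] unif_subset[OF assms(3) h(3)]
      by auto
    have "?T - A \<inter> X \<in> G1" unfolding G1_def using h by (intro imageI) auto
    moreover have "?T - A \<in> S'" unfolding S'_def using h by (intro imageI)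
    then have "?T - (?T - A) \<inter> Y \<in> G2" unfolding G2_def using h by (intro imageI) auto
    ultimately have "?T - ((?T - A \<inter> X) \<inter> (?T - (?T - A) \<inter> Y)) \<in> G"
      unfolding G_def by (intro imageI) auto
    also have "?T - ((?T - A \<inter> X) \<inter> (?T - (?T - A) \<inter> Y)) = (A \<inter> X) \<union> (Y - A)"
      using T by auto
    finally show ?thesis .
  qed
  then show ?thesis by (intro unif_mono[OF G] subsetI) auto
qed

text \<open>Two distinct elements serve as truth values: a pair of parameters, equal or distinct,
  lets one formula choose between two cases. In a one-element structure a formula defines only one
  set, whatever the parameters, so the trivial group needs its own argument.\<close>

locale nontrivial_struct =
  fixes M :: "'a lstruct"
  assumes two_elements: "\<exists>x\<in>Dom M. \<exists>y\<in>Dom M. x \<noteq> y"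
begin

lemma unif_trivial: "unif m M {{}, tuples M m}"
proof -
  obtain x y where xy: "x \<in> Dom M" "y \<in> Dom M" "x \<noteq> y" using two_elements by blast
  let ?p = "FEq (TVar m) (TVar (Suc m))"
  have 1: "definable_set m M ?p [x, y] = {}" "definable_set m M ?p [x, x] = tuples M m"
    using xy by (auto simp: definable_set_def tuples_def nth_append)
  have 2: "[x, y] \<in> tuples M 2" "[x, x] \<in> tuples M 2" using xy by (auto simp: tuples_def)
  show ?thesis
  proof (rule unifI[of m 2 ?p])
    fix X assume "X \<in> {{}, tuples M m}"
    then show "\<exists>b\<in>tuples M 2. X = definable_set m M ?p b"
      using 1 2 by (metis insertE singletonD)
  qed simp
qed

lemma unif_Un:
  assumes "unif m M F" "unif m M F'"
  shows "unif m M (F \<union> F')"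
proof (cases "F = {} \<or> F' = {}")
  case False
  then obtain X0 Y0 where "X0 \<in> F" "Y0 \<in> F'" by blast
  show ?thesis
  proof (rule unif_mono[OF unif_mix[OF unif_trivial assms]], rule subsetI)
    fix Z assume Z: "Z \<in> F \<union> F'"
    then consider "Z \<in> F" | "Z \<in> F'" by blast
    then show "Z \<in> {(A \<inter> X) \<union> (Y - A) | A X Y. A \<in> {{}, tuples M m} \<and> X \<in> F \<and> Y \<in> F'}"
    proof cases
      case 1
      then have "Z = (tuples M m \<inter> Z) \<union> (Y0 - tuples M m)"
        using unif_subset[OF assms(1)] unif_subset[OF assms(2) \<open>Y0 \<in> F'\<close>] by blast
      then show ?thesis using 1 \<open>Y0 \<in> F'\<close> by blast
    next
      case 2
      then have "Z = ({} \<inter> X0) \<union> (Z - {})" by blast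
      then show ?thesis using 2 \<open>X0 \<in> F\<close> by blast
    qed
  qed
qed (use assms in auto)

end

text \<open>\<open>X\<close> is a union of atoms of the Boolean algebra generated by the
  \<open>A i\<close> inside \<open>U\<close>. For finite \<open>I\<close> this is a semantic way of
  saying that \<open>X\<close> is a Boolean combination of the \<open>A i\<close>.\<close>

definition separated_by :: "'i set \<Rightarrow> ('i \<Rightarrow> 'b set) \<Rightarrow> 'b set \<Rightarrow> 'b set \<Rightarrow> bool" where
  "separated_by I A U X \<longleftrightarrow> X \<subseteq> U \<and>
    (\<forall>x\<in>U. \<forall>y\<in>U. (\<forall>i\<in>I. x \<in> A i \<longleftrightarrow> y \<in> A i) \<longrightarrow> x \<in> X \<longrightarrow> y \<in> X)"

lemma (in nontrivial_struct) unif_boolean_combination: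
  assumes "finite I" "\<And>i. i \<in> I \<Longrightarrow> unif m M (F i)"
  shows "unif m M {X. \<exists>A. (\<forall>i\<in>I. A i \<in> F i) \<and> separated_by I A (tuples M m) X}"
  using assms
proof (induction I rule: finite_induct)
  case empty
  have "X \<in> {{}, tuples M m}" if "separated_by {} A (tuples M m) X" for A :: "'b \<Rightarrow> 'a list set" and X
    using that by (cases "X = {}") (auto simp: separated_by_def)
  then show ?case by (intro unif_mono[OF unif_trivial]) auto
next
  case (insert i I)
  let ?U = "tuples M m"
  define Z where "Z = {X. \<exists>A. (\<forall>i\<in>I. A i \<in> F i) \<and> separated_by I A ?U X}"
  have Z: "unif m M Z" unfolding Z_def by (rule insert.IH) (simp add: insert.prems)
  have i: "unif m M (F i)" by (simp add: insert.prems)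
  show ?case
  proof (rule unif_mono[OF unif_mix[OF i Z Z]], rule subsetI, elim CollectE exE conjE)
    fix X A assume A: "\<forall>j\<in>insert i I. A j \<in> F j" and X: "separated_by (insert i I) A ?U X"
    \<comment> \<open>The saturation of \<open>S\<close> under agreement on the \<open>A j\<close>
      with \<open>j\<close> in \<open>I\<close>. The parts of \<open>X\<close> inside and outside
      \<open>A i\<close> are recovered from their saturations by cutting with
      \<open>A i\<close>.\<close>
    define R where "R S = {y \<in> ?U. \<exists>x\<in>S. \<forall>j\<in>I. x \<in> A j \<longleftrightarrow> y \<in> A j}" for S
    have "X \<subseteq> ?U" using X by (simp add: separated_by_def)
    have "separated_by I A ?U (R S)" for S
      unfolding separated_by_def
    proof (intro conjI ballI impI)
      show "R S \<subseteq> ?U" by (auto simp: R_def)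
      fix x y assume "x \<in> ?U" "y \<in> ?U" and xy: "\<forall>i\<in>I. x \<in> A i \<longleftrightarrow> y \<in> A i" and "x \<in> R S"
      then obtain z where "z \<in> S" "\<forall>j\<in>I. z \<in> A j \<longleftrightarrow> x \<in> A j" by (auto simp: R_def)
      then show "y \<in> R S" using xy \<open>y \<in> ?U\<close> by (auto simp: R_def intro!: bexI[of _ z])
    qed
    then have RZ: "R S \<in> Z" for S using A unfolding Z_def by blast
    have "X = (A i \<inter> R (X \<inter> A i)) \<union> (R (X - A i) - A i)"
    proof
      show "X \<subseteq> (A i \<inter> R (X \<inter> A i)) \<union> (R (X - A i) - A i)"
        using \<open>X \<subseteq> ?U\<close> unfolding R_def by blast
      show "(A i \<inter> R (X \<inter> A i)) \<union> (R (X - A i) - A i) \<subseteq> X"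
      proof
        fix y assume "y \<in> (A i \<inter> R (X \<inter> A i)) \<union> (R (X - A i) - A i)"
        then obtain x where "x \<in> X" "y \<in> ?U" "\<forall>j\<in>insert i I. x \<in> A j \<longleftrightarrow> y \<in> A j"
          unfolding R_def by blast
        then show "y \<in> X" using X \<open>X \<subseteq> ?U\<close> unfolding separated_by_def by blast
      qed
    qed
    then show "X \<in> {(B \<inter> Y) \<union> (Z' - B) | B Y Z'. B \<in> F i \<and> Y \<in> Z \<and> Z' \<in> Z}"
      using A RZ by (intro CollectI exI[of _ "A i"] exI[of _ "R (X \<inter> A i)"] exI[of _ "R (X - A i)"] conjI)
        simp_all
  qed
qed

section \<open>Finite transfer\<close>

text \<open>The same formula with the same parameters from \<open>M\<close>, evaluated in both
  structures. The variable tuple stands first, so that \<open>FEx ^^ k\<close> binds it;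
  elementarity is then used for a single existential formula, in
  \<open>copair_nonempty\<close>.\<close>

definition copair :: "'a lstruct \<Rightarrow> ('a \<Rightarrow> 'b) \<Rightarrow> 'b lstruct \<Rightarrow> nat \<Rightarrow> 'a list set \<Rightarrow> 'b list set \<Rightarrow> bool" where
  "copair M h N k A B \<longleftrightarrow> (\<exists>l p. \<exists>b\<in>tuples M l. fm_in (k + l) p \<and>
     A = {a \<in> tuples M k. sat M (a @ b) p} \<and> B = {a \<in> tuples N k. sat N (a @ map h b) p})"

lemma copair_I:
  assumes "fm_in (l + k) p" "b \<in> tuples M l"
  shows "copair M h N k {a \<in> tuples M k. sat M (b @ a) p} {a \<in> tuples N k. sat N (map h b @ a) p}"
proof -
  define f where "f i = (if i < l then i + k else i - l)" for i
  have "sat P (a @ c) (ren f p) \<longleftrightarrow> sat P (c @ a) p" if "length a = k" "length c = l"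
    for a c and P :: "'c lstruct"
    using that by (intro sat_ren[OF assms(1)]) (auto simp: f_def nth_append)
  note 1 = this
  have "sat P (a @ c) (ren f p) \<longleftrightarrow> sat P (c @ a) p" if "length a = k" "length c = l"
    for a c and P :: "'d lstruct"
    using that by (intro sat_ren[OF assms(1)]) (auto simp: f_def nth_append)
  note 2 = this
  show ?thesis unfolding copair_def
    by (intro exI[of _ l] exI[of _ "ren f p"] bexI[of _ b] conjI fm_in_ren[OF assms(1)])
       (use assms(2) in \<open>auto simp: f_def tuples_def 1 2\<close>)
qed

lemma copair_Diff:
  "copair M h N k A B \<Longrightarrow> copair M h N k (tuples M k - A) (tuples N k - B)"
  unfolding copair_def
proof (elim exE bexE conjE)
  fix l p b
  assume "fm_in (k + l) p" "b \<in> tuples M l"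
    "A = {a \<in> tuples M k. sat M (a @ b) p}" "B = {a \<in> tuples N k. sat N (a @ map h b) p}"
  then show "\<exists>l p. \<exists>b\<in>tuples M l. fm_in (k + l) p \<and>
     tuples M k - A = {a \<in> tuples M k. sat M (a @ b) p} \<and>
     tuples N k - B = {a \<in> tuples N k. sat N (a @ map h b) p}"
    by (intro exI[of _ l] exI[of _ "FNot p"] bexI[of _ b]) auto
qed

lemma copair_Int:
  assumes "copair M h N k A B" "copair M h N k A' B'"
  shows "copair M h N k (A \<inter> A') (B \<inter> B')"
proof -
  obtain l p b where p: "fm_in (k + l) p" "b \<in> tuples M l"
    "A = {a \<in> tuples M k. sat M (a @ b) p}" "B = {a \<in> tuples N k. sat N (a @ map h b) p}"
    using assms by (auto simp: copair_def)
  obtain l' p' b' where p': "fm_in (k + l') p'" "b' \<in> tuples M l'"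
    "A' = {a \<in> tuples M k. sat M (a @ b') p'}" "B' = {a \<in> tuples N k. sat N (a @ map h b') p'}"
    using assms by (auto simp: copair_def)
  define f where "f i = (if i < k then i else i + l)" for i
  have f: "fm_in (k + (l + l')) (FAnd p (ren f p'))"
    using p p' by (auto intro: fm_in_mono intro!: fm_in_ren simp: f_def)
  have 1: "sat M (a @ b @ b') p \<longleftrightarrow> sat M (a @ b) p"
    "sat M (a @ b @ b') (ren f p') \<longleftrightarrow> sat M (a @ b') p'" if "length a = k" for a
    using p(2) that by (auto intro!: sat_cong[OF p(1)] sat_ren[OF p'(1)]
      simp: f_def nth_append tuples_def)
  have 2: "sat N (a @ map h b @ map h b') p \<longleftrightarrow> sat N (a @ map h b) p"
    "sat N (a @ map h b @ map h b') (ren f p') \<longleftrightarrow> sat N (a @ map h b') p'" if "length a = k" for a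
    using p(2) that by (auto intro!: sat_cong[OF p(1)] sat_ren[OF p'(1)]
      simp: f_def nth_append tuples_def)
  show ?thesis unfolding copair_def
    by (intro exI[of _ "l + l'"] exI[of _ "FAnd p (ren f p')"] bexI[of _ "b @ b'"] conjI f)
       (use p p' in \<open>auto simp: 1 2 tuples_append tuples_length\<close>)
qed

lemma copair_nonempty:
  assumes "elementary_extension M h N" "copair M h N k A B" "B \<noteq> {}"
  shows "A \<noteq> {}"
proof -
  obtain l p b where p: "fm_in (k + l) p" "b \<in> tuples M l"
    "A = {a \<in> tuples M k. sat M (a @ b) p}" "B = {a \<in> tuples N k. sat N (a @ map h b) p}"
    using assms by (auto simp: copair_def)
  have "sat N (map h b) ((FEx ^^ k) p)" using assms(3) p by (auto simp: sat_FEx_pow)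
  then have "sat M b ((FEx ^^ k) p)"
    using assms(1) p fm_in_FEx_pow[of l k p] unfolding elementary_extension_def by blast
  then show ?thesis using p by (auto simp: sat_FEx_pow)
qed

text \<open>For each pair in \<open>P\<close> take the formula or its negation, whichever
  \<open>a\<close> satisfies. The conjunction is satisfiable in \<open>N\<close>, hence in
  \<open>M\<close>. It is formed semantically, by intersecting copairs.\<close>

lemma finite_transfer:
  assumes "elementary_extension M h N" "finite P" "a \<in> tuples N k"
    and "\<And>p b. (p, b) \<in> P \<Longrightarrow> set b \<subseteq> Dom M \<and> fm_in (length b + k) p"
  shows "\<exists>a'\<in>tuples M k. \<forall>(p, b)\<in>P. sat M (b @ a') p \<longleftrightarrow> sat N (map h b @ a) p"
proof -
  have "\<exists>A B. copair M h N k A B \<and> a \<in> B \<and>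
    (\<forall>a'\<in>A. a' \<in> tuples M k \<and> (\<forall>(p, b)\<in>P. sat M (b @ a') p \<longleftrightarrow> sat N (map h b @ a) p))"
    using assms(2,4)
  proof (induction P rule: finite_induct)
    case empty
    have "copair M h N k (tuples M k) (tuples N k)"
      using copair_I[of 0 k "FEq TZero TZero" "[]" M h N] by simp
    then show ?case using assms(3) by auto
  next
    case (insert q P)
    have "\<exists>A B. copair M h N k A B \<and> a \<in> B \<and>
      (\<forall>a'\<in>A. a' \<in> tuples M k \<and> (\<forall>(p, b)\<in>P. sat M (b @ a') p \<longleftrightarrow> sat N (map h b @ a) p))"
      by (rule insert.IH, rule insert.prems, rule insertI2)
    then obtain A B where AB: "copair M h N k A B" "a \<in> B"
      "\<And>a'. a' \<in> A \<Longrightarrow> a' \<in> tuples M k"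
      "\<And>a'. a' \<in> A \<Longrightarrow> \<forall>(p, b)\<in>P. sat M (b @ a') p \<longleftrightarrow> sat N (map h b @ a) p"
      by (elim exE conjE) simp
    obtain p b where q: "q = (p, b)" by fastforce
    let ?A = "{a \<in> tuples M k. sat M (b @ a) p}" and ?B = "{a \<in> tuples N k. sat N (map h b @ a) p}"
    have c: "copair M h N k ?A ?B"
      using insert.prems[of p b] q by (intro copair_I[of "length b"]) (auto simp: tuples_def)
    show ?case
    proof (cases "sat N (map h b @ a) p")
      case True
      then show ?thesis using AB assms(3) q
        by (intro exI[of _ "A \<inter> ?A"] exI[of _ "B \<inter> ?B"] conjI copair_Int[OF AB(1) c]) auto
    next
      case False
      then show ?thesis using AB assms(3) q
        by (intro exI[of _ "A \<inter> (tuples M k - ?A)"] exI[of _ "B \<inter> (tuples N k - ?B)"] conjI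
            copair_Int[OF AB(1) copair_Diff[OF c]]) auto
    qed
  qed
  then obtain A B where AB: "copair M h N k A B" "a \<in> B"
    "\<forall>a'\<in>A. a' \<in> tuples M k \<and> (\<forall>(p, b)\<in>P. sat M (b @ a') p \<longleftrightarrow> sat N (map h b @ a) p)" by blast
  then have "A \<noteq> {}" using copair_nonempty[OF assms(1) AB(1)] by blast
  then show ?thesis using AB by blast
qed


section \<open>The groups\<close>

definition lexless :: "(nat \<Rightarrow> real) \<Rightarrow> (nat \<Rightarrow> real) \<Rightarrow> bool" where
  "lexless x y \<longleftrightarrow> (\<exists>i. x i < y i \<and> (\<forall>j<i. x j = y j))"

text \<open>Sequences vanishing beyond \<open>n\<close>, rather than lists: dropping the first
  coordinate is an index shift into the group with one integer coordinate less. The inductions on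
  \<open>n\<close> use this together with \<open>lexless_Suc\<close>.\<close>

definition lex_grp :: "nat \<Rightarrow> real set \<Rightarrow> (nat \<Rightarrow> real) lstruct" where
  "lex_grp n T =
     \<lparr> Dom = {x. (\<forall>i<n. x i \<in> \<int>) \<and> x n \<in> T \<and> (\<forall>i>n. x i = 0)},
       zero_of = (\<lambda>_. 0),
       plus_of = (\<lambda>x y i. x i + y i),
       neg_of = (\<lambda>x i. - x i),
       less_of = lexless \<rparr>"

lemma lex_grp_simps [simp]:
  "zero_of (lex_grp n T) = (\<lambda>_. 0)"
  "plus_of (lex_grp n T) x y = (\<lambda>i. x i + y i)"
  "neg_of (lex_grp n T) x = (\<lambda>i. - x i)"
  "less_of (lex_grp n T) = lexless"
  by (simp_all add: lex_grp_def)

lemma Dom_lex_grp: "x \<in> Dom (lex_grp n T) \<longleftrightarrow> (\<forall>i<n. x i \<in> \<int>) \<and> x n \<in> T \<and> (\<forall>i>n. x i = 0)"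
  by (simp add: lex_grp_def)

lemma lexless_irrefl [simp]: "\<not> lexless x x"
  by (simp add: lexless_def)

lemma lexless_trans: "lexless x y \<Longrightarrow> lexless y z \<Longrightarrow> lexless x z"
  unfolding lexless_def
proof (elim exE conjE)
  fix i j assume h: "x i < y i" "\<forall>k<i. x k = y k" "y j < z j" "\<forall>k<j. y k = z k"
  have "x (min i j) < z (min i j)"
  proof (cases i j rule: linorder_cases)
    case less then show ?thesis using h(1) h(4)[rule_format, of i] by simp
  next
    case equal then show ?thesis using h(1,3) by simp
  next
    case greater then show ?thesis using h(3) h(2)[rule_format, of j] by simp
  qed
  moreover have "\<forall>k<min i j. x k = z k" using h(2,4) by simp
  ultimately show "\<exists>i. x i < z i \<and> (\<forall>j<i. x j = z j)" by blast
qed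

lemma lexless_linear: "lexless x y \<or> x = y \<or> lexless y x"
proof (cases "x = y")
  case False
  then obtain k where k: "x k \<noteq> y k" by auto
  define i where "i = (LEAST i. x i \<noteq> y i)"
  have "x i \<noteq> y i" unfolding i_def by (rule LeastI[of "\<lambda>i. x i \<noteq> y i", OF k])
  moreover have eq: "x j = y j" if "j < i" for j
    using not_less_Least[of j "\<lambda>i. x i \<noteq> y i"] that unfolding i_def by blast
  moreover have "lexless x y" if "x i < y i"
    unfolding lexless_def using that eq by blast
  moreover have "lexless y x" if "y i < x i"
    unfolding lexless_def using that eq[symmetric] by blast
  ultimately show ?thesis by linarith
qed simp

lemma lexless_not_sym: "lexless x y \<Longrightarrow> \<not> lexless y x"
  using lexless_trans lexless_irrefl by blast

lemma lexless_0: "lexless x y \<longleftrightarrow> lexless (\<lambda>_. 0) (\<lambda>i. y i - x i)"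
  by (auto simp: lexless_def)

lemma lexless_mult: "(c::real) > 0 \<Longrightarrow> lexless (\<lambda>i. c * x i) (\<lambda>i. c * y i) \<longleftrightarrow> lexless x y"
  by (simp add: lexless_def)

lemma lexless_Suc:
  "lexless x y \<longleftrightarrow> x 0 < y 0 \<or> x 0 = y 0 \<and> lexless (\<lambda>i. x (Suc i)) (\<lambda>i. y (Suc i))"
proof
  assume "lexless x y"
  then obtain i where i: "x i < y i" "\<forall>j<i. x j = y j" by (auto simp: lexless_def)
  show "x 0 < y 0 \<or> x 0 = y 0 \<and> lexless (\<lambda>i. x (Suc i)) (\<lambda>i. y (Suc i))"
  proof (cases i)
    case (Suc k)
    then show ?thesis using i by (auto simp: lexless_def)
  qed (use i in simp)
next
  assume "x 0 < y 0 \<or> x 0 = y 0 \<and> lexless (\<lambda>i. x (Suc i)) (\<lambda>i. y (Suc i))"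
  then show "lexless x y"
  proof
    assume "x 0 = y 0 \<and> lexless (\<lambda>i. x (Suc i)) (\<lambda>i. y (Suc i))"
    then obtain i where i: "x 0 = y 0" "x (Suc i) < y (Suc i)" "\<forall>j<i. x (Suc j) = y (Suc j)"
      by (auto simp: lexless_def)
    have "x j = y j" if "j < Suc i" for j using i that by (cases j) auto
    then show ?thesis using i(2) by (auto simp: lexless_def)
  qed (auto simp: lexless_def)
qed

section \<open>Elimination of quantifiers\<close>

text \<open>A gap longer than \<open>m\<close> may have a different length on the other side, so
  \<open>w\<close> cannot be copied at its true distance. It is placed at distance at most
  \<open>m\<close> from the image of its nearest neighbour; the distances \<open>1, ..., m\<close>
  already realise every residue, and comparisons at offsets up to \<open>m\<close> are
  preserved.\<close>

lemma int_gap: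
  fixes f g :: "'i \<Rightarrow> int"
  assumes "finite J" "m > 0"
    and fg: "\<And>i j d. i \<in> J \<Longrightarrow> j \<in> J \<Longrightarrow> \<bar>d\<bar> \<le> m \<Longrightarrow> 0 < f i - f j + d \<longleftrightarrow> 0 < g i - g j + d"
    and cong: "\<And>i. i \<in> J \<Longrightarrow> m dvd f i - g i"
    and w: "\<And>i. i \<in> J \<Longrightarrow> f i \<noteq> w"
  shows "\<exists>w'. m dvd w - w' \<and> (\<forall>i\<in>J. (f i < w \<longleftrightarrow> g i < w') \<and> (w < f i \<longleftrightarrow> w' < g i))"
proof -
  have fin: "finite {i \<in> J. f i < w}" using assms(1) by simp
  consider (below) "{i \<in> J. f i < w} \<noteq> {}" | (above) "J \<noteq> {}" "{i \<in> J. f i < w} = {}" | "J = {}" by blast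
  then show ?thesis
  proof cases
    case below
    define a where "a = Max (f ` {i \<in> J. f i < w})"
    have "a \<in> f ` {i \<in> J. f i < w}" unfolding a_def using fin below by (intro Max_in) auto
    then obtain k where k: "k \<in> J" "f k < w" "a = f k" by auto
    have a: "f i \<le> f k" if "i \<in> J" "f i < w" for i
      unfolding k(3)[symmetric] a_def using fin that by (intro Max_ge) auto
    \<comment> \<open>The representative of \<open>w - f k\<close> in \<open>{1..m}\<close>: zero
      must be avoided, and since \<open>w - f k\<close> is positive, \<open>d\<close> does not
      exceed it, so \<open>f k + d\<close> has not jumped over any \<open>f i\<close> above
      \<open>w\<close>.\<close>
    define d where "d = (w - f k - 1) mod m + 1"
    have d: "1 \<le> d" "d \<le> m" "d \<le> w - f k"
      using assms(2) k(2) pos_mod_sign[of m] pos_mod_bound[of m] zmod_le_nonneg_dividend[of "w - f k - 1" m]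
      by (auto simp: d_def add1_zle_eq)
    have "m dvd (w - f k) - d"
      using dvd_minus_mod[of m "w - f k - 1"] by (simp add: d_def algebra_simps)
    then have "m dvd ((w - f k) - d) + (f k - g k)" using cong[OF k(1)] by (rule dvd_add)
    then have c: "m dvd w - (g k + d)" by (simp add: algebra_simps)
    have "(f i < w \<longleftrightarrow> g i < g k + d) \<and> (w < f i \<longleftrightarrow> g k + d < g i)" if i: "i \<in> J" for i
    proof (cases "f i < w")
      case True
      then have "f i \<le> f k" using a i by blast
      then have "0 < f k - f i + d" using d by simp
      then have "0 < g k - g i + d" using fg[OF k(1) i, of d] d by simp
      then show ?thesis using True by auto
    next
      case False
      then have "f i > w" using w[OF i] by simp
      then have "0 < f i - f k + (-d)" using d by simp
      then have "0 < g i - g k + (-d)" using fg[OF i k(1), of "-d"] d by simp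
      then show ?thesis using False \<open>f i > w\<close> by auto
    qed
    then show ?thesis using c by blast
  next
    case above
    have up: "w < f i" if "i \<in> J" for i using above(2) w[OF that] that by force
    define a where "a = Min (f ` J)"
    have "a \<in> f ` J" unfolding a_def using assms(1) above by (intro Min_in) auto
    then obtain k where k: "k \<in> J" "a = f k" by auto
    have a: "f k \<le> f i" if "i \<in> J" for i
      unfolding k(2)[symmetric] a_def using assms(1) that by (intro Min_le) auto
    \<comment> \<open>Nothing lies below \<open>w\<close>, so the point is placed below the image of
      the smallest \<open>f i\<close>, at the distance in \<open>{1..m}\<close> with the right
      residue.\<close>
    define d where "d = (f k - w - 1) mod m + 1"
    have d: "1 \<le> d" "d \<le> m"
      using assms(2) pos_mod_sign[of m] pos_mod_bound[of m]
      by (auto simp: d_def add1_zle_eq)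
    have "m dvd (f k - w) - d"
      using dvd_minus_mod[of m "f k - w - 1"] by (simp add: d_def algebra_simps)
    from dvd_diff[OF cong[OF k(1)] this] have "m dvd (f k - g k) - ((f k - w) - d)" .
    then have c: "m dvd w - (g k - d)" by (simp add: algebra_simps)
    have "g k - d < g i" if i: "i \<in> J" for i
    proof -
      have "0 < f i - f k + d" using a[OF i] d by simp
      then have "0 < g i - g k + d" using fg[OF i k(1), of d] d by simp
      then show ?thesis by simp
    qed
    then show ?thesis using c up by (intro exI[of _ "g k - d"]) force
  next
    case 3
    then show ?thesis by (intro exI[of _ w]) simp
  qed
qed

text \<open>For the last coordinate order alone matters, because the reals are dense and have no
  endpoints.\<close>

lemma real_gap:
  fixes f g :: "'i \<Rightarrow> real"
  assumes J: "finite J" and fg: "\<And>i j. i \<in> J \<Longrightarrow> j \<in> J \<Longrightarrow> f i < f j \<longleftrightarrow> g i < g j"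
  shows "\<exists>w'. \<forall>i\<in>J. (f i < w \<longleftrightarrow> g i < w') \<and> (w < f i \<longleftrightarrow> w' < g i)"
proof (cases "\<exists>j\<in>J. f j = w")
  case True
  then obtain j where "j \<in> J" "f j = w" by blast
  then show ?thesis using fg by (intro exI[of _ "g j"]) auto
next
  case False
  define L where "L = g ` {i \<in> J. f i < w}"
  define U where "U = g ` {i \<in> J. w < f i}"
  have fin: "finite L" "finite U" using J by (auto simp: L_def U_def)
  have LU: "l < u" if "l \<in> L" "u \<in> U" for l u using that fg by (force simp: L_def U_def)
  have "\<exists>w'. (\<forall>l\<in>L. l < w') \<and> (\<forall>u\<in>U. w' < u)"
  proof -
    consider "L = {}" "U = {}" | "L = {}" "U \<noteq> {}" | "L \<noteq> {}" "U = {}" | "L \<noteq> {}" "U \<noteq> {}" by blast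
    then show ?thesis
    proof cases
      case 2
      have "Min U - 1 < u" if "u \<in> U" for u using Min_le[OF fin(2) that] by simp
      then show ?thesis using 2 by blast
    next
      case 3
      have "l < Max L + 1" if "l \<in> L" for l using Max_ge[OF fin(1) that] by simp
      then show ?thesis using 3 by blast
    next
      case 4
      have m: "Max L < Min U" using LU Max_in[OF fin(1) 4(1)] Min_in[OF fin(2) 4(2)] by blast
      have "l < (Max L + Min U) / 2" if "l \<in> L" for l using Max_ge[OF fin(1) that] m by simp
      moreover have "(Max L + Min U) / 2 < u" if "u \<in> U" for u using Min_le[OF fin(2) that] m by simp
      ultimately show ?thesis by blast
    qed blast
  qed
  then obtain w' where w': "\<And>l. l \<in> L \<Longrightarrow> l < w'" "\<And>u. u \<in> U \<Longrightarrow> w' < u" by blast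
  have "(f i < w \<longleftrightarrow> g i < w') \<and> (w < f i \<longleftrightarrow> w' < g i)" if "i \<in> J" for i
  proof -
    from False that consider "f i < w" | "w < f i" by (metis linorder_neqE)
    then show ?thesis
    proof cases
      case 1
      then show ?thesis using w'(1)[of "g i"] that by (auto simp: L_def)
    next
      case 2
      then show ?thesis using w'(2)[of "g i"] that by (auto simp: U_def)
    qed
  qed
  then show ?thesis by blast
qed

section \<open>Congruences between integer coordinates, stored as reals\<close>

definition real_cong :: "int \<Rightarrow> real \<Rightarrow> real \<Rightarrow> bool" where
  "real_cong m a b \<longleftrightarrow> (\<exists>q::int. a - b = of_int m * of_int q)"

lemma real_cong_refl [simp]: "real_cong m a a"
  by (auto simp: real_cong_def intro: exI[of _ 0])

lemma real_cong_sym: "real_cong m a b \<Longrightarrow> real_cong m b a"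
proof -
  assume "real_cong m a b"
  then obtain q :: int where "a - b = of_int m * of_int q" by (auto simp: real_cong_def)
  then have "b - a = of_int m * of_int (- q)" by simp
  then show ?thesis unfolding real_cong_def by blast
qed

lemma real_cong_add: "real_cong m a b \<Longrightarrow> real_cong m c d \<Longrightarrow> real_cong m (a + c) (b + d)"
proof -
  assume "real_cong m a b" "real_cong m c d"
  then obtain q r :: int where "a - b = of_int m * of_int q" "c - d = of_int m * of_int r"
    by (auto simp: real_cong_def)
  then have "(a + c) - (b + d) = of_int m * of_int (q + r)" by (simp add: algebra_simps)
  then show ?thesis unfolding real_cong_def by blast
qed

lemma real_cong_mult: "real_cong m a b \<Longrightarrow> real_cong m (of_int c * a) (of_int c * b)"
proof -
  assume "real_cong m a b"
  then obtain q :: int where "a - b = of_int m * of_int q" by (auto simp: real_cong_def)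
  then have "of_int c * a - of_int c * b = of_int m * of_int (c * q)"
    by (simp flip: right_diff_distrib)
  then show ?thesis unfolding real_cong_def by blast
qed

lemma real_cong_trans: "real_cong m a b \<Longrightarrow> real_cong m b c \<Longrightarrow> real_cong m a c"
  using real_cong_add[of m a b b c] by (simp add: real_cong_def)

lemma real_cong_sum: "(\<And>j. j \<in> J \<Longrightarrow> real_cong m (f j) (g j)) \<Longrightarrow> real_cong m (sum f J) (sum g J)"
  by (induction J rule: infinite_finite_induct) (auto intro: real_cong_add)

lemma real_cong_dvd: "real_cong m a b \<Longrightarrow> k dvd m \<Longrightarrow> real_cong k a b"
proof -
  assume "real_cong m a b" "k dvd m"
  then obtain q r :: int where "a - b = of_int m * of_int q" "m = k * r"
    unfolding real_cong_def dvd_def by (elim exE)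
  then have "a - b = of_int k * of_int (r * q)" by simp
  then show ?thesis unfolding real_cong_def by blast
qed

lemma real_cong_of_int: "real_cong m (of_int a) (of_int b) \<longleftrightarrow> m dvd a - b"
proof
  assume "real_cong m (of_int a) (of_int b)"
  then obtain q :: int where "(of_int a :: real) - of_int b = of_int m * of_int q" by (auto simp: real_cong_def)
  then have "(of_int (a - b) :: real) = of_int (m * q)" by simp
  then show "m dvd a - b" unfolding of_int_eq_iff by simp
next
  assume "m dvd a - b"
  then obtain q where "a - b = m * q" by (elim dvdE)
  then have "(of_int a :: real) - of_int b = of_int m * of_int q" by (simp flip: of_int_diff of_int_mult)
  then show "real_cong m (of_int a) (of_int b)" unfolding real_cong_def by blast
qed

text \<open>\<open>x\<close> and \<open>y\<close> stand for differences of two points on either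
  side. The conditions are those that \<open>int_gap\<close> and \<open>real_gap\<close> ask for:
  integer coordinates are compared up to offsets of size \<open>m\<close>, the last coordinate only
  by sign, and tails matter only where the first coordinates coincide.\<close>

fun near :: "nat \<Rightarrow> int \<Rightarrow> (nat \<Rightarrow> real) \<Rightarrow> (nat \<Rightarrow> real) \<Rightarrow> bool" where
  "near 0 m x y \<longleftrightarrow> (0 < x 0 \<longleftrightarrow> 0 < y 0)"
| "near (Suc n) m x y \<longleftrightarrow>
     (\<forall>d::int. \<bar>d\<bar> \<le> m \<longrightarrow> (0 < x 0 + of_int d \<longleftrightarrow> 0 < y 0 + of_int d)) \<and>
     (x 0 = 0 \<and> y 0 = 0 \<longrightarrow> near n m (\<lambda>i. x (Suc i)) (\<lambda>i. y (Suc i)))"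

text \<open>
  By recursion on the coordinates: if \<open>w\<close> has the same first coordinate as some \<open>u j\<close>, the
  problem reduces to the tails of these \<open>u j\<close>; otherwise only the first coordinate matters.
\<close>

lemma lex_grp_gap:
  assumes "finite J" "m > 0" "T = {0} \<or> T = UNIV"
    and "\<And>j. j \<in> J \<Longrightarrow> u j \<in> Dom (lex_grp n T)" "\<And>j. j \<in> J \<Longrightarrow> v j \<in> Dom (lex_grp n T)"
    and "\<And>j i. j \<in> J \<Longrightarrow> i < n \<Longrightarrow> real_cong m (u j i) (v j i)"
    and "\<And>i j. i \<in> J \<Longrightarrow> j \<in> J \<Longrightarrow> near n m (\<lambda>l. u i l - u j l) (\<lambda>l. v i l - v j l)"
    and "w \<in> Dom (lex_grp n T)"
  shows "\<exists>w'\<in>Dom (lex_grp n T). (\<forall>i<n. real_cong m (w i) (w' i)) \<and>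
    (\<forall>j\<in>J. (lexless (u j) w \<longleftrightarrow> lexless (v j) w') \<and> (lexless w (u j) \<longleftrightarrow> lexless w' (v j)))"
  using assms(1,4-)
proof (induction n arbitrary: J u v w)
  case 0
  have lex: "lexless x y \<longleftrightarrow> x 0 < y 0"
    if "x \<in> Dom (lex_grp 0 T)" "y \<in> Dom (lex_grp 0 T)" for x y
  proof -
    have "x (Suc i) = 0" "y (Suc i) = 0" for i using that by (simp_all add: Dom_lex_grp)
    then show ?thesis by (subst lexless_Suc) simp
  qed
  show ?case
  proof (cases "T = {0}")
    case True
    have D0: "x = (\<lambda>_. 0)" if "x \<in> Dom (lex_grp 0 T)" for x
    proof
      fix i show "x i = 0" using that True by (cases i) (simp_all add: Dom_lex_grp)
    qed
    have "u j = w" "v j = w" if "j \<in> J" for j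
      using D0[OF 0(2)[OF that]] D0[OF 0(3)[OF that]] D0[OF 0(6)] by simp_all
    then show ?thesis using 0(6) by (intro bexI[of _ w]) auto
  next
    case False
    then have T: "T = UNIV" using assms by blast
    have "\<exists>r. \<forall>i\<in>J. (u i 0 < w 0 \<longleftrightarrow> v i 0 < r) \<and> (w 0 < u i 0 \<longleftrightarrow> r < v i 0)"
      by (rule real_gap[OF 0(1)]) (use 0(5) in simp)
    then obtain r where r: "\<forall>i\<in>J. (u i 0 < w 0 \<longleftrightarrow> v i 0 < r) \<and> (w 0 < u i 0 \<longleftrightarrow> r < v i 0)" ..
    let ?w = "case_nat r (\<lambda>_. 0) :: nat \<Rightarrow> real"
    have w: "?w \<in> Dom (lex_grp 0 T)" by (auto simp: Dom_lex_grp T split: nat.split)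
    show ?thesis
    proof (intro bexI[OF _ w] conjI ballI)
      fix j assume "j \<in> J"
      then show "lexless (u j) w \<longleftrightarrow> lexless (v j) ?w" "lexless w (u j) \<longleftrightarrow> lexless ?w (v j)"
        using lex[OF 0(2) 0(6), of j] lex[OF 0(3) w, of j] lex[OF 0(6) 0(2), of j] lex[OF w 0(3), of j] r
        by simp_all
    qed simp
  qed
next
  case (Suc n)
  have tail: "(\<lambda>i. x (Suc i)) \<in> Dom (lex_grp n T)" if "x \<in> Dom (lex_grp (Suc n) T)" for x
    using that by (simp add: Dom_lex_grp)
  have cons: "case_nat a x \<in> Dom (lex_grp (Suc n) T)" if "a \<in> \<int>" "x \<in> Dom (lex_grp n T)" for a x
    using that by (auto simp: Dom_lex_grp split: nat.split)
  have near: "0 < u i 0 - u j 0 + of_int d \<longleftrightarrow> 0 < v i 0 - v j 0 + of_int d"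
    if "i \<in> J" "j \<in> J" "\<bar>d\<bar> \<le> m" for i j d
    using Suc.prems(5)[OF that(1,2)] that(3) by simp
  have near0: "u j 0 < u i 0 \<longleftrightarrow> v j 0 < v i 0" if "i \<in> J" "j \<in> J" for i j
    using near[OF that, of 0] assms(2) by simp
  show ?case
  proof (cases "\<exists>j\<in>J. u j 0 = w 0")
    case False
    define f where "f j = \<lfloor>u j 0\<rfloor>" for j
    define g where "g j = \<lfloor>v j 0\<rfloor>" for j
    have f: "u j 0 = of_int (f j)" "v j 0 = of_int (g j)" if "j \<in> J" for j
      using Suc.prems(2,3)[OF that] by (auto simp: Dom_lex_grp f_def g_def)
    have w: "w 0 = of_int \<lfloor>w 0\<rfloor>" using Suc.prems(6) by (auto simp: Dom_lex_grp)
    have "\<exists>w'. m dvd \<lfloor>w 0\<rfloor> - w' \<and> (\<forall>i\<in>J. (f i < \<lfloor>w 0\<rfloor> \<longleftrightarrow> g i < w') \<and> (\<lfloor>w 0\<rfloor> < f i \<longleftrightarrow> w' < g i))"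
    proof (rule int_gap[OF Suc.prems(1) assms(2)])
      fix i j and d :: int assume h: "i \<in> J" "j \<in> J" "\<bar>d\<bar> \<le> m"
      have "(0::real) < of_int (f i - f j + d) \<longleftrightarrow> (0::real) < of_int (g i - g j + d)"
        using near[OF h] f[OF h(1)] f[OF h(2)] by simp
      then show "0 < f i - f j + d \<longleftrightarrow> 0 < g i - g j + d" by (simp only: of_int_0_less_iff)
    next
      fix i assume "i \<in> J"
      then show "m dvd f i - g i"
        using Suc.prems(4)[of i 0] f[of i] by (simp add: real_cong_of_int)
      show "f i \<noteq> \<lfloor>w 0\<rfloor>" using False f[OF \<open>i \<in> J\<close>] w \<open>i \<in> J\<close> by auto
    qed
    then obtain a where a: "m dvd \<lfloor>w 0\<rfloor> - a"
      "\<forall>i\<in>J. (f i < \<lfloor>w 0\<rfloor> \<longleftrightarrow> g i < a) \<and> (\<lfloor>w 0\<rfloor> < f i \<longleftrightarrow> a < g i)" by blast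
    \<comment> \<open>The first coordinate of \<open>w\<close> differs from that of every
      \<open>u j\<close>, and \<open>a\<close> from that of every \<open>v j\<close>. So the tail
      does not affect comparisons, and keeping the tail of \<open>w\<close> keeps its
      residues.\<close>
    let ?w = "case_nat (of_int a) (\<lambda>i. w (Suc i)) :: nat \<Rightarrow> real"
    show ?thesis
    proof (intro bexI[of _ ?w] conjI ballI allI impI)
      show "?w \<in> Dom (lex_grp (Suc n) T)" using tail[OF Suc.prems(6)] by (intro cons) simp_all
      fix i assume "i < Suc n"
      show "real_cong m (w i) (?w i)"
      proof (cases i)
        case 0
        then show ?thesis using a(1) real_cong_of_int[of m "\<lfloor>w 0\<rfloor>" a] w by simp
      qed simp
    next
      fix j assume j: "j \<in> J"
      have "f j < \<lfloor>w 0\<rfloor> \<longleftrightarrow> g j < a" "\<lfloor>w 0\<rfloor> < f j \<longleftrightarrow> a < g j" using a(2) j by blast+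
      then have "(of_int (f j) :: real) < of_int \<lfloor>w 0\<rfloor> \<longleftrightarrow> (of_int (g j) :: real) < of_int a"
        "(of_int \<lfloor>w 0\<rfloor> :: real) < of_int (f j) \<longleftrightarrow> (of_int a :: real) < of_int (g j)"
        by (simp_all only: of_int_less_iff)
      then have c: "u j 0 < w 0 \<longleftrightarrow> v j 0 < of_int a" "w 0 < u j 0 \<longleftrightarrow> of_int a < v j 0"
        using f[OF j] w by simp_all
      have ne: "u j 0 \<noteq> w 0" "v j 0 \<noteq> of_int a" using False j c by (auto simp: neq_iff)
      show "lexless (u j) w \<longleftrightarrow> lexless (v j) ?w" "lexless w (u j) \<longleftrightarrow> lexless ?w (v j)"
        using c ne by (simp_all add: lexless_Suc[of "u j" w] lexless_Suc[of "v j" ?w]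
          lexless_Suc[of w "u j"] lexless_Suc[of ?w "v j"])
    qed
  next
    case True
    then obtain k where k: "k \<in> J" "u k 0 = w 0" by blast
    \<comment> \<open>All \<open>u j\<close> with \<open>j\<close> in \<open>I\<close> share their
      first coordinate, and so do the corresponding \<open>v j\<close>; hence \<open>near\<close>
      speaks about the tails of their differences.\<close>
    define I where "I = {j \<in> J. u j 0 = w 0}"
    have I: "j \<in> J" "u j 0 = w 0" "v j 0 = v k 0" if "j \<in> I" for j
      using that near0[OF k(1), of j] near0[OF _ k(1), of j] k(2) by (auto simp: I_def)
    have "\<exists>w'\<in>Dom (lex_grp n T). (\<forall>i<n. real_cong m (w (Suc i)) (w' i)) \<and>
      (\<forall>j\<in>I. (lexless (\<lambda>i. u j (Suc i)) (\<lambda>i. w (Suc i)) \<longleftrightarrow> lexless (\<lambda>i. v j (Suc i)) w') \<and>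
        (lexless (\<lambda>i. w (Suc i)) (\<lambda>i. u j (Suc i)) \<longleftrightarrow> lexless w' (\<lambda>i. v j (Suc i))))"
    proof (rule Suc.IH)
      show "finite I" using Suc.prems(1) by (simp add: I_def)
      show "(\<lambda>i. w (Suc i)) \<in> Dom (lex_grp n T)" using Suc.prems(6) by (rule tail)
      fix j assume j: "j \<in> I"
      show "(\<lambda>i. u j (Suc i)) \<in> Dom (lex_grp n T)" "(\<lambda>i. v j (Suc i)) \<in> Dom (lex_grp n T)"
        using Suc.prems(2,3) I(1)[OF j] tail by blast+
      show "real_cong m (u j (Suc i)) (v j (Suc i))" if "i < n" for i
        using Suc.prems(4)[OF I(1)[OF j], of "Suc i"] that by simp
      fix i assume i: "i \<in> I"
      show "near n m (\<lambda>l. u i (Suc l) - u j (Suc l)) (\<lambda>l. v i (Suc l) - v j (Suc l))"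
        using Suc.prems(5)[OF I(1)[OF i] I(1)[OF j]] I[OF i] I[OF j] by simp
    qed
    then obtain w' where w': "w' \<in> Dom (lex_grp n T)" "\<forall>i<n. real_cong m (w (Suc i)) (w' i)"
      "\<And>j. j \<in> I \<Longrightarrow> lexless (\<lambda>i. u j (Suc i)) (\<lambda>i. w (Suc i)) \<longleftrightarrow> lexless (\<lambda>i. v j (Suc i)) w'"
      "\<And>j. j \<in> I \<Longrightarrow> lexless (\<lambda>i. w (Suc i)) (\<lambda>i. u j (Suc i)) \<longleftrightarrow> lexless w' (\<lambda>i. v j (Suc i))"
      by blast
    \<comment> \<open>\<open>v k 0\<close> is congruent to \<open>u k 0\<close>, which equals
      \<open>w 0\<close>.\<close>
    let ?w = "case_nat (v k 0) w'"
    show ?thesis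
    proof (intro bexI[of _ ?w] conjI ballI allI impI)
      show "?w \<in> Dom (lex_grp (Suc n) T)" using Suc.prems(3)[OF k(1)] w'(1)
        by (intro cons) (simp_all add: Dom_lex_grp)
      fix i assume "i < Suc n"
      then show "real_cong m (w i) (?w i)"
        using Suc.prems(4)[OF k(1), of 0] k(2) w'(2) by (cases i) simp_all
    next
      fix j assume j: "j \<in> J"
      show "lexless (u j) w \<longleftrightarrow> lexless (v j) ?w"
        using near0[OF k(1) j] near0[OF j k(1)] k(2) w'(3)[of j] j
        by (auto simp: lexless_Suc[of "u j" w] lexless_Suc[of "v j" ?w] I_def)
      show "lexless w (u j) \<longleftrightarrow> lexless ?w (v j)"
        using near0[OF k(1) j] near0[OF j k(1)] k(2) w'(4)[of j] j
        by (auto simp: lexless_Suc[of w "u j"] lexless_Suc[of ?w "v j"] I_def)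
    qed
  qed
qed


section \<open>Bounded integer vectors and the back-and-forth step\<close>

definition int_vec :: "nat \<Rightarrow> nat \<Rightarrow> (nat \<Rightarrow> int) \<Rightarrow> bool" where
  "int_vec k B c \<longleftrightarrow> (\<forall>j. \<bar>c j\<bar> \<le> int B) \<and> (\<forall>j\<ge>k. c j = 0)"

lemma finite_int_vec: "finite {c. int_vec k B c}"
proof -
  have "{c. int_vec k B c} \<subseteq>
    {c. \<forall>j. (j \<in> {..<k} \<longrightarrow> c j \<in> {- int B..int B}) \<and> (j \<notin> {..<k} \<longrightarrow> c j = 0)}"
    by (auto simp: int_vec_def abs_le_iff minus_le_iff)
  then show ?thesis
    using finite_set_of_finite_funs[of "{..<k}" "{- int B..int B}" 0] finite_subset by fast
qed

lemma int_vec_mono: "int_vec k B c \<Longrightarrow> B \<le> B' \<Longrightarrow> int_vec k B' c"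
  by (metis int_vec_def of_nat_mono order.trans)

lemma int_vec_mult:
  "int_vec k B c \<Longrightarrow> \<bar>r\<bar> \<le> int R \<Longrightarrow> int_vec k (R * B) (\<lambda>j. r * c j)"
  by (auto simp: int_vec_def abs_mult intro!: mult_mono)

lemma int_vec_add:
  "int_vec k B c \<Longrightarrow> int_vec k B' c' \<Longrightarrow> int_vec k (B + B') (\<lambda>j. c j + c' j)"
  by (auto simp: int_vec_def intro!: order.trans[OF abs_triangle_ineq] add_mono)

lemma int_vec_diff:
  "int_vec k B c \<Longrightarrow> int_vec k B' c' \<Longrightarrow> int_vec k (B + B') (\<lambda>j. c j - c' j)"
  by (auto simp: int_vec_def intro!: order.trans[OF abs_triangle_ineq4] add_mono)

definition comb :: "(nat \<Rightarrow> int) \<Rightarrow> (nat \<Rightarrow> real) list \<Rightarrow> nat \<Rightarrow> real" where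
  "comb c e i = (\<Sum>j<length e. of_int (c j) * (e ! j) i)"

lemma comb_Cons: "comb c (z # e) i = of_int (c 0) * z i + comb (\<lambda>j. c (Suc j)) e i"
  unfolding comb_def length_Cons sum.lessThan_Suc_shift by simp

lemma comb_append:
  "comb c (e @ e') i = comb c e i + comb (\<lambda>j. c (length e + j)) e' i"
proof (induction e arbitrary: c)
  case Nil
  then show ?case by (simp add: comb_def)
next
  case (Cons z e)
  then show ?case by (simp add: comb_Cons)
qed

lemma comb_mult: "comb (\<lambda>j. r * c j) e i = of_int r * comb c e i"
  by (simp add: comb_def sum_distrib_left mult.assoc)

lemma comb_add: "comb (\<lambda>j. c j + c' j) e i = comb c e i + comb c' e i"
  by (simp add: comb_def sum.distrib ring_distribs)

lemma comb_diff: "comb (\<lambda>j. c j - c' j) e i = comb c e i - comb c' e i"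
  by (simp add: comb_def sum_subtractf ring_distribs)

abbreviation pos :: "(nat \<Rightarrow> real) \<Rightarrow> bool" where
  "pos \<equiv> lexless (\<lambda>_. 0)"

lemma pos_mult: "(c::real) > 0 \<Longrightarrow> pos (\<lambda>i. c * x i) \<longleftrightarrow> pos x"
  using lexless_mult[of c "\<lambda>_. 0" x] by simp

text \<open>
  Doubling \<open>x\<close> makes the first coordinate of \<open>2 x + d\<close> nonzero for odd \<open>d 0\<close>, so that the
  tail does not influence the sign.
\<close>

lemma near_if_pos:
  assumes "\<And>d. int_vec n (2 * m + 1) d \<Longrightarrow>
      pos (\<lambda>i. 2 * x i + of_int (d i)) \<longleftrightarrow> pos (\<lambda>i. 2 * y i + of_int (d i))"
    and "\<forall>i<n. x i \<in> \<int>" "\<forall>i>n. x i = 0" "\<forall>i<n. y i \<in> \<int>" "\<forall>i>n. y i = 0"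
  shows "near n (int m) x y"
  using assms
proof (induction n arbitrary: x y)
  case 0
  have "pos (\<lambda>i. 2 * x i) \<longleftrightarrow> pos (\<lambda>i. 2 * y i)"
    using 0(1)[of "\<lambda>_. 0"] by (simp add: int_vec_def)
  moreover have "pos (\<lambda>i. 2 * x i) \<longleftrightarrow> 0 < x 0" if "\<forall>i>0. x i = 0" for x
    using that by (subst lexless_Suc) simp
  ultimately show ?case using 0 by simp
next
  case (Suc n)
  have "0 < x 0 + of_int d \<longleftrightarrow> 0 < y 0 + of_int d" if "\<bar>d\<bar> \<le> int m" for d
  proof -
    \<comment> \<open>For an integer \<open>x 0\<close>, the number
      \<open>2 * x 0 + 2 * d - 1\<close> is never zero, and it is positive iff
      \<open>x 0 + d\<close> is. This offset is the source of the bound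
      \<open>2 * m + 1\<close>.\<close>
    let ?d = "\<lambda>i. if i = 0 then 2 * d - 1 else 0 :: int"
    have "int_vec (Suc n) (2 * m + 1) ?d" using that by (auto simp: int_vec_def)
    note N = Suc.prems(1)[OF this]
    have E: "pos (\<lambda>i. 2 * x i + of_int (?d i)) \<longleftrightarrow> 0 < x 0 + of_int d" if x: "x 0 \<in> \<int>" for x
    proof -
      obtain k where k: "x 0 = of_int k" using x by (elim Ints_cases)
      have "(0::real) < 2 * of_int k + of_int (2 * d - 1) \<longleftrightarrow> (0::real) < of_int k + of_int d"
      proof -
        have "(0::real) < of_int (2 * k + (2 * d - 1)) \<longleftrightarrow> (0::real) < of_int (k + d)"
          unfolding of_int_0_less_iff by linarith
        then show ?thesis by simp
      qed
      moreover have "2 * of_int k + of_int (2 * d - 1) \<noteq> (0::real)"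
      proof
        assume "2 * of_int k + of_int (2 * d - 1) = (0::real)"
        then have "of_int (2 * k + (2 * d - 1)) = (0::real)" by simp
        then have "2 * k + (2 * d - 1) = 0" unfolding of_int_eq_0_iff .
        then show False by presburger
      qed
      ultimately show ?thesis using k by (subst lexless_Suc) simp
    qed
    have "x 0 \<in> \<int>" "y 0 \<in> \<int>" using Suc.prems(2,4) by simp_all
    from N[unfolded E[of x, OF this(1)] E[of y, OF this(2)]] show ?thesis .
  qed
  moreover have "near n (int m) (\<lambda>i. x (Suc i)) (\<lambda>i. y (Suc i))" if "x 0 = 0" "y 0 = 0"
  proof (rule Suc.IH)
    fix d assume d: "int_vec n (2 * m + 1) d"
    let ?d = "case_nat 0 d"
    have "int_vec (Suc n) (2 * m + 1) ?d"
      using d by (auto simp: int_vec_def split: nat.split)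
    from Suc.prems(1)[OF this]
    show "pos (\<lambda>i. 2 * x (Suc i) + of_int (d i)) \<longleftrightarrow> pos (\<lambda>i. 2 * y (Suc i) + of_int (d i))"
      using that by (simp add: lexless_Suc[of _ "\<lambda>i. 2 * x i + of_int (?d i)"]
          lexless_Suc[of _ "\<lambda>i. 2 * y i + of_int (?d i)"])
  qed (use Suc.prems in auto)
  ultimately show ?case by simp
qed

text \<open>
  The integer vectors \<open>d\<close> play the role of constants; comparisons with them also determine
  membership in the convex subgroups.
\<close>

definition sim :: "nat \<Rightarrow> nat \<Rightarrow> (nat \<Rightarrow> real) list \<Rightarrow> (nat \<Rightarrow> real) list \<Rightarrow> bool" where
  "sim n B e e' \<longleftrightarrow>
     (\<forall>c d. int_vec (length e) B c \<longrightarrow> int_vec n B d \<longrightarrow>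
       (pos (\<lambda>i. comb c e i + of_int (d i)) \<longleftrightarrow> pos (\<lambda>i. comb c e' i + of_int (d i)))) \<and>
     (\<forall>j<length e. \<forall>i<n. real_cong (fact B) ((e ! j) i) ((e' ! j) i))"

lemma sim_mono:
  assumes "sim n B' e e'" "B \<le> B'"
  shows "sim n B e e'"
proof -
  have "(fact B :: int) dvd fact B'" using assms(2) by (rule fact_dvd)
  then show ?thesis using assms int_vec_mono[OF _ assms(2)] real_cong_dvd
    unfolding sim_def by blast
qed

lemma sim_sym: "sim n B e e' \<Longrightarrow> length e = length e' \<Longrightarrow> sim n B e' e"
  unfolding sim_def by (auto intro: real_cong_sym)

text \<open>Put \<open>L = fact B\<close>. A condition on the sign of \<open>c 0 * z + t\<close>
  with nonzero \<open>c 0\<close> of size at most \<open>B\<close> is scaled by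
  \<open>L / \<bar>c 0\<bar>\<close> into a comparison of \<open>L * z\<close> with a combination of
  the old variables. A point \<open>w'\<close> in the corresponding gap yields
  \<open>z' = w' / L\<close>. Requiring \<open>w'\<close> to be congruent to \<open>L * z\<close>
  modulo \<open>m = L * L\<close> makes this division possible and leaves \<open>z'\<close>
  congruent to \<open>z\<close> modulo \<open>L\<close>. In the bound, \<open>4 * (L * B)\<close> is
  twice the difference of two scaled combinations, \<open>2 * m + 1\<close> is the offset of
  \<open>near_if_pos\<close>, and the last \<open>B\<close> serves the case
  \<open>c 0 = 0\<close>.\<close>

lemma sim_extend:
  assumes T: "T = {0} \<or> T = UNIV"
    and e: "e \<in> tuples (lex_grp n T) k" and e': "e' \<in> tuples (lex_grp n T) k"
    and sim: "sim n (4 * (fact B * B) + (2 * (fact B * fact B) + 1) + B) e e'"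
    and z: "z \<in> Dom (lex_grp n T)"
  shows "\<exists>z'\<in>Dom (lex_grp n T). sim n B (z # e) (z' # e')"
proof -
  define L :: nat where "L = fact B"
  define m :: nat where "m = L * L"
  define B' where "B' = 4 * (L * B) + (2 * m + 1) + B"
  have simB': "sim n B' e e'" using sim by (simp add: B'_def L_def m_def)
  have "L > 0" by (simp add: L_def)
  then have "m > 0" by (simp add: m_def)
  have len: "length e = k" "length e' = k" using e e' by (auto simp: tuples_def)
  have eD: "e ! j \<in> Dom (lex_grp n T)" "e' ! j \<in> Dom (lex_grp n T)" if "j < k" for j
    using e e' that by (auto simp: tuples_def subset_iff)
  \<comment> \<open>\<open>m\<close> is at most \<open>B'\<close>, so it divides the factorial, and
    the congruences of the old variables are available modulo \<open>m\<close>.\<close>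
  have m_dvd: "int m dvd fact B'"
  proof -
    have "m dvd fact B'" by (rule dvd_fact) (use \<open>m > 0\<close> in \<open>simp_all add: B'_def\<close>)
    then have "int m dvd int (fact B')" by (simp only: int_dvd_int_iff)
    then show ?thesis by simp
  qed
  \<comment> \<open>\<open>J\<close> indexes the points with which \<open>L * z\<close> may have to
    be compared; \<open>u\<close> evaluates them on the given side, \<open>v\<close> on the
    other.\<close>
  define J where "J = {c. int_vec k (L * B) c} \<times> {d. int_vec n (L * B) d}"
  define u where "u = (\<lambda>(c, d) i. comb c e i + of_int (d i))"
  define v where "v = (\<lambda>(c, d) i. comb c e' i + of_int (d i))"
  have comb_Ints: "comb c f i \<in> \<int>" if "\<And>j. j < length f \<Longrightarrow> (f ! j) i \<in> \<int>" for c f and i :: nat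
    unfolding comb_def using that by (auto intro!: Ints_sum Ints_mult)
  have comb_zero: "comb c f i = 0" if "\<And>j. j < length f \<Longrightarrow> (f ! j) i = 0" for c f and i :: nat
    unfolding comb_def using that by simp
  have combD: "(\<lambda>i. comb c f i + of_int (d i)) \<in> Dom (lex_grp n T)"
    if "int_vec n (L * B) d" "\<And>j. j < length f \<Longrightarrow> f ! j \<in> Dom (lex_grp n T)" for c d f
    unfolding Dom_lex_grp
  proof (intro conjI allI impI)
    fix i assume "i < n" then show "comb c f i + of_int (d i) \<in> \<int>"
      using that(2) by (auto intro!: Ints_add comb_Ints simp: Dom_lex_grp)
  next
    fix i assume "n < i" then show "comb c f i + of_int (d i) = 0"
      using that comb_zero[of f i c] by (simp add: Dom_lex_grp int_vec_def)
  next
    show "comb c f n + of_int (d n) \<in> T"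
    proof (cases "T = {0}")
      case True
      then show ?thesis using that comb_zero[of f n c] by (simp add: Dom_lex_grp int_vec_def)
    qed (use T in simp)
  qed
  have "\<exists>w'\<in>Dom (lex_grp n T). (\<forall>i<n. real_cong (int m) ((\<lambda>i. real L * z i) i) (w' i)) \<and>
    (\<forall>j\<in>J. (lexless (u j) (\<lambda>i. real L * z i) \<longleftrightarrow> lexless (v j) w') \<and>
      (lexless (\<lambda>i. real L * z i) (u j) \<longleftrightarrow> lexless w' (v j)))"
  proof (rule lex_grp_gap[OF _ _ T])
    show "finite J" by (simp add: J_def finite_int_vec)
    show "int m > 0" using \<open>m > 0\<close> by simp
    show "(\<lambda>i. real L * z i) \<in> Dom (lex_grp n T)"
      using z T by (auto simp: Dom_lex_grp intro: Ints_mult)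
    fix p assume p: "p \<in> J"
    obtain c d where cd: "p = (c, d)" "int_vec k (L * B) c" "int_vec n (L * B) d"
      using p by (auto simp: J_def)
    show "u p \<in> Dom (lex_grp n T)" "v p \<in> Dom (lex_grp n T)"
      unfolding u_def v_def cd(1) prod.case using cd(3) eD len by (auto intro: combD)
    show "real_cong (int m) (u p i) (v p i)" if "i < n" for i
    proof -
      have "real_cong (fact B') ((e ! j) i) ((e' ! j) i)" if "j < k" for j
        using simB' \<open>i < n\<close> that len by (simp add: sim_def)
      then have "real_cong (int m) (comb c e i) (comb c e' i)"
        unfolding comb_def len by (intro real_cong_sum real_cong_mult) (auto intro: real_cong_dvd[OF _ m_dvd])
      then show ?thesis unfolding u_def v_def cd(1) prod.case by (intro real_cong_add) simp_all
    qed
    fix q assume q: "q \<in> J"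
    obtain c' d' where cd': "q = (c', d')" "int_vec k (L * B) c'" "int_vec n (L * B) d'"
      using q by (auto simp: J_def)
    show "near n (int m) (\<lambda>l. u p l - u q l) (\<lambda>l. v p l - v q l)"
    proof (rule near_if_pos)
      have D: "x \<in> Dom (lex_grp n T) \<Longrightarrow> y \<in> Dom (lex_grp n T) \<Longrightarrow>
        (\<forall>i<n. x i - y i \<in> \<int>) \<and> (\<forall>i>n. x i - y i = 0)" for x y
        by (simp add: Dom_lex_grp)
      have uv: "u p \<in> Dom (lex_grp n T)" "v p \<in> Dom (lex_grp n T)"
        "u q \<in> Dom (lex_grp n T)" "v q \<in> Dom (lex_grp n T)"
        unfolding u_def v_def cd(1) cd'(1) prod.case using cd(3) cd'(3) eD len
        by (auto intro: combD)
      show "\<forall>i<n. u p i - u q i \<in> \<int>" "\<forall>i>n. u p i - u q i = 0"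
        "\<forall>i<n. v p i - v q i \<in> \<int>" "\<forall>i>n. v p i - v q i = 0"
        using D[OF uv(1,3)] D[OF uv(2,4)] by blast+
      fix \<delta> assume \<delta>: "int_vec n (2 * m + 1) \<delta>"
      have "int_vec k (2 * (L * B + L * B)) (\<lambda>j. 2 * (c j - c' j))"
        using int_vec_mult[OF int_vec_diff[OF cd(2) cd'(2)], of 2 2] by simp
      then have 1: "int_vec k B' (\<lambda>j. 2 * (c j - c' j))"
        by (rule int_vec_mono) (simp add: B'_def)
      have "int_vec n (2 * (L * B + L * B) + (2 * m + 1)) (\<lambda>j. 2 * (d j - d' j) + \<delta> j)"
        using int_vec_add[OF int_vec_mult[OF int_vec_diff[OF cd(3) cd'(3)], of 2 2] \<delta>]
        by simp
      then have 2: "int_vec n B' (\<lambda>j. 2 * (d j - d' j) + \<delta> j)"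
        by (rule int_vec_mono) (simp add: B'_def)
      have eq: "(\<lambda>i. 2 * ((comb c f i + of_int (d i)) - (comb c' f i + of_int (d' i))) + of_int (\<delta> i))
        = (\<lambda>i. comb (\<lambda>j. 2 * (c j - c' j)) f i + of_int (2 * (d i - d' i) + \<delta> i))" for f
        unfolding comb_mult comb_diff by (intro ext) (simp add: algebra_simps)
      show "pos (\<lambda>i. 2 * (u p i - u q i) + of_int (\<delta> i)) \<longleftrightarrow>
        pos (\<lambda>i. 2 * (v p i - v q i) + of_int (\<delta> i))"
        unfolding u_def v_def cd(1) cd'(1) prod.case eq
        using simB' 1 2 len unfolding sim_def by blast
    qed
  qed
  then obtain w' where w': "w' \<in> Dom (lex_grp n T)" "\<And>i. i < n \<Longrightarrow> real_cong (int m) (real L * z i) (w' i)"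
    "\<And>j. j \<in> J \<Longrightarrow> lexless (u j) (\<lambda>i. real L * z i) \<longleftrightarrow> lexless (v j) w'"
    "\<And>j. j \<in> J \<Longrightarrow> lexless (\<lambda>i. real L * z i) (u j) \<longleftrightarrow> lexless w' (v j)"
    by blast
  define z' where "z' i = w' i / real L" for i
  have w'_eq: "w' = (\<lambda>i. real L * z' i)" using \<open>L > 0\<close> by (simp add: z'_def)
  have zz': "real_cong (fact B) (z i) (z' i)" if i: "i < n" for i
  proof -
    obtain q :: int where "real L * z i - w' i = of_int (int m) * of_int q"
      using w'(2)[OF i] by (auto simp: real_cong_def)
    then have "real L * (z i - z' i) = real L * (real L * of_int q)"
      by (simp add: w'_eq m_def algebra_simps)
    then have "z i - z' i = real L * of_int q" using \<open>L > 0\<close> by simp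
    also have "\<dots> = of_int (fact B) * of_int q" by (simp add: L_def)
    finally show ?thesis unfolding real_cong_def by blast
  qed
  have z'D: "z' \<in> Dom (lex_grp n T)"
    unfolding Dom_lex_grp
  proof (intro conjI allI impI)
    fix i assume i: "i < n"
    obtain q :: int where "z i - z' i = of_int (fact B) * of_int q"
      using zz'[OF i] by (auto simp: real_cong_def)
    then have "z' i = z i - of_int (fact B * q)" by simp
    then show "z' i \<in> \<int>" using z i by (auto simp: Dom_lex_grp intro!: Ints_diff simp del: of_int_mult)
  next
    show "z' n \<in> T" using T w'(1) by (auto simp: Dom_lex_grp z'_def)
    show "z' i = 0" if "n < i" for i using w'(1) that by (simp add: Dom_lex_grp z'_def)
  qed
  have "sim n B (z # e) (z' # e')"
    unfolding sim_def
  proof (intro conjI allI impI)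
    fix c d assume c: "int_vec (length (z # e)) B c" and d: "int_vec n B d"
    define c' where "c' = (\<lambda>j. c (Suc j))"
    have c': "int_vec k B c'" using c len by (auto simp: int_vec_def c'_def)
    define t where "t f i = comb c' f i + of_int (d i)" for f i
    have eq: "(\<lambda>i. comb c (x # f) i + of_int (d i)) = (\<lambda>i. of_int (c 0) * x i + t f i)" for x f
      by (intro ext) (simp add: comb_Cons t_def c'_def)
    show "pos (\<lambda>i. comb c (z # e) i + of_int (d i)) \<longleftrightarrow> pos (\<lambda>i. comb c (z' # e') i + of_int (d i))"
    proof (cases "c 0 = 0")
      case True
      have "int_vec k B' c'" "int_vec n B' d"
        using c' d by (auto elim!: int_vec_mono simp: B'_def)
      then show ?thesis using simB' len unfolding eq t_def True sim_def by simp
    next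
      case False
      \<comment> \<open>The scaling factor \<open>r = L / s\<close> is an integer because
        \<open>s\<close> is at most \<open>B\<close>. The sign of \<open>c 0\<close> decides on
        which side of the point \<open>L * z\<close> must lie.\<close>
      define s where "s = nat \<bar>c 0\<bar>"
      have s: "s > 0" "s \<le> B" using False c by (auto simp: s_def int_vec_def nat_le_iff)
      then have "s dvd L" unfolding L_def by (intro dvd_fact) simp_all
      then obtain r where r: "L = s * r" by (elim dvdE)
      have "r > 0" using r \<open>L > 0\<close> by (cases r) auto
      have "r \<le> L" using r s by simp
      have rc: "int_vec k (L * B) (\<lambda>j. \<rho> * c' j)" "int_vec n (L * B) (\<lambda>j. \<rho> * d j)"
        if "\<bar>\<rho>\<bar> = int r" for \<rho>
        using int_vec_mult[OF c', of \<rho> L] int_vec_mult[OF d, of \<rho> L] that \<open>r \<le> L\<close> by simp_all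
      have pos: "pos (\<lambda>i. of_int (c 0) * x i + t f i) \<longleftrightarrow>
        pos (\<lambda>i. real r * (of_int (c 0) * x i) + real r * t f i)" for x f
        using pos_mult[of "real r" "\<lambda>i. of_int (c 0) * x i + t f i"] \<open>r > 0\<close> by (simp add: ring_distribs)
      have "c 0 = int s \<or> c 0 = - int s" by (simp add: s_def abs_if)
      then consider "c 0 = int s" | "c 0 = - int s" by blast
      then show ?thesis
      proof cases
        case 1
        let ?p = "(\<lambda>j. (- int r) * c' j, \<lambda>j. (- int r) * d j)"
        have "?p \<in> J" using rc[of "- int r"] unfolding J_def by simp
        have "pos (\<lambda>i. of_int (c 0) * x i + t f i) \<longleftrightarrow>
          lexless (\<lambda>i. comb (\<lambda>j. (- int r) * c' j) f i + of_int ((- int r) * d i)) (\<lambda>i. real L * x i)" for x f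
          unfolding pos lexless_0[of _ "\<lambda>i. real L * x i"] comb_mult
          by (simp add: 1 r t_def algebra_simps)
        then show ?thesis
          using w'(3)[OF \<open>?p \<in> J\<close>] unfolding eq w'_eq u_def v_def prod.case by simp
      next
        case 2
        let ?p = "(\<lambda>j. int r * c' j, \<lambda>j. int r * d j)"
        have "?p \<in> J" using rc[of "int r"] unfolding J_def by simp
        have "pos (\<lambda>i. of_int (c 0) * x i + t f i) \<longleftrightarrow>
          lexless (\<lambda>i. real L * x i) (\<lambda>i. comb (\<lambda>j. int r * c' j) f i + of_int (int r * d i))" for x f
          unfolding pos lexless_0[of "\<lambda>i. real L * x i"] comb_mult
          by (simp add: 2 r t_def algebra_simps)
        then show ?thesis
          using w'(4)[OF \<open>?p \<in> J\<close>] unfolding eq w'_eq u_def v_def prod.case by simp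
      qed
    qed
  next
    fix j i assume j: "j < length (z # e)" and i: "i < n"
    show "real_cong (fact B) (((z # e) ! j) i) (((z' # e') ! j) i)"
    proof (cases j)
      case 0
      then show ?thesis using zz'[OF i] by simp
    next
      case (Suc l)
      have "sim n B e e'" by (rule sim_mono[OF simB']) (simp add: B'_def)
      then show ?thesis using Suc i j by (simp add: sim_def)
    qed
  qed
  then show ?thesis using z'D by blast
qed

section \<open>Invariance of formulas under \<open>sim\<close>\<close>

fun tm_coeff :: "tm \<Rightarrow> nat \<Rightarrow> int" where
  "tm_coeff (TVar i) = (\<lambda>j. if j = i then 1 else 0)"
| "tm_coeff TZero = (\<lambda>_. 0)"
| "tm_coeff (TPlus s t) = (\<lambda>j. tm_coeff s j + tm_coeff t j)"
| "tm_coeff (TNeg t) = (\<lambda>j. - tm_coeff t j)"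

lemma tm_val_lex_grp:
  "tm_in (length e) t \<Longrightarrow> tm_val (lex_grp n T) e t = comb (tm_coeff t) e"
proof (induction t)
  case (TVar i)
  have "(if j = i then 1 else 0) * x = (if j = i then x else 0)" for j and x :: real by simp
  then show ?case using TVar by (intro ext) (simp add: comb_def if_distrib[of of_int] cong: if_cong)
next
  case TZero
  then show ?case by (intro ext) (simp add: comb_def)
next
  case (TPlus s t)
  then show ?case by (intro ext) (simp add: comb_add)
next
  case (TNeg t)
  then show ?case using comb_mult[of "-1" "tm_coeff t" e] by (intro ext) simp
qed

lemma tm_coeff_bounded: "tm_in k t \<Longrightarrow> \<exists>B. int_vec k B (tm_coeff t)"
proof (induction t)
  case (TVar i)
  then show ?case by (intro exI[of _ 1]) (simp add: int_vec_def)
next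
  case TZero
  then show ?case by (intro exI[of _ 0]) (simp add: int_vec_def)
next
  case (TPlus s t)
  then show ?case using int_vec_add by fastforce
next
  case (TNeg t)
  then show ?case using int_vec_mult[of k _ "tm_coeff t" "-1" 1] by fastforce
qed

definition sim_invariant :: "nat \<Rightarrow> real set \<Rightarrow> nat \<Rightarrow> nat \<Rightarrow> fm \<Rightarrow> bool" where
  "sim_invariant n T k B p \<longleftrightarrow>
     (\<forall>e\<in>tuples (lex_grp n T) k. \<forall>e'\<in>tuples (lex_grp n T) k.
       sim n B e e' \<longrightarrow> sat (lex_grp n T) e p \<longrightarrow> sat (lex_grp n T) e' p)"

text \<open>Quantifier elimination without normal forms: the bound grows at each quantifier as in
  \<open>sim_extend\<close>. One implication is enough in \<open>sim_invariant\<close>, since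
  \<open>sim\<close> is symmetric on tuples of equal length; negation relies on this.\<close>

theorem sat_sim:
  assumes T: "T = {0} \<or> T = UNIV" and "fm_in k p"
  shows "\<exists>B. sim_invariant n T k B p"
  using assms(2)
proof (induction p arbitrary: k)
  have diff: "pos (\<lambda>i. comb c e i - comb c' e i) \<longleftrightarrow> pos (\<lambda>i. comb c e' i - comb c' e' i)"
    if "int_vec k B c" "int_vec k B' c'" "sim n (B + B') e e'" "length e = k"
    for k B B' c c' e e'
  proof -
    have 1: "int_vec k (B + B') (\<lambda>j. c j - c' j)" by (rule int_vec_diff[OF that(1,2)])
    have 2: "int_vec n (B + B') (\<lambda>_. 0)" by (simp add: int_vec_def)
    have "pos (\<lambda>i. comb (\<lambda>j. c j - c' j) e i + of_int 0) \<longleftrightarrow> pos (\<lambda>i. comb (\<lambda>j. c j - c' j) e' i + of_int 0)"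
      using that(3) 1 2 unfolding sim_def that(4) by fast
    then show ?thesis by (simp add: comb_diff)
  qed
  {
    case (FEq s t)
    then obtain B B' where B: "int_vec k B (tm_coeff s)" "int_vec k B' (tm_coeff t)"
      using tm_coeff_bounded by fastforce
    have eq: "x = y \<longleftrightarrow> \<not> pos (\<lambda>i. x i - y i) \<and> \<not> pos (\<lambda>i. y i - x i)" for x y :: "nat \<Rightarrow> real"
      using lexless_linear[of x y] lexless_0[of x y] lexless_0[of y x] by auto
    show ?case unfolding sim_invariant_def
    proof (intro exI[of _ "B + B'"] ballI impI)
      fix e e' assume e: "e \<in> tuples (lex_grp n T) k" "e' \<in> tuples (lex_grp n T) k"
        "sim n (B + B') e e'" "sat (lex_grp n T) e (FEq s t)"
      have len: "length e = k" "length e' = k" using e by (auto simp: tuples_def)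
      have v: "tm_val (lex_grp n T) e s = comb (tm_coeff s) e" "tm_val (lex_grp n T) e t = comb (tm_coeff t) e"
        "tm_val (lex_grp n T) e' s = comb (tm_coeff s) e'" "tm_val (lex_grp n T) e' t = comb (tm_coeff t) e'"
        using FEq len by (auto intro!: tm_val_lex_grp)
      have "sim n (B' + B) e e'" using e(3) by (simp add: add.commute)
      then show "sat (lex_grp n T) e' (FEq s t)"
        using e(4) diff[OF B e(3) len(1)] diff[OF B(2,1) _ len(1)]
        unfolding sat.simps v eq[of "comb (tm_coeff s) _"] by blast
    qed
  next
    case (FLess s t)
    then obtain B B' where B: "int_vec k B (tm_coeff s)" "int_vec k B' (tm_coeff t)"
      using tm_coeff_bounded by fastforce
    show ?case unfolding sim_invariant_def
    proof (intro exI[of _ "B' + B"] ballI impI)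
      fix e e' assume e: "e \<in> tuples (lex_grp n T) k" "e' \<in> tuples (lex_grp n T) k"
        "sim n (B' + B) e e'" "sat (lex_grp n T) e (FLess s t)"
      have len: "length e = k" "length e' = k" using e by (auto simp: tuples_def)
      have v: "tm_val (lex_grp n T) e s = comb (tm_coeff s) e" "tm_val (lex_grp n T) e t = comb (tm_coeff t) e"
        "tm_val (lex_grp n T) e' s = comb (tm_coeff s) e'" "tm_val (lex_grp n T) e' t = comb (tm_coeff t) e'"
        using FLess len by (auto intro!: tm_val_lex_grp)
      show "sat (lex_grp n T) e' (FLess s t)"
        using e(4) diff[OF B(2,1) e(3) len(1)]
        unfolding sat.simps v lex_grp_simps lexless_0[of "comb (tm_coeff s) _"] by blast
    qed
  next
    case (FNot p)
    then have "fm_in k p" by simp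
    from FNot.IH[OF this] obtain B where B: "sim_invariant n T k B p" ..
    show ?case unfolding sim_invariant_def
    proof (intro exI[of _ B] ballI impI)
      fix e e' assume e: "e \<in> tuples (lex_grp n T) k" "e' \<in> tuples (lex_grp n T) k"
        "sim n B e e'" "sat (lex_grp n T) e (FNot p)"
      have "sim n B e' e" using e(3) by (rule sim_sym) (use e in \<open>simp add: tuples_def\<close>)
      then show "sat (lex_grp n T) e' (FNot p)" using B[unfolded sim_invariant_def, rule_format, OF e(2,1)] e(4) by auto
    qed
  next
    case (FAnd p q)
    then have pq: "fm_in k p" "fm_in k q" by simp_all
    from FAnd.IH(1)[OF pq(1)] obtain B where B: "sim_invariant n T k B p" ..
    from FAnd.IH(2)[OF pq(2)] obtain C where C: "sim_invariant n T k C q" ..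
    show ?case unfolding sim_invariant_def
    proof (intro exI[of _ "max B C"] ballI impI)
      fix e e' assume e: "e \<in> tuples (lex_grp n T) k" "e' \<in> tuples (lex_grp n T) k"
        "sim n (max B C) e e'" "sat (lex_grp n T) e (FAnd p q)"
      have "sim n B e e'" "sim n C e e'" by (auto intro: sim_mono[OF e(3)])
      then show "sat (lex_grp n T) e' (FAnd p q)"
        using B[unfolded sim_invariant_def, rule_format, OF e(1,2)] C[unfolded sim_invariant_def, rule_format, OF e(1,2)] e(4) by simp
    qed
  next
    case (FEx p)
    then have "fm_in (Suc k) p" by simp
    from FEx.IH[OF this] obtain B where B: "sim_invariant n T (Suc k) B p" ..
    show ?case unfolding sim_invariant_def
    proof (rule exI, intro ballI impI)
      fix e e' assume e: "e \<in> tuples (lex_grp n T) k" "e' \<in> tuples (lex_grp n T) k"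
        "sim n (4 * (fact B * B) + (2 * (fact B * fact B) + 1) + B) e e'" "sat (lex_grp n T) e (FEx p)"
      then obtain z where z: "z \<in> Dom (lex_grp n T)" "sat (lex_grp n T) (z # e) p" by auto
      obtain z' where z': "z' \<in> Dom (lex_grp n T)" "sim n B (z # e) (z' # e')"
        using sim_extend[OF T e(1-3) z(1)] by blast
      have "z # e \<in> tuples (lex_grp n T) (Suc k)" "z' # e' \<in> tuples (lex_grp n T) (Suc k)"
        using z z' e by (auto simp: tuples_def)
      then have "sat (lex_grp n T) (z' # e') p" using B z z' unfolding sim_invariant_def by blast
      then show "sat (lex_grp n T) e' (FEx p)" using z' by auto
    qed
  }
qed


section \<open>Externally definable sets\<close>

text \<open>A cut is located coordinate by coordinate. Either it runs between two values of some
  integer coordinate, and an odd number separates the doubled values, or it descends to the last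
  coordinate, where the infimum of a set of reals is attained or not.\<close>

lemma upward_closed_lex_grp:
  assumes T: "T = {0} \<or> T = UNIV"
    and "L \<subseteq> Dom (lex_grp n T)"
    and "\<And>x y. x \<in> L \<Longrightarrow> y \<in> Dom (lex_grp n T) \<Longrightarrow> lexless x y \<Longrightarrow> y \<in> L"
  shows "L = {} \<or> L = Dom (lex_grp n T) \<or>
    (\<exists>g\<in>Dom (lex_grp n T). L = {y \<in> Dom (lex_grp n T). lexless g (\<lambda>i. 2 * y i)}) \<or>
    (\<exists>g\<in>Dom (lex_grp n T). L = {y \<in> Dom (lex_grp n T). \<not> lexless (\<lambda>i. 2 * y i) g})"
  using assms(2-)
proof (induction n arbitrary: L)
  case 0
  let ?D = "Dom (lex_grp 0 T)"
  have ext: "x = y" if "x \<in> ?D" "y \<in> ?D" "x 0 = y 0" for x y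
  proof
    fix i show "x i = y i" using that by (cases i) (simp_all add: Dom_lex_grp)
  qed
  show ?case
  proof (cases "T = {0}")
    case True
    have z: "x = (\<lambda>_. 0)" if "x \<in> ?D" for x
    proof
      fix i show "x i = 0" using that True by (cases i) (simp_all add: Dom_lex_grp)
    qed
    show ?thesis
    proof (cases "L = {}")
      case False
      then obtain x where "x \<in> L" by blast
      then have "y \<in> L" if "y \<in> ?D" for y using z[OF that] z[of x] 0(1) by auto
      then have "L = ?D" using 0(1) by blast
      then show ?thesis by blast
    qed simp
  next
    case False
    with T have T: "T = UNIV" by blast
    have lex: "lexless x y \<longleftrightarrow> x 0 < y 0" if "\<forall>i>0. x i = 0" "\<forall>i>0. y i = 0" for x y
      using that by (subst lexless_Suc) simp
    have D: "x \<in> ?D \<longleftrightarrow> (\<forall>i>0. x i = 0)" for x by (auto simp: Dom_lex_grp T)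
    consider "L = {}" | "L = ?D" | x y where "x \<in> L" "y \<in> ?D" "y \<notin> L" using 0(1) by blast
    then show ?thesis
    proof cases
      case (3 x y)
      define R where "R = (\<lambda>x. x 0) ` L"
      have lower: "y 0 \<le> r" if "r \<in> R" for r
      proof (rule ccontr)
        assume "\<not> y 0 \<le> r"
        then obtain z where z: "z \<in> L" "z 0 < y 0" using \<open>r \<in> R\<close> by (auto simp: R_def)
        then have "lexless z y" using 3(2) 0(1) D by (subst lex) auto
        then show False using 0(2)[OF z(1) 3(2)] 3(3) by blast
      qed
      have ne: "R \<noteq> {}" using 3(1) by (auto simp: R_def)
      have bdd: "bdd_below R" using lower by (intro bdd_belowI)
      define c where "c = Inf R"
      have above: "z \<in> L" if z: "z \<in> ?D" "c < z 0" for z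
      proof -
        obtain r where "r \<in> R" "r < z 0" using z(2) cInf_less_iff[OF ne bdd] unfolding c_def by blast
        then obtain x where "x \<in> L" "x 0 < z 0" by (auto simp: R_def)
        then have "lexless x z" using z 0(1) D by (subst lex) auto
        then show ?thesis using 0(2)[OF \<open>x \<in> L\<close> z(1)] by blast
      qed
      have ge: "c \<le> z 0" if "z \<in> L" for z unfolding c_def using that bdd by (intro cInf_lower) (auto simp: R_def)
      let ?g = "\<lambda>i::nat. if i = 0 then 2 * c else 0"
      have g: "?g \<in> ?D" by (simp add: D)
      show ?thesis
      proof (cases "c \<in> R")
        case True
        then obtain x where x: "x \<in> L" "x 0 = c" by (auto simp: R_def)
        have "z \<in> L \<longleftrightarrow> \<not> lexless (\<lambda>i. 2 * z i) ?g" if z: "z \<in> ?D" for z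
        proof -
          have "lexless (\<lambda>i. 2 * z i) ?g \<longleftrightarrow> z 0 < c" using z D by (subst lex) auto
          moreover have "z \<in> L" if "z 0 = c" using ext[of z x] z x that 0(1) by auto
          ultimately show ?thesis using above[OF z] ge[of z] by force
        qed
        then have "L = {y \<in> ?D. \<not> lexless (\<lambda>i. 2 * y i) ?g}" using 0(1) by blast
        then show ?thesis using g by blast
      next
        case False
        have "z \<in> L \<longleftrightarrow> lexless ?g (\<lambda>i. 2 * z i)" if z: "z \<in> ?D" for z
        proof -
          have "lexless ?g (\<lambda>i. 2 * z i) \<longleftrightarrow> c < z 0" using z D by (subst lex) auto
          moreover have "z 0 \<noteq> c" if "z \<in> L" using False that by (auto simp: R_def)
          ultimately show ?thesis using above[OF z] ge[of z] by force
        qed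
        then have "L = {y \<in> ?D. lexless ?g (\<lambda>i. 2 * y i)}" using 0(1) by blast
        then show ?thesis using g by blast
      qed
    qed auto
  qed
next
  case (Suc n)
  let ?D = "Dom (lex_grp (Suc n) T)" and ?D' = "Dom (lex_grp n T)"
  have tail: "(\<lambda>i. x (Suc i)) \<in> ?D'" if "x \<in> ?D" for x
    using that by (simp add: Dom_lex_grp)
  have cons: "case_nat (of_int a) x \<in> ?D" if "x \<in> ?D'" for a x
    using that by (auto simp: Dom_lex_grp split: nat.split)
  have int0: "\<exists>a. x 0 = of_int a" if "x \<in> ?D" for x
  proof -
    have "x 0 \<in> \<int>" using that by (simp add: Dom_lex_grp)
    then show ?thesis by (elim Ints_cases) blast
  qed
  consider "L = {}" | "L = ?D" | x y where "x \<in> L" "y \<in> ?D" "y \<notin> L" using Suc.prems(1) by blast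
  then show ?case
  proof cases
    case (3 x0 y)
    have ge: "y 0 \<le> x 0" if "x \<in> L" for x
      using Suc.prems(2)[OF that 3(2)] 3(3) lexless_Suc[of x y] by fastforce
    \<comment> \<open>First coordinates of elements of \<open>L\<close> are integers bounded below
      by \<open>y 0\<close>, so a least one exists.\<close>
    obtain z where z: "z \<in> L" and zmin: "\<And>x. x \<in> L \<Longrightarrow> nat \<lfloor>z 0 - y 0\<rfloor> \<le> nat \<lfloor>x 0 - y 0\<rfloor>"
      using ex_has_least_nat[of "\<lambda>x. x \<in> L" x0 "\<lambda>x. nat \<lfloor>x 0 - y 0\<rfloor>"] 3(1) by blast
    have zD: "z \<in> ?D" using z Suc.prems(1) by blast
    obtain a where a: "z 0 = of_int a" using int0[OF zD] by blast
    have min: "z 0 \<le> x 0" if x: "x \<in> L" for x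
    proof -
      obtain b c where bc: "x 0 = of_int b" "y 0 = of_int c"
        using int0 x 3(2) Suc.prems(1) by (metis subsetD)
      have "c \<le> a" "c \<le> b" using ge[OF z] ge[OF x] a bc by simp_all
      moreover have "nat (a - c) \<le> nat (b - c)"
        using zmin[OF x] unfolding a bc of_int_diff[symmetric] floor_of_int .
      ultimately show ?thesis using a bc by simp
    qed
    \<comment> \<open>Everything with a larger first coordinate is in \<open>L\<close>, so only the
      slice over the least one carries information.\<close>
    define L' where "L' = {x' \<in> ?D'. case_nat (z 0) x' \<in> L}"
    have "L' = {} \<or> L' = ?D' \<or> (\<exists>g\<in>?D'. L' = {y \<in> ?D'. lexless g (\<lambda>i. 2 * y i)}) \<or>
      (\<exists>g\<in>?D'. L' = {y \<in> ?D'. \<not> lexless (\<lambda>i. 2 * y i) g})"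
    proof (rule Suc.IH)
      show "L' \<subseteq> ?D'" by (auto simp: L'_def)
      fix x y assume h: "x \<in> L'" "y \<in> ?D'" "lexless x y"
      then have "case_nat (z 0) x \<in> L" by (simp add: L'_def)
      moreover have "case_nat (z 0) y \<in> ?D" using cons[OF h(2)] a by simp
      moreover have "lexless (case_nat (z 0) x) (case_nat (z 0) y)"
        using h(3) by (simp add: lexless_Suc[of "case_nat (z 0) x"])
      ultimately have "case_nat (z 0) y \<in> L" by (rule Suc.prems(2))
      then show "y \<in> L'" using h(2) by (simp add: L'_def)
    qed
    moreover have "(\<lambda>i. z (Suc i)) \<in> L'"
    proof -
      have "case_nat (z 0) (\<lambda>i. z (Suc i)) = z" by (rule ext) (simp split: nat.split)
      then show ?thesis using z tail[OF zD] by (simp add: L'_def)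
    qed
    ultimately consider "L' = ?D'" | g where "g \<in> ?D'" "L' = {y \<in> ?D'. lexless g (\<lambda>i. 2 * y i)}"
      | g where "g \<in> ?D'" "L' = {y \<in> ?D'. \<not> lexless (\<lambda>i. 2 * y i) g}" by blast
    moreover have L: "x \<in> L \<longleftrightarrow> z 0 < x 0 \<or> z 0 = x 0 \<and> (\<lambda>i. x (Suc i)) \<in> L'" if x: "x \<in> ?D" for x
    proof -
      have "z 0 < x 0 \<Longrightarrow> x \<in> L" using Suc.prems(2)[OF z x] by (simp add: lexless_Suc[of z x])
      moreover have "case_nat (x 0) (\<lambda>i. x (Suc i)) = x" by (rule ext) (simp split: nat.split)
      then have "z 0 = x 0 \<Longrightarrow> (\<lambda>i. x (Suc i)) \<in> L' \<longleftrightarrow> x \<in> L" using tail[OF x] by (simp add: L'_def)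
      ultimately show ?thesis using min[of x] by force
    qed
    ultimately show ?thesis
    proof cases
      case 1
      \<comment> \<open>The slice is everything: the boundary lies between the first coordinates
        \<open>a - 1\<close> and \<open>a\<close>, where there need not be a least or greatest
        element. The odd \<open>2 * a - 1\<close> separates their doubles.\<close>
      let ?g = "case_nat (of_int (2 * a - 1)) (\<lambda>_. 0) :: nat \<Rightarrow> real"
      have g: "?g \<in> ?D" using T by (intro cons) (auto simp: Dom_lex_grp)
      have "x \<in> L \<longleftrightarrow> lexless ?g (\<lambda>i. 2 * x i)" if x: "x \<in> ?D" for x
      proof -
        obtain b where b: "x 0 = of_int b" using int0[OF x] by blast
        have "of_int (2 * a - 1) \<noteq> (of_int (2 * b) :: real)" unfolding of_int_eq_iff by presburger
        moreover have "of_int (2 * a - 1) < (of_int (2 * b) :: real) \<longleftrightarrow> a \<le> b"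
          unfolding of_int_less_iff by linarith
        moreover have "x \<in> L \<longleftrightarrow> a \<le> b" using L[OF x] tail[OF x] 1 a b by auto
        ultimately show ?thesis using b by (subst lexless_Suc) simp
      qed
      then have "L = {y \<in> ?D. lexless ?g (\<lambda>i. 2 * y i)}" using Suc.prems(1) by blast
      then show ?thesis using g by blast
    next
      case (2 g)
      let ?g = "case_nat (of_int (2 * a)) g :: nat \<Rightarrow> real"
      have g: "?g \<in> ?D" using 2 by (intro cons)
      have "x \<in> L \<longleftrightarrow> lexless ?g (\<lambda>i. 2 * x i)" if x: "x \<in> ?D" for x
        using L[OF x] tail[OF x] 2 a by (subst lexless_Suc) simp
      then have "L = {y \<in> ?D. lexless ?g (\<lambda>i. 2 * y i)}" using Suc.prems(1) by blast
      then show ?thesis using g by blast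
    next
      case (3 g)
      let ?g = "case_nat (of_int (2 * a)) g :: nat \<Rightarrow> real"
      have g: "?g \<in> ?D" using 3 by (intro cons)
      have "x \<in> L \<longleftrightarrow> \<not> lexless (\<lambda>i. 2 * x i) ?g" if x: "x \<in> ?D" for x
        using L[OF x] tail[OF x] 3 a by (subst lexless_Suc) force
      then have "L = {y \<in> ?D. \<not> lexless (\<lambda>i. 2 * y i) ?g}" using Suc.prems(1) by blast
      then show ?thesis using g by blast
    qed
  qed auto
qed

section \<open>Uniform definability of cuts and residue classes\<close>

fun TMult :: "nat \<Rightarrow> tm \<Rightarrow> tm" where
  "TMult 0 t = TZero"
| "TMult (Suc k) t = TPlus t (TMult k t)"

lemma tm_in_TMult: "tm_in k t \<Longrightarrow> tm_in k (TMult q t)"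
  by (induction q) auto

lemma tm_coeff_TMult [simp]: "tm_coeff (TMult q t) j = int q * tm_coeff t j"
  by (induction q) (auto simp: algebra_simps)

fun TComb :: "(nat \<Rightarrow> int) \<Rightarrow> nat \<Rightarrow> tm" where
  "TComb c 0 = TZero"
| "TComb c (Suc k) = TPlus (TComb c k)
     (if c k \<ge> 0 then TMult (nat (c k)) (TVar k) else TNeg (TMult (nat (- c k)) (TVar k)))"

lemma tm_in_TComb: "k \<le> l \<Longrightarrow> tm_in l (TComb c k)"
  by (induction k) (auto intro: tm_in_TMult)

lemma tm_coeff_TComb [simp]: "tm_coeff (TComb c k) j = (if j < k then c j else 0)"
  by (induction k) (auto simp: less_Suc_eq)

lemma comb_cong: "(\<And>j. j < length e \<Longrightarrow> c j = c' j) \<Longrightarrow> comb c e = comb c' e"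
  by (intro ext) (simp add: comb_def)

lemma comb_zero: "(\<And>j. j < length e \<Longrightarrow> c j = 0) \<Longrightarrow> comb c e i = 0"
  by (simp add: comb_def)

lemma tm_val_TComb:
  assumes "length e = k"
  shows "tm_val (lex_grp n T) (e @ e') (TComb c k) = comb c e"
proof -
  have "tm_in (length (e @ e')) (TComb c k)" using assms by (simp add: tm_in_TComb)
  then have "tm_val (lex_grp n T) (e @ e') (TComb c k) = comb (tm_coeff (TComb c k)) (e @ e')"
    by (rule tm_val_lex_grp)
  also have "\<dots> = comb c e"
  proof
    fix i
    have "comb (tm_coeff (TComb c k)) e = comb c e" using assms by (intro comb_cong) simp
    moreover have "comb (\<lambda>j. tm_coeff (TComb c k) (length e + j)) e' i = 0"
      using assms by (intro comb_zero) simp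
    ultimately show "comb (tm_coeff (TComb c k)) (e @ e') i = comb c e i"
      by (simp only: comb_append add_0_right)
  qed
  finally show ?thesis .
qed

text \<open>For a tuple \<open>a\<close> of an elementary extension and \<open>y\<close> ranging
  over the standard group, this describes the cut of \<open>- comb c a\<close>. The varying element
  comes first in the environment, hence the coefficient 1 in front of \<open>c\<close>.\<close>

definition sign_fm :: "nat \<Rightarrow> (nat \<Rightarrow> int) \<Rightarrow> fm" where
  "sign_fm k c = FLess TZero (TComb (case_nat 1 c) (Suc k))"

lemma fm_in_sign_fm: "fm_in (Suc k) (sign_fm k c)"
  using tm_in_TComb[of "Suc k" "Suc k" "case_nat 1 c"] by (simp add: sign_fm_def del: TComb.simps)

lemma sat_sign_fm:
  "length a = k \<Longrightarrow> sat (lex_grp n T) (y # a) (sign_fm k c) \<longleftrightarrow> pos (\<lambda>i. y i + comb c a i)"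
  using tm_val_TComb[of "y # a" "Suc k" n T "[]" "case_nat 1 c"]
  by (simp add: sign_fm_def comb_Cons[abs_def] del: TComb.simps)

lemma comb_in_Dom:
  assumes "T = {0} \<or> T = UNIV" "set e \<subseteq> Dom (lex_grp n T)"
  shows "comb c e \<in> Dom (lex_grp n T)"
  unfolding Dom_lex_grp
proof (intro conjI allI impI)
  have e: "e ! j \<in> Dom (lex_grp n T)" if "j < length e" for j using assms(2) that by auto
  show "comb c e i \<in> \<int>" if "i < n" for i
    unfolding comb_def using e that by (intro Ints_sum Ints_mult) (auto simp: Dom_lex_grp)
  show "comb c e i = 0" if "n < i" for i
    unfolding comb_def using e that by (simp add: Dom_lex_grp)
  show "comb c e n \<in> T"
  proof (cases "T = {0}")
    case True
    then show ?thesis unfolding comb_def using e by (simp add: Dom_lex_grp)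
  qed (use assms(1) in simp)
qed

lemma int_vector_in_Dom:
  assumes "T = {0} \<or> T = UNIV" "int_vec n B d"
  shows "(\<lambda>i. of_int (d i)) \<in> Dom (lex_grp n T)"
  using assms by (auto simp: Dom_lex_grp int_vec_def)

lemma add_in_Dom:
  assumes "T = {0} \<or> T = UNIV" "x \<in> Dom (lex_grp n T)" "y \<in> Dom (lex_grp n T)"
  shows "(\<lambda>i. x i + y i) \<in> Dom (lex_grp n T)" "(\<lambda>i. x i - y i) \<in> Dom (lex_grp n T)"
  using assms by (auto simp: Dom_lex_grp)

text \<open>The set \<open>L\<close> is coded by one element \<open>g\<close>, and the shift
  \<open>d\<close> is absorbed into it as \<open>g - 2 * d\<close>. The formula therefore depends on
  \<open>c\<close> alone, while \<open>d\<close> and \<open>L\<close> vary.\<close>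

lemma unif_cuts:
  fixes c :: "nat \<Rightarrow> int"
  assumes T: "T = {0} \<or> T = UNIV"
    and two: "\<exists>x\<in>Dom (lex_grp n T). \<exists>y\<in>Dom (lex_grp n T). x \<noteq> y"
  defines "D \<equiv> Dom (lex_grp n T)"
  shows "unif m (lex_grp n T) {{x \<in> tuples (lex_grp n T) m. (\<lambda>i. comb c x i + d i) \<in> L} | d L.
    d \<in> D \<and> L \<subseteq> D \<and> (\<forall>x\<in>L. \<forall>y\<in>D. lexless x y \<longrightarrow> y \<in> L)}"
proof -
  interpret nontrivial_struct "lex_grp n T" by unfold_locales (rule two)
  let ?U = "tuples (lex_grp n T) m"
  let ?S1 = "\<lambda>g. {x \<in> ?U. lexless g (comb (\<lambda>j. 2 * c j) x)}"
  let ?S2 = "\<lambda>g. {x \<in> ?U. \<not> lexless (comb (\<lambda>j. 2 * c j) x) g}"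
  let ?t = "TComb (\<lambda>j. 2 * c j) m"
  have t: "tm_in (m + 1) ?t" by (rule tm_in_TComb) simp
  have sat: "tm_val (lex_grp n T) (x @ [g]) ?t = comb (\<lambda>j. 2 * c j) x" "(x @ [g]) ! m = g" if "x \<in> ?U" for x g
    using that by (auto simp: tuples_def intro: tm_val_TComb)
  have g: "[g] \<in> tuples (lex_grp n T) 1" if "g \<in> D" for g using that by (simp add: tuples_def D_def)
  have 1: "unif m (lex_grp n T) (?S1 ` D)"
  proof (rule unifI)
    show "fm_in (m + 1) (FLess (TVar m) ?t)" using t by simp
    fix X assume "X \<in> ?S1 ` D"
    then obtain g where "g \<in> D" "X = ?S1 g" by blast
    then show "\<exists>b\<in>tuples (lex_grp n T) 1. X = definable_set m (lex_grp n T) (FLess (TVar m) ?t) b"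
      using g sat by (intro bexI[of _ "[g]"]) (auto simp: definable_set_def)
  qed
  have 2: "unif m (lex_grp n T) (?S2 ` D)"
  proof (rule unifI)
    show "fm_in (m + 1) (FNot (FLess ?t (TVar m)))" using t by simp
    fix X assume "X \<in> ?S2 ` D"
    then obtain g where "g \<in> D" "X = ?S2 g" by blast
    then show "\<exists>b\<in>tuples (lex_grp n T) 1. X = definable_set m (lex_grp n T) (FNot (FLess ?t (TVar m))) b"
      using g sat by (intro bexI[of _ "[g]"]) (auto simp: definable_set_def)
  qed
  show ?thesis
  proof (rule unif_mono[OF unif_Un[OF unif_trivial unif_Un[OF 1 2]]], rule subsetI, elim CollectE exE conjE)
    fix X d L assume X: "X = {x \<in> ?U. (\<lambda>i. comb c x i + d i) \<in> L}" and d: "d \<in> D" and L: "L \<subseteq> D"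
      "\<forall>x\<in>L. \<forall>y\<in>D. lexless x y \<longrightarrow> y \<in> L"
    have xD: "(\<lambda>i. comb c x i + d i) \<in> D" if "x \<in> ?U" for x
      unfolding D_def using that d T by (intro add_in_Dom comb_in_Dom) (auto simp: tuples_def D_def)
    have gD: "(\<lambda>i. g i - 2 * d i) \<in> D" if "g \<in> D" for g
      using that d T by (auto simp: Dom_lex_grp D_def)
    have eq: "lexless g (\<lambda>i. 2 * (comb c x i + d i)) \<longleftrightarrow> lexless (\<lambda>i. g i - 2 * d i) (comb (\<lambda>j. 2 * c j) x)"
      "lexless (\<lambda>i. 2 * (comb c x i + d i)) g \<longleftrightarrow> lexless (comb (\<lambda>j. 2 * c j) x) (\<lambda>i. g i - 2 * d i)" for g x
      unfolding lexless_0[of g] lexless_0[of "\<lambda>i. g i - 2 * d i"] lexless_0[of _ g]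
        lexless_0[of _ "\<lambda>i. g i - 2 * d i"] comb_mult
      by (simp_all add: algebra_simps)
    from upward_closed_lex_grp[OF T, of L n] L
    consider "L = {}" | "L = D" | g where "g \<in> D" "L = {y \<in> D. lexless g (\<lambda>i. 2 * y i)}"
      | g where "g \<in> D" "L = {y \<in> D. \<not> lexless (\<lambda>i. 2 * y i) g}" unfolding D_def by blast
    then show "X \<in> {{}, ?U} \<union> (?S1 ` D \<union> ?S2 ` D)"
    proof cases
      case 2
      then have "X = ?U" using X xD by blast
      then show ?thesis by blast
    next
      case (3 g)
      have "(\<lambda>i. comb c x i + d i) \<in> L \<longleftrightarrow> lexless (\<lambda>i. g i - 2 * d i) (comb (\<lambda>j. 2 * c j) x)" if "x \<in> ?U" for x
        using xD[OF that] unfolding eq[symmetric] 3(2) by blast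
      then have "X = ?S1 (\<lambda>i. g i - 2 * d i)" unfolding X by blast
      then show ?thesis using gD[OF 3(1)] by blast
    next
      case (4 g)
      have "(\<lambda>i. comb c x i + d i) \<in> L \<longleftrightarrow> \<not> lexless (comb (\<lambda>j. 2 * c j) x) (\<lambda>i. g i - 2 * d i)" if "x \<in> ?U" for x
        using xD[OF that] unfolding eq[symmetric] 4(2) by blast
      then have "X = ?S2 (\<lambda>i. g i - 2 * d i)" unfolding X by blast
      then show ?thesis using gD[OF 4(1)] by blast
    qed (use X in simp)
  qed
qed

text \<open>Since \<open>T\<close> is divisible, congruence to \<open>r\<close> in the integer
  coordinates is the same as divisibility of \<open>x ! j - r\<close> by \<open>q\<close> in the
  group, which is expressible.\<close>

lemma unif_residue_class:
  assumes T: "T = {0} \<or> T = UNIV" and "j < m" "q > 0" and r: "r \<in> Dom (lex_grp n T)"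
  shows "unif m (lex_grp n T) {{x \<in> tuples (lex_grp n T) m. \<forall>i<n. real_cong (int q) ((x ! j) i) (r i)}}"
proof (rule unifI)
  let ?p = "FEx (FEq (TVar (Suc j)) (TPlus (TMult q (TVar 0)) (TVar (Suc m))))"
  show "fm_in (m + 1) ?p" using assms(2) by (simp add: tm_in_TMult)
  fix X assume "X \<in> {{x \<in> tuples (lex_grp n T) m. \<forall>i<n. real_cong (int q) ((x ! j) i) (r i)}}"
  then have X: "X = {x \<in> tuples (lex_grp n T) m. \<forall>i<n. real_cong (int q) ((x ! j) i) (r i)}" by simp
  have "sat (lex_grp n T) (x @ [r]) ?p \<longleftrightarrow> (\<forall>i<n. real_cong (int q) ((x ! j) i) (r i))"
    if x: "x \<in> tuples (lex_grp n T) m" for x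
  proof -
    have len: "length x = m" and xj: "x ! j \<in> Dom (lex_grp n T)" using x assms(2) by (auto simp: tuples_def)
    have v: "tm_val (lex_grp n T) (y # x @ [r]) (TMult q (TVar 0)) = (\<lambda>i. real q * y i)" for y
    proof (induction q)
      case (Suc q)
      then show ?case by (simp add: algebra_simps)
    qed simp
    have "sat (lex_grp n T) (x @ [r]) ?p \<longleftrightarrow> (\<exists>y\<in>Dom (lex_grp n T). x ! j = (\<lambda>i. real q * y i + r i))"
      using len assms(2) by (simp add: v nth_append)
    also have "\<dots> \<longleftrightarrow> (\<forall>i<n. real_cong (int q) ((x ! j) i) (r i))"
    proof
      assume "\<exists>y\<in>Dom (lex_grp n T). x ! j = (\<lambda>i. real q * y i + r i)"
      then obtain y where y: "y \<in> Dom (lex_grp n T)" "x ! j = (\<lambda>i. real q * y i + r i)" by blast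
      show "\<forall>i<n. real_cong (int q) ((x ! j) i) (r i)"
      proof (intro allI impI)
        fix i assume "i < n"
        then have "y i \<in> \<int>" using y(1) by (simp add: Dom_lex_grp)
        then obtain a where "y i = of_int a" by (elim Ints_cases)
        then show "real_cong (int q) ((x ! j) i) (r i)" using y(2) unfolding real_cong_def by auto
      qed
    next
      assume c: "\<forall>i<n. real_cong (int q) ((x ! j) i) (r i)"
      define y where "y i = ((x ! j) i - r i) / real q" for i
      have "y i \<in> \<int>" if "i < n" for i
        using c that assms(3) unfolding real_cong_def by (auto simp: y_def)
      moreover have "y n \<in> T" using T xj r by (auto simp: y_def Dom_lex_grp)
      ultimately have "y \<in> Dom (lex_grp n T)" using xj r by (auto simp: Dom_lex_grp y_def)
      moreover have "x ! j = (\<lambda>i. real q * y i + r i)" using assms(3) by (simp add: y_def)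
      ultimately show "\<exists>y\<in>Dom (lex_grp n T). x ! j = (\<lambda>i. real q * y i + r i)" by blast
    qed
    finally show ?thesis .
  qed
  then show "\<exists>b\<in>tuples (lex_grp n T) 1. X = definable_set m (lex_grp n T) ?p b"
    using r unfolding X definable_set_def by (intro bexI[of _ "[r]"]) (auto simp: tuples_def simp del: sat.simps)
qed

lemma bounded_residue:
  assumes "x \<in> Dom (lex_grp n T)" "q > 0"
  shows "\<exists>r. int_vec n q r \<and> (\<forall>i<n. real_cong (int q) (x i) (of_int (r i)))"
proof (intro exI conjI allI impI)
  let ?r = "\<lambda>i. if i < n then \<lfloor>x i\<rfloor> mod int q else 0"
  have "\<bar>a mod int q\<bar> \<le> int q" for a
    using assms(2) pos_mod_sign[of "int q" a] pos_mod_bound[of "int q" a] by linarith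
  then show "int_vec n q ?r" by (auto simp: int_vec_def)
  fix i assume i: "i < n"
  then have "x i \<in> \<int>" using assms(1) by (simp add: Dom_lex_grp)
  then obtain a where a: "x i = of_int a" by (elim Ints_cases)
  show "real_cong (int q) (x i) (of_int (?r i))" using i by (simp add: a real_cong_of_int dvd_minus_mod)
qed

text \<open>It must be shown that two points \<open>x\<close> and \<open>y\<close> agreeing on all
  \<open>A i\<close> are not separated by \<open>p\<close> at \<open>a\<close>. For these two points
  \<open>a\<close> is replaced by a tuple \<open>a'\<close> of the standard group with the same sign
  formulas and the same instances of \<open>p\<close>. Agreement on the \<open>A i\<close> then
  makes \<open>x @ a'\<close> and \<open>y @ a'\<close> equivalent under \<open>sim\<close>. The
  tuple \<open>a'\<close> varies with \<open>x\<close> and \<open>y\<close>, but the index set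
  \<open>I\<close> does not even depend on \<open>a\<close>.\<close>

theorem lex_grp_uniformly_stably_embedded:
  assumes T: "T = {0} \<or> T = UNIV"
    and two: "\<exists>x\<in>Dom (lex_grp n T). \<exists>y\<in>Dom (lex_grp n T). x \<noteq> y"
    and h: "elementary_extension (lex_grp n T) h N"
  shows "uniformly_stably_embedded_in (lex_grp n T) h N"
  unfolding uniformly_stably_embedded_in_iff
proof (intro allI impI)
  fix m k p assume p: "fm_in (m + k) p"
  let ?G = "lex_grp n T"
  let ?D = "Dom ?G" and ?U = "tuples ?G m"
  interpret nontrivial_struct ?G by unfold_locales (rule two)
  obtain B where B: "\<forall>e\<in>tuples ?G (m + k). \<forall>e'\<in>tuples ?G (m + k). sim n B e e' \<longrightarrow> sat ?G e p \<longrightarrow> sat ?G e' p"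
    using sat_sim[OF T p] unfolding sim_invariant_def by blast
  let ?q = "fact B :: nat"
  \<comment> \<open>A coefficient vector for \<open>x @ a\<close> splits into \<open>c\<close> for
    \<open>x\<close> and \<open>c'\<close> for \<open>a\<close>; \<open>d\<close> is the integer
    constant occurring in \<open>sim\<close>.\<close>
  define C where "C = {c. int_vec m B c} \<times> {d. int_vec n B d} \<times> {c. int_vec k B c}"
  define R where "R = {..<m} \<times> {r. int_vec n ?q r}"
  define I where "I = Inl ` C \<union> Inr ` R"
  define cls where "cls j r = {x \<in> ?U. \<forall>i<n. real_cong (int ?q) ((x ! j) i) ((\<lambda>i. of_int (r i)) i)}" for j and r :: "nat \<Rightarrow> int"
  define F where "F i = (case i of
      Inl (c, d, c') \<Rightarrow> {{x \<in> ?U. (\<lambda>i. comb c x i + d i) \<in> L} | d L.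
        d \<in> ?D \<and> L \<subseteq> ?D \<and> (\<forall>x\<in>L. \<forall>y\<in>?D. lexless x y \<longrightarrow> y \<in> L)}
    | Inr (j, r) \<Rightarrow> {cls j r})"
    for i :: "(nat \<Rightarrow> int) \<times> (nat \<Rightarrow> int) \<times> (nat \<Rightarrow> int) + nat \<times> (nat \<Rightarrow> int)"
  have "finite I" unfolding I_def C_def R_def by (simp add: finite_int_vec)
  have "unif m ?G (F i)" if i: "i \<in> I" for i
  proof -
    consider c d c' where "i = Inl (c, d, c')" | j r where "i = Inr (j, r)" "j < m" "int_vec n ?q r"
      using i unfolding I_def R_def by auto
    then show ?thesis
    proof cases
      case 1
      then show ?thesis unfolding F_def using unif_cuts[OF T two, of m c] by simp
    next
      case 2
      have "unif m ?G {cls j r}" unfolding cls_def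
        by (rule unif_residue_class[OF T 2(2) _ int_vector_in_Dom[OF T 2(3)]]) simp
      then show ?thesis unfolding F_def 2(1) by simp
    qed
  qed
  then have U: "unif m ?G {X. \<exists>A. (\<forall>i\<in>I. A i \<in> F i) \<and> separated_by I A ?U X}"
    by (rule unif_boolean_combination[OF \<open>finite I\<close>])
  show "unif m ?G (trace m ?G h N p ` tuples N k)"
  proof (rule unif_mono[OF U], rule image_subsetI)
    fix a assume a: "a \<in> tuples N k"
    define X where "X = trace m ?G h N p a"
    define L where "L c = {y \<in> ?D. sat N (h y # a) (sign_fm k c)}" for c
    have L_up: "z \<in> L c" if "y \<in> L c" "z \<in> ?D" "lexless y z" for c y z
    proof (rule ccontr)
      assume "z \<notin> L c"
      have y: "y \<in> ?D" using that(1) by (simp add: L_def)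
      \<comment> \<open>Monotonicity in the compared element is checked on an imitation of
        \<open>a\<close>, so no order axioms are derived in \<open>N\<close>.\<close>
      have "\<exists>a'\<in>tuples ?G k. \<forall>(p, b)\<in>{(sign_fm k c, [y]), (sign_fm k c, [z])}.
        sat ?G (b @ a') p \<longleftrightarrow> sat N (map h b @ a) p"
        by (rule finite_transfer[OF h _ a]) (use that y fm_in_sign_fm in auto)
      then obtain a' where a': "a' \<in> tuples ?G k"
        "sat ?G (y # a') (sign_fm k c) \<longleftrightarrow> sat N (h y # a) (sign_fm k c)"
        "sat ?G (z # a') (sign_fm k c) \<longleftrightarrow> sat N (h z # a) (sign_fm k c)" by auto
      have "length a' = k" using a'(1) by (simp add: tuples_def)
      then have "pos (\<lambda>i. y i + comb c a' i)" "\<not> pos (\<lambda>i. z i + comb c a' i)"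
        using a'(2,3) that(1,2) \<open>z \<notin> L c\<close> by (auto simp: sat_sign_fm L_def)
      moreover have "lexless (\<lambda>i. y i + comb c a' i) (\<lambda>i. z i + comb c a' i)"
        using that(3) by (simp add: lexless_def)
      ultimately show False using lexless_trans by blast
    qed
    define A where "A i = (case i of
        Inl (c, d, c') \<Rightarrow> {x \<in> ?U. (\<lambda>i. comb c x i + of_int (d i)) \<in> L c'}
      | Inr (j, r) \<Rightarrow> cls j r)"
      for i :: "(nat \<Rightarrow> int) \<times> (nat \<Rightarrow> int) \<times> (nat \<Rightarrow> int) + nat \<times> (nat \<Rightarrow> int)"
    have "A i \<in> F i" if i: "i \<in> I" for i
    proof -
      consider c d c' where "i = Inl (c, d, c')" "int_vec n B d" | j r where "i = Inr (j, r)"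
        using i unfolding I_def C_def by auto
      then show ?thesis
      proof cases
        case 1
        show ?thesis unfolding A_def F_def 1(1) sum.case prod.case
        proof (intro CollectI exI[of _ "\<lambda>i. of_int (d i)"] exI[of _ "L c'"] conjI ballI impI)
          show "L c' \<subseteq> ?D" by (auto simp: L_def)
          show "(\<lambda>i. of_int (d i)) \<in> ?D" by (rule int_vector_in_Dom[OF T 1(2)])
          fix y z assume "y \<in> L c'" "z \<in> ?D" "lexless y z"
          then show "z \<in> L c'" by (rule L_up)
        qed (rule refl)
      qed (simp add: A_def F_def)
    qed
    moreover have "separated_by I A ?U X"
      unfolding separated_by_def
    proof (intro conjI ballI impI)
      show "X \<subseteq> ?U" by (auto simp: X_def trace_def)
      fix x y assume x: "x \<in> ?U" and y: "y \<in> ?U" and xy: "\<forall>i\<in>I. x \<in> A i \<longleftrightarrow> y \<in> A i" and "x \<in> X"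
      define v where "v c x d i = comb c x i + of_int (d i)" for c d :: "nat \<Rightarrow> int" and x and i :: nat
      have vD: "v c x d \<in> ?D" if "x \<in> ?U" "int_vec n B d" for c x d
        unfolding v_def using T that by (intro add_in_Dom comb_in_Dom int_vector_in_Dom) (auto simp: tuples_def)
      \<comment> \<open>Finitely many formulas fix all that \<open>p\<close> and the sign conditions
        of \<open>sim\<close> can say about \<open>x\<close> and \<open>y\<close> together with
        \<open>a\<close>.\<close>
      define P where "P = {(p, x), (p, y)} \<union> (\<lambda>(c, d, c'). (sign_fm k c', [v c x d])) ` C
        \<union> (\<lambda>(c, d, c'). (sign_fm k c', [v c y d])) ` C"
      have "\<exists>a'\<in>tuples ?G k. \<forall>(p, b)\<in>P. sat ?G (b @ a') p \<longleftrightarrow> sat N (map h b @ a) p"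
      proof (rule finite_transfer[OF h _ a])
        show "finite P" unfolding P_def C_def by (simp add: finite_int_vec)
        fix q b assume "(q, b) \<in> P"
        then consider "q = p" "b = x" | "q = p" "b = y" | c d c' where "q = sign_fm k c'" "b = [v c x d]" "int_vec n B d"
          | c d c' where "q = sign_fm k c'" "b = [v c y d]" "int_vec n B d"
          unfolding P_def C_def by auto
        then show "set b \<subseteq> ?D \<and> fm_in (length b + k) q"
          by cases (use x y p vD fm_in_sign_fm in \<open>auto simp: tuples_def\<close>)
      qed
      then obtain a' where a': "a' \<in> tuples ?G k"
        and P: "\<And>q b. (q, b) \<in> P \<Longrightarrow> sat ?G (b @ a') q \<longleftrightarrow> sat N (map h b @ a) q" by blast
      have len: "length x = m" "length y = m" "length a' = k" using x y a' by (auto simp: tuples_def)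
      have "sim n B (x @ a') (y @ a')"
        unfolding sim_def
      proof (intro conjI allI impI)
        fix c d assume c: "int_vec (length (x @ a')) B c" and d: "int_vec n B d"
        define c1 where "c1 = (\<lambda>j. if j < m then c j else 0)"
        define c2 where "c2 = (\<lambda>j. c (m + j))"
        have i: "(c1, d, c2) \<in> C" using c d len by (auto simp: C_def int_vec_def c1_def c2_def)
        have eq: "(\<lambda>i. comb c (z @ a') i + of_int (d i)) = (\<lambda>i. v c1 z d i + comb c2 a' i)"
          if "length z = m" for z
        proof
          fix i
          have "comb c z = comb c1 z" using that by (intro comb_cong) (simp add: c1_def)
          then show "comb c (z @ a') i + of_int (d i) = v c1 z d i + comb c2 a' i"
            using that by (simp add: comb_append v_def c2_def)
        qed
        have pos: "pos (\<lambda>i. comb c (z @ a') i + of_int (d i)) \<longleftrightarrow> z \<in> A (Inl (c1, d, c2))"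
          if "z \<in> ?U" "(sign_fm k c2, [v c1 z d]) \<in> P" for z
        proof -
          have z: "length z = m" using that(1) by (simp add: tuples_def)
          have "pos (\<lambda>i. comb c (z @ a') i + of_int (d i)) \<longleftrightarrow> sat ?G ([v c1 z d] @ a') (sign_fm k c2)"
            unfolding eq[OF z] using len by (simp add: sat_sign_fm)
          also have "\<dots> \<longleftrightarrow> sat N (h (v c1 z d) # a) (sign_fm k c2)" using P[OF that(2)] by simp
          also have "\<dots> \<longleftrightarrow> v c1 z d \<in> L c2" using vD[OF that(1) d] by (simp add: L_def)
          also have "\<dots> \<longleftrightarrow> z \<in> A (Inl (c1, d, c2))" using that(1) by (simp add: A_def v_def[abs_def])
          finally show ?thesis .
        qed
        have "(sign_fm k c2, [v c1 x d]) \<in> P" "(sign_fm k c2, [v c1 y d]) \<in> P"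
          unfolding P_def using i by force+
        then show "pos (\<lambda>i. comb c (x @ a') i + of_int (d i)) \<longleftrightarrow> pos (\<lambda>i. comb c (y @ a') i + of_int (d i))"
          using pos[OF x] pos[OF y] xy i unfolding I_def by blast
      next
        fix j i assume j: "j < length (x @ a')" and i: "i < n"
        show "real_cong (fact B) (((x @ a') ! j) i) (((y @ a') ! j) i)"
        \<comment> \<open>Entries of \<open>x\<close> and \<open>y\<close> are congruent because the
          two lie in the same residue classes; the entries of \<open>a'\<close> are common to both
          tuples.\<close>
        proof (cases "j < m")
          case True
          have "x ! j \<in> ?D" using x True by (auto simp: tuples_def)
          then obtain r where r: "int_vec n ?q r" "\<forall>i<n. real_cong (int ?q) ((x ! j) i) (of_int (r i))"
            using bounded_residue[of "x ! j" n T ?q] by auto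
          have "x \<in> A (Inr (j, r))" using x r by (simp add: A_def cls_def)
          moreover have "Inr (j, r) \<in> I" using True r by (simp add: I_def R_def)
          ultimately have "y \<in> A (Inr (j, r))" using xy by blast
          then have "real_cong (int ?q) ((y ! j) i) (of_int (r i))" using i by (simp add: A_def cls_def)
          then have "real_cong (int ?q) ((x ! j) i) ((y ! j) i)"
            using r(2) i real_cong_trans real_cong_sym by blast
          then show ?thesis using True len by (simp add: nth_append)
        qed (use len in \<open>simp add: nth_append\<close>)
      qed
      moreover have "x @ a' \<in> tuples ?G (m + k)" "y @ a' \<in> tuples ?G (m + k)"
        using x y a' by (auto intro: tuples_append)
      moreover have "sat ?G (x @ a') p"
        using P[of p x] \<open>x \<in> X\<close> by (simp add: P_def X_def trace_def)
      ultimately have "sat ?G (y @ a') p" using B by blast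
      then show "y \<in> X" using P[of p y] y by (simp add: P_def X_def trace_def)
    qed
    ultimately show "trace m ?G h N p a \<in> {X. \<exists>A. (\<forall>i\<in>I. A i \<in> F i) \<and> separated_by I A ?U X}"
      unfolding X_def by blast
  qed
qed

text \<open>The extension has one element as well, so there is at most one tuple \<open>a\<close>,
  and the formula may be chosen after looking at its trace.\<close>

lemma trivial_uniformly_stably_embedded:
  assumes D: "Dom M = {z}" and h: "elementary_extension M h N"
  shows "uniformly_stably_embedded_in M h N"
  unfolding uniformly_stably_embedded_in_iff
proof (intro allI impI)
  fix m k p
  let ?q = "FAll (FAll (FEq (TVar 0) (TVar 1)))"
  have "sat M [] ?q" using D by simp
  moreover have "fm_in 0 ?q" by simp
  ultimately have "sat N (map h []) ?q" using h tuples_0 unfolding elementary_extension_def by blast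
  then have N: "x = y" if "x \<in> Dom N" "y \<in> Dom N" for x y using that by simp
  have ab: "a = b" if "a \<in> tuples N k" "b \<in> tuples N k" for a b
    using that N by (auto simp: tuples_def subset_iff intro!: nth_equalityI)
  have z: "x = replicate m z" if "x \<in> tuples M m" for x
    using that D by (intro replicate_eqI) (auto simp: tuples_def)
  have tr: "trace m M h N p a = {} \<or> trace m M h N p a = tuples M m" for a
    using z unfolding trace_def by (cases "sat N (map h (replicate m z) @ a) p") blast+
  have "trace m M h N p ` tuples N k \<subseteq> {{}} \<or> trace m M h N p ` tuples N k \<subseteq> {tuples M m}"
  proof (cases "tuples N k = {}")
    case False
    then obtain a where "a \<in> tuples N k" by blast
    with ab have "tuples N k = {a}" by blast
    then show ?thesis using tr[of a] by auto
  qed simp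
  then consider "trace m M h N p ` tuples N k \<subseteq> {{}}" | "trace m M h N p ` tuples N k \<subseteq> {tuples M m}"
    by blast
  then show "unif m M (trace m M h N p ` tuples N k)"
  proof cases
    case 1
    show ?thesis
    proof (rule unif_mono[OF _ 1], rule unifI)
      show "fm_in (m + 0) (FNot (FEq TZero TZero))" by simp
    qed (simp add: definable_set_def)
  next
    case 2
    show ?thesis
    proof (rule unif_mono[OF _ 2], rule unifI)
      show "fm_in (m + 0) (FEq TZero TZero)" by simp
    qed (simp add: definable_set_def)
  qed
qed

lemma uniformly_stably_embedded_lex_grp:
  fixes U :: "'u itself"
  assumes T: "T = {0} \<or> T = UNIV"
  shows "uniformly_stably_embedded U (lex_grp n T)"
  unfolding uniformly_stably_embedded_def
proof (intro allI impI)
  fix N :: "'u lstruct" and h assume h: "elementary_extension (lex_grp n T) h N"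
  show "uniformly_stably_embedded_in (lex_grp n T) h N"
  proof (cases "\<exists>x\<in>Dom (lex_grp n T). \<exists>y\<in>Dom (lex_grp n T). x \<noteq> y")
    case True
    then show ?thesis using lex_grp_uniformly_stably_embedded[OF T _ h] by blast
  next
    case False
    moreover have "(\<lambda>_. 0) \<in> Dom (lex_grp n T)" using T by (auto simp: Dom_lex_grp)
    ultimately have "Dom (lex_grp n T) = {\<lambda>_. 0}" by blast
    then show ?thesis using h by (rule trivial_uniformly_stably_embedded)
  qed
qed

lemma uniformly_stably_embedded_iso:
  fixes U :: "'u itself"
  assumes f: "struct_iso f M N" and M: "is_lstruct M" and N: "uniformly_stably_embedded U N"
  shows "uniformly_stably_embedded U M"
  unfolding uniformly_stably_embedded_def
proof (intro allI impI)
  fix P :: "'u lstruct" and h assume h: "elementary_extension M h P"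
  define g where "g = inv_into (Dom M) f"
  have g: "struct_iso g N M" unfolding g_def by (rule struct_iso_inv[OF f M])
  have N': "is_lstruct N" by (rule is_lstruct_iso[OF f M])
  have "elementary_extension N (h \<circ> g) P" by (rule elementary_extension_iso[OF g N' h])
  then have u: "uniformly_stably_embedded_in N (h \<circ> g) P" using N unfolding uniformly_stably_embedded_def by blast
  have bij: "bij_betw f (Dom M) (Dom N)" using f by (simp add: struct_iso_def)
  have gf: "g (f x) = x" if "x \<in> Dom M" for x
    using bij that unfolding g_def by (simp add: bij_betw_def)
  have mgf: "map (h \<circ> g) (map f x) = map h x" if "x \<in> tuples M m" for x m
    using that gf by (auto simp: tuples_def)
  have mf: "map f x \<in> tuples N m" if "x \<in> tuples M m" for x m
    using that map_tuples_iso[OF f, of m] by blast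
  show "uniformly_stably_embedded_in M h P"
    unfolding uniformly_stably_embedded_in_def
  proof (intro allI impI)
    fix m k p assume "fm_in (m + k) p"
    then obtain l q where q: "fm_in (m + l) q"
      "\<forall>a\<in>tuples P k. \<exists>b\<in>tuples N l. trace m N (h \<circ> g) P p a = definable_set m N q b"
      using u unfolding uniformly_stably_embedded_in_def by meson
    have "\<exists>b\<in>tuples M l. trace m M h P p a = definable_set m M q b" if a: "a \<in> tuples P k" for a
    proof -
      obtain b where b: "b \<in> tuples N l" "trace m N (h \<circ> g) P p a = definable_set m N q b"
        using bspec[OF q(2) a] by blast
      obtain b' where b': "b' \<in> tuples M l" "b = map f b'"
        using b(1) map_tuples_iso[OF f, of l] by blast
      have "sat P (map h x @ a) p \<longleftrightarrow> sat M (x @ b') q" if x: "x \<in> tuples M m" for x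
      proof -
        have "sat P (map h x @ a) p \<longleftrightarrow> map f x \<in> trace m N (h \<circ> g) P p a"
          using mf[OF x] mgf[OF x] by (simp add: trace_def del: map_map)
        also have "\<dots> \<longleftrightarrow> sat N (map f (x @ b')) q"
          using mf[OF x] b'(2) unfolding b(2) by (simp add: definable_set_def)
        also have "\<dots> \<longleftrightarrow> sat M (x @ b') q"
          using x b'(1) q(1) by (intro sat_iso[OF f M]) (auto simp: tuples_def)
        finally show ?thesis .
      qed
      then have "trace m M h P p a = definable_set m M q b'"
        unfolding trace_def definable_set_def by blast
      then show ?thesis using b'(1) by blast
    qed
    then show "\<exists>l q. fm_in (m + l) q \<and>
      (\<forall>a\<in>tuples P k. \<exists>b\<in>tuples M l. trace m M h P p a = definable_set m M q b)"
      using q(1) by blast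
  qed
qed

lemma stably_embedded_if_uniformly: "uniformly_stably_embedded U M \<Longrightarrow> stably_embedded U M"
  unfolding uniformly_stably_embedded_def stably_embedded_def
    uniformly_stably_embedded_in_def stably_embedded_in_def by meson

section \<open>Identification with the groups of integer lists\<close>

lemma lex_nth:
  assumes "length xs = n" "length ys = n"
  shows "(xs, ys) \<in> lex r \<longleftrightarrow> (\<exists>i<n. (xs ! i, ys ! i) \<in> r \<and> (\<forall>j<i. xs ! j = ys ! j))"
proof
  assume "(xs, ys) \<in> lex r"
  then obtain us x y vs ws where "xs = us @ x # vs" "ys = us @ y # ws" "(x, y) \<in> r"
    by (auto simp: lex_conv)
  then show "\<exists>i<n. (xs ! i, ys ! i) \<in> r \<and> (\<forall>j<i. xs ! j = ys ! j)"
    using assms by (intro exI[of _ "length us"]) (auto simp: nth_append)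
next
  assume "\<exists>i<n. (xs ! i, ys ! i) \<in> r \<and> (\<forall>j<i. xs ! j = ys ! j)"
  then obtain i where i: "i < n" "(xs ! i, ys ! i) \<in> r" "\<forall>j<i. xs ! j = ys ! j" by blast
  have "take i xs = take i ys" using i assms by (intro nth_equalityI) auto
  then have "xs = take i xs @ xs ! i # drop (Suc i) xs" "ys = take i xs @ ys ! i # drop (Suc i) ys"
    using i assms id_take_nth_drop[of i xs] id_take_nth_drop[of i ys] by simp_all
  with i(2) have "\<exists>us x y vs ws. xs = us @ x # vs \<and> ys = us @ y # ws \<and> (x, y) \<in> r"
    by (intro exI conjI)
  then show "(xs, ys) \<in> lex r" using assms by (simp add: lex_conv)
qed

definition coords :: "int list \<times> real \<Rightarrow> nat \<Rightarrow> real" where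
  "coords = (\<lambda>(xs, r) i. if i < length xs then of_int (xs ! i) else if i = length xs then r else 0)"

lemma lexless_coords:
  assumes "length xs = n" "length ys = n"
  shows "lexless (coords (xs, r)) (coords (ys, s)) \<longleftrightarrow>
    (xs, ys) \<in> lex {(a, b). a < b} \<or> xs = ys \<and> r < s"
proof
  assume "lexless (coords (xs, r)) (coords (ys, s))"
  then obtain i where i: "coords (xs, r) i < coords (ys, s) i" "\<forall>j<i. coords (xs, r) j = coords (ys, s) j"
    by (auto simp: lexless_def)
  have eq: "xs ! j = ys ! j" if "j < i" "j < n" for j
    using i(2)[rule_format, OF that(1)] that(2) assms by (simp add: coords_def)
  show "(xs, ys) \<in> lex {(a, b). a < b} \<or> xs = ys \<and> r < s"
  proof (cases "i < n")
    case True
    then have "xs ! i < ys ! i" using i(1) assms by (simp add: coords_def)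
    then show ?thesis using True eq assms by (auto simp: lex_nth)
  next
    case False
    then have "i = n" using i(1) assms by (auto simp: coords_def split: if_splits)
    then show ?thesis using eq i(1) assms by (auto simp: coords_def intro: nth_equalityI)
  qed
next
  assume "(xs, ys) \<in> lex {(a, b). a < b} \<or> xs = ys \<and> r < s"
  then consider i where "i < n" "xs ! i < ys ! i" "\<forall>j<i. xs ! j = ys ! j" | "xs = ys" "r < s"
    using assms by (auto simp: lex_nth)
  then show "lexless (coords (xs, r)) (coords (ys, s))"
  proof cases
    case 1
    then show ?thesis unfolding lexless_def using assms by (intro exI[of _ i]) (simp add: coords_def)
  next
    case 2
    then show ?thesis unfolding lexless_def using assms by (intro exI[of _ n]) (simp add: coords_def)
  qed
qed

lemma bij_betw_coords:
  "bij_betw coords ({xs. length xs = n} \<times> T) (Dom (lex_grp n T))"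
proof (rule bij_betw_byWitness[where f' = "\<lambda>x. (map (\<lambda>i. \<lfloor>x i\<rfloor>) [0..<n], x n)"])
  show "\<forall>a\<in>{xs. length xs = n} \<times> T. (map (\<lambda>i. \<lfloor>coords a i\<rfloor>) [0..<n], coords a n) = a"
    by (auto simp: coords_def intro!: nth_equalityI)
  show "\<forall>x\<in>Dom (lex_grp n T). coords (map (\<lambda>i. \<lfloor>x i\<rfloor>) [0..<n], x n) = x"
    by (auto simp: coords_def Dom_lex_grp fun_eq_iff)
qed (auto simp: coords_def Dom_lex_grp)

lemma struct_iso_lex_times: "struct_iso coords (lex_times (Z_pow n) R_grp) (lex_grp n UNIV)"
proof -
  let ?M = "lex_times (Z_pow n) R_grp"
  have D: "Dom ?M = {xs. length xs = n} \<times> UNIV"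
    by (simp add: lex_times_def Z_pow_def R_grp_def)
  have "bij_betw coords (Dom ?M) (Dom (lex_grp n UNIV))"
    unfolding D by (rule bij_betw_coords)
  moreover have "coords (zero_of ?M) = (\<lambda>_. 0)"
    by (auto simp: lex_times_def Z_pow_def R_grp_def coords_def fun_eq_iff)
  moreover have "coords (plus_of ?M x y) = (\<lambda>i. coords x i + coords y i)"
    "coords (neg_of ?M x) = (\<lambda>i. - coords x i)"
    if "x \<in> Dom ?M" "y \<in> Dom ?M" for x y
    using that unfolding D by (auto simp: lex_times_def Z_pow_def R_grp_def coords_def fun_eq_iff)
  moreover have "less_of ?M x y \<longleftrightarrow> lexless (coords x) (coords y)"
    if xy: "x \<in> Dom ?M" "y \<in> Dom ?M" for x y
  proof -
    obtain xs r ys s where "x = (xs, r)" "y = (ys, s)" "length xs = n" "length ys = n"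
      using xy unfolding D by auto
    then show ?thesis by (simp add: lexless_coords) (simp add: lex_times_def Z_pow_def R_grp_def)
  qed
  ultimately show ?thesis unfolding struct_iso_def by simp
qed

lemma struct_iso_Z_pow: "struct_iso (\<lambda>xs. coords (xs, 0)) (Z_pow n) (lex_grp n {0})"
proof -
  have D: "Dom (Z_pow n) = {xs. length xs = n}" by (simp add: Z_pow_def)
  have "bij_betw (\<lambda>xs. (xs, 0)) {xs::int list. length xs = n} ({xs. length xs = n} \<times> {0::real})"
    by (auto simp: bij_betw_def inj_on_def)
  from bij_betw_trans[OF this bij_betw_coords]
  have "bij_betw (\<lambda>xs. coords (xs, 0)) (Dom (Z_pow n)) (Dom (lex_grp n {0}))"
    by (simp add: D o_def)
  moreover have "coords (zero_of (Z_pow n), 0) = (\<lambda>_. 0)"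
    by (auto simp: Z_pow_def coords_def fun_eq_iff)
  moreover have "coords (plus_of (Z_pow n) x y, 0) = (\<lambda>i. coords (x, 0) i + coords (y, 0) i)"
    "coords (neg_of (Z_pow n) x, 0) = (\<lambda>i. - coords (x, 0) i)"
    if "x \<in> Dom (Z_pow n)" "y \<in> Dom (Z_pow n)" for x y
    using that unfolding D by (auto simp: Z_pow_def coords_def fun_eq_iff)
  moreover have "less_of (Z_pow n) x y \<longleftrightarrow> lexless (coords (x, 0)) (coords (y, 0))"
    if "x \<in> Dom (Z_pow n)" "y \<in> Dom (Z_pow n)" for x y
    using that unfolding D by (simp add: lexless_coords) (simp add: Z_pow_def)
  ultimately show ?thesis unfolding struct_iso_def by simp
qed

lemma is_lstruct_Z_pow: "is_lstruct (Z_pow n)"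
  by (auto simp: is_lstruct_def Z_pow_def)

lemma is_lstruct_lex_times: "is_lstruct (lex_times (Z_pow n) R_grp)"
  by (auto simp: is_lstruct_def Z_pow_def lex_times_def R_grp_def)


section \<open>Realising cuts in elementary extensions\<close>

text \<open>A minimal proper filter below \<open>sequentially\<close>, from Zorn's lemma. A chain of
  proper filters has a proper infimum, because an event that is eventual for the infimum is already
  eventual for a member.\<close>

lemma free_ultrafilter_exists:
  "\<exists>F::nat filter. F \<le> sequentially \<and> F \<noteq> bot \<and>
    (\<forall>P. eventually P F \<or> eventually (\<lambda>x. \<not> P x) F)"
proof -
  define A where "A = {F::nat filter. F \<le> sequentially \<and> F \<noteq> bot}"
  \<comment> \<open>The order is reversed, so that maximality means being finest.\<close>
  have "\<exists>m\<in>A. \<forall>a\<in>A. (\<lambda>F F'. F' \<le> F) m a \<longrightarrow> a = m"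
  proof (rule predicate_Zorn)
    show "partial_order_on A (relation_of (\<lambda>F F'. F' \<le> F) A)"
      by (rule partial_order_on_relation_ofI) auto
    fix C assume C: "C \<in> Chains (relation_of (\<lambda>F F'. F' \<le> F) A)"
    then have CA: "C \<subseteq> A" and chain: "\<And>F F'. F \<in> C \<Longrightarrow> F' \<in> C \<Longrightarrow> F \<le> F' \<or> F' \<le> F"
      unfolding Chains_def relation_of_def by blast+
    show "\<exists>u\<in>A. \<forall>a\<in>C. u \<le> a"
    proof (cases "C = {}")
      case True
      have "sequentially \<in> A" by (simp add: A_def)
      then show ?thesis using True by blast
    next
      case False
      then obtain F0 where F0: "F0 \<in> C" by blast
      have "\<not> eventually (\<lambda>_. False) (Inf C)"
      proof
        assume "eventually (\<lambda>_. False) (Inf C)"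
        then have "\<exists>F\<in>C. eventually (\<lambda>_. False) F"
        proof (subst (asm) eventually_Inf_base[OF False])
          fix F F' assume "F \<in> C" "F' \<in> C"
          then show "\<exists>x\<in>C. x \<le> inf F F'" using chain[of F F'] by (metis inf.absorb1 inf.absorb2 order_refl)
        qed
        then show False using CA by (auto simp: A_def trivial_limit_def)
      qed
      then have "Inf C \<noteq> bot" by (auto simp: trivial_limit_def)
      moreover have "Inf C \<le> F0" using F0 by (rule Inf_lower)
      then have "Inf C \<le> sequentially" using F0 CA by (auto simp: A_def intro: order_trans)
      ultimately have "Inf C \<in> A" by (simp add: A_def)
      then show ?thesis by (meson Inf_lower)
    qed
  qed
  then obtain F where F: "F \<in> A" and min: "\<And>F'. F' \<in> A \<Longrightarrow> F' \<le> F \<Longrightarrow> F' = F" by blast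
  have "eventually P F \<or> eventually (\<lambda>x. \<not> P x) F" for P
  proof (cases "inf F (principal {x. P x}) = bot")
    case True
    then have "eventually (\<lambda>_. False) (inf F (principal {x. P x}))" by simp
    then show ?thesis by (simp add: eventually_inf_principal)
  next
    case False
    have "inf F (principal {x. P x}) \<le> F" by simp
    moreover have "inf F (principal {x. P x}) \<in> A"
      using False F by (auto simp: A_def intro: le_infI1)
    ultimately have "inf F (principal {x. P x}) = F" by (intro min)
    then have "F \<le> principal {x. P x}" by (metis inf_le2)
    then show ?thesis by (simp add: le_principal)
  qed
  then show ?thesis using F by (auto simp: A_def)
qed

instance tm :: countable by countable_datatype
instance fm :: countable by countable_datatype

text \<open>
  Skolem terms over the elements of \<open>M\<close> and one generic sequence. They denote sequences of
  tuples, and the classes of the sequences of elements among them form an elementary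
  extension of \<open>M\<close> that is small enough to be placed on the same type.
\<close>

datatype 'a sk = Const 'a | Generic | Empty | Append "'a sk" "'a sk" | Wit fm "'a sk"

text \<open>The implication inside the choice keeps the value in the domain even if \<open>p\<close>
  has no solution, so every Skolem term over the domain denotes a sequence there.\<close>

definition witness :: "'a lstruct \<Rightarrow> fm \<Rightarrow> 'a list \<Rightarrow> 'a" where
  "witness M p e = (SOME x. x \<in> Dom M \<and> ((\<exists>y\<in>Dom M. sat M (y # e) p) \<longrightarrow> sat M (x # e) p))"

lemma witness:
  assumes "is_lstruct M"
  shows "witness M p e \<in> Dom M" "y \<in> Dom M \<Longrightarrow> sat M (y # e) p \<Longrightarrow> sat M (witness M p e # e) p"
proof -
  have "\<exists>x. x \<in> Dom M \<and> ((\<exists>y\<in>Dom M. sat M (y # e) p) \<longrightarrow> sat M (x # e) p)"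
    using assms unfolding is_lstruct_def by blast
  from someI_ex[OF this] show "witness M p e \<in> Dom M"
    "y \<in> Dom M \<Longrightarrow> sat M (y # e) p \<Longrightarrow> sat M (witness M p e # e) p"
    unfolding witness_def by blast+
qed

fun sk_val :: "'a lstruct \<Rightarrow> (nat \<Rightarrow> 'a) \<Rightarrow> 'a sk \<Rightarrow> nat \<Rightarrow> 'a list" where
  "sk_val M s (Const x) j = [x]"
| "sk_val M s Generic j = [s j]"
| "sk_val M s Empty j = []"
| "sk_val M s (Append t u) j = sk_val M s t j @ sk_val M s u j"
| "sk_val M s (Wit p t) j = [witness M p (sk_val M s t j)]"

fun sk_code :: "('a \<Rightarrow> 'a \<Rightarrow> 'a) \<Rightarrow> (nat \<Rightarrow> 'a) \<Rightarrow> 'a sk \<Rightarrow> 'a" where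
  "sk_code f c (Const x) = f (c 0) x"
| "sk_code f c Generic = f (c 1) (c 0)"
| "sk_code f c Empty = f (c 2) (c 0)"
| "sk_code f c (Append t u) = f (c 3) (f (sk_code f c t) (sk_code f c u))"
| "sk_code f c (Wit p t) = f (c (4 + to_nat p)) (sk_code f c t)"

lemma sk_code_inj:
  assumes "\<And>x y x' y'. f x y = f x' y' \<longleftrightarrow> x = x' \<and> y = y'" "inj c"
  shows "sk_code f c t = sk_code f c u \<Longrightarrow> t = u"
proof (induction t arbitrary: u)
  case (Const x) then show ?case by (cases u) (auto simp: assms(1) inj_eq[OF assms(2)])
next
  case Generic then show ?case by (cases u) (auto simp: assms(1) inj_eq[OF assms(2)])
next
  case Empty then show ?case by (cases u) (auto simp: assms(1) inj_eq[OF assms(2)])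
next
  case (Append t1 t2) then show ?case by (cases u) (auto simp: assms(1) inj_eq[OF assms(2)])
next
  case (Wit p t) then show ?case by (cases u) (auto simp: assms(1) inj_eq[OF assms(2)])
qed

text \<open>An infinite type is in bijection with its square and contains countably many tags, so
  the finite trees over it can be coded by iterated pairing.\<close>

lemma sk_inj_exists:
  assumes "infinite (UNIV :: 'u set)"
  shows "\<exists>h :: 'u sk \<Rightarrow> 'u. inj h"
proof -
  obtain g where g: "bij_betw g ((UNIV :: 'u set) \<times> (UNIV :: 'u set)) (UNIV :: 'u set)"
    using card_of_Times_same_infinite[OF assms] card_of_ordIso by blast
  obtain c :: "nat \<Rightarrow> 'u" where c: "inj c" using infinite_countable_subset[OF assms] by blast
  have "inj g" using g by (simp add: bij_betw_def)
  then have "g (x, y) = g (x', y') \<longleftrightarrow> x = x' \<and> y = y'" for x y x' y'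
    by (simp add: inj_eq)
  then have "inj (sk_code (\<lambda>x y. g (x, y)) c)"
    using sk_code_inj[of "\<lambda>x y. g (x, y)" c] c by (intro injI) blast
  then show ?thesis by (rule exI[where P = inj])
qed

locale skolem_ultrapower =
  fixes M :: "'u lstruct" and s :: "nat \<Rightarrow> 'u" and U :: "nat filter" and code :: "'u sk \<Rightarrow> 'u"
  assumes M: "is_lstruct M" and s: "\<And>j. s j \<in> Dom M"
    and U_bot: "U \<noteq> bot" and ultra: "\<And>P. eventually P U \<or> eventually (\<lambda>x. \<not> P x) U"
    and code: "inj code"
begin

lemma eventually_not: "eventually (\<lambda>x. \<not> P x) U \<longleftrightarrow> \<not> eventually P U"
proof
  assume n: "eventually (\<lambda>x. \<not> P x) U"
  have "eventually (\<lambda>_. False) U" if "eventually P U"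
    by (rule eventually_elim2[OF n that]) blast
  then show "\<not> eventually P U" using U_bot by (auto simp: trivial_limit_def)
qed (use ultra in blast)

definition seqs :: "(nat \<Rightarrow> 'u) set" where
  "seqs = {f. (\<forall>j. f j \<in> Dom M) \<and> (\<exists>t. \<forall>j. sk_val M s t j = [f j])}"

text \<open>The choice depends only on \<open>f\<close> modulo \<open>U\<close>, so the code of the
  chosen Skolem term names the class. This is how the elements of the extension become elements of
  \<open>'u\<close>.\<close>

definition cls :: "(nat \<Rightarrow> 'u) \<Rightarrow> 'u" where
  "cls f = code (SOME t. eventually (\<lambda>j. sk_val M s t j = [f j]) U)"

definition rep :: "'u \<Rightarrow> nat \<Rightarrow> 'u" where
  "rep a = (SOME f. f \<in> seqs \<and> cls f = a)"

definition N :: "'u lstruct" where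
  "N = \<lparr> Dom = cls ` seqs,
         zero_of = cls (\<lambda>_. zero_of M),
         plus_of = (\<lambda>a b. cls (\<lambda>j. plus_of M (rep a j) (rep b j))),
         neg_of = (\<lambda>a. cls (\<lambda>j. neg_of M (rep a j))),
         less_of = (\<lambda>a b. eventually (\<lambda>j. less_of M (rep a j) (rep b j)) U) \<rparr>"

lemma seqs_Dom: "f \<in> seqs \<Longrightarrow> f j \<in> Dom M"
  by (simp add: seqs_def)

lemma cls_cong:
  assumes "eventually (\<lambda>j. f j = g j) U"
  shows "cls f = cls g"
proof -
  have "eventually (\<lambda>j. sk_val M s t j = [f j]) U \<longleftrightarrow> eventually (\<lambda>j. sk_val M s t j = [g j]) U" for t
    by (rule eventually_subst[OF eventually_mono[OF assms]]) simp
  then show ?thesis unfolding cls_def by simp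
qed

lemma cls_eq_iff:
  assumes "f \<in> seqs" "g \<in> seqs"
  shows "cls f = cls g \<longleftrightarrow> eventually (\<lambda>j. f j = g j) U"
proof
  define t where "t f = (SOME t. eventually (\<lambda>j. sk_val M s t j = [f j]) U)" for f
  have t: "eventually (\<lambda>j. sk_val M s (t f) j = [f j]) U" if f: "f \<in> seqs" for f
  proof -
    obtain u where "\<forall>j. sk_val M s u j = [f j]" using f by (auto simp: seqs_def)
    then have "eventually (\<lambda>j. sk_val M s u j = [f j]) U" by simp
    then show ?thesis unfolding t_def by (rule someI)
  qed
  assume "cls f = cls g"
  then have "t f = t g" using code unfolding cls_def t_def by (rule injD[rotated])
  then have "eventually (\<lambda>j. sk_val M s (t f) j = [g j]) U" using t[OF assms(2)] by simp
  with t[OF assms(1)] show "eventually (\<lambda>j. f j = g j) U" by (rule eventually_elim2) simp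
qed (rule cls_cong)

lemma rep:
  assumes "f \<in> seqs"
  shows "rep (cls f) \<in> seqs" "eventually (\<lambda>j. rep (cls f) j = f j) U"
proof -
  have "rep (cls f) \<in> seqs \<and> cls (rep (cls f)) = cls f"
    unfolding rep_def by (rule someI[of _ f]) (simp add: assms)
  then show "rep (cls f) \<in> seqs" "eventually (\<lambda>j. rep (cls f) j = f j) U"
    using cls_eq_iff assms by blast+
qed

lemma const_seqs: "x \<in> Dom M \<Longrightarrow> (\<lambda>_. x) \<in> seqs"
  unfolding seqs_def by (auto intro!: exI[of _ "Const x"])

lemma generic_seqs: "s \<in> seqs"
  unfolding seqs_def using s by (auto intro!: exI[of _ Generic])

lemma witness_seqs:
  assumes "set e \<subseteq> seqs"
  shows "(\<lambda>j. witness M p (map (\<lambda>f. f j) e)) \<in> seqs"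
proof -
  have "\<exists>t. \<forall>j. sk_val M s t j = map (\<lambda>f. f j) e" using assms
  proof (induction e)
    case Nil
    then show ?case by (auto intro!: exI[of _ Empty])
  next
    case (Cons f e)
    then obtain t where "\<forall>j. sk_val M s t j = map (\<lambda>f. f j) e" by auto
    moreover obtain u where "\<forall>j. sk_val M s u j = [f j]" using Cons.prems by (auto simp: seqs_def)
    ultimately have "\<forall>j. sk_val M s (Append u t) j = map (\<lambda>f. f j) (f # e)" by simp
    then show ?case by blast
  qed
  then obtain t where "\<forall>j. sk_val M s t j = map (\<lambda>f. f j) e" by blast
  then have "\<forall>j. sk_val M s (Wit p t) j = [witness M p (map (\<lambda>f. f j) e)]" by simp
  then show ?thesis unfolding seqs_def using witness(1)[OF M] by blast
qed

text \<open>Skolem terms have no constructors for the group operations: the value of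
  \<open>t\<close> is the unique witness of \<open>x = t\<close>.\<close>

lemma tm_val_seqs:
  assumes "set e \<subseteq> seqs" "tm_in (length e) t"
  shows "(\<lambda>j. tm_val M (map (\<lambda>f. f j) e) t) \<in> seqs"
proof -
  let ?p = "FEq (TVar 0) (tren Suc t)"
  have "witness M ?p (map (\<lambda>f. f j) e) = tm_val M (map (\<lambda>f. f j) e) t" for j
  proof -
    let ?e = "map (\<lambda>f. f j) e"
    have eq: "sat M (x # ?e) ?p \<longleftrightarrow> x = tm_val M ?e t" for x
      using tm_val_tren[of "length e" t "x # ?e" Suc ?e M] assms(2) by simp
    have "tm_val M ?e t \<in> Dom M"
      using assms seqs_Dom by (intro tm_val_in_Dom[OF M]) auto
    then have "sat M (witness M ?p ?e # ?e) ?p" using eq by (intro witness(2)[OF M]) blast+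
    then show ?thesis using eq by blast
  qed
  then show ?thesis using witness_seqs[OF assms(1), of ?p] by simp
qed

lemma tm_val_N:
  assumes "set e \<subseteq> seqs" "tm_in (length e) t"
  shows "tm_val N (map cls e) t = cls (\<lambda>j. tm_val M (map (\<lambda>f. f j) e) t)"
  using assms(2)
proof (induction t)
  case (TPlus t u)
  let ?v = "\<lambda>t j. tm_val M (map (\<lambda>f. f j) e) t"
  have "?v t \<in> seqs" "?v u \<in> seqs" using TPlus.prems assms(1) by (auto intro: tm_val_seqs)
  note r = rep(2)[OF this(1)] rep(2)[OF this(2)]
  have "cls (\<lambda>j. plus_of M (rep (cls (?v t)) j) (rep (cls (?v u)) j)) = cls (\<lambda>j. plus_of M (?v t j) (?v u j))"
    by (rule cls_cong, rule eventually_elim2[OF r]) simp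
  then show ?case using TPlus by (simp add: N_def)
next
  case (TNeg t)
  let ?v = "\<lambda>t j. tm_val M (map (\<lambda>f. f j) e) t"
  have "?v t \<in> seqs" using TNeg.prems assms(1) by (auto intro: tm_val_seqs)
  note r = rep(2)[OF this(1)]
  have "cls (\<lambda>j. neg_of M (rep (cls (?v t)) j)) = cls (\<lambda>j. neg_of M (?v t j))"
    by (rule cls_cong, rule eventually_mono[OF r]) simp
  then show ?case using TNeg by (simp add: N_def)
qed (simp_all add: N_def)

lemma los:
  assumes "set e \<subseteq> seqs" "fm_in (length e) p"
  shows "sat N (map cls e) p \<longleftrightarrow> eventually (\<lambda>j. sat M (map (\<lambda>f. f j) e) p) U"
  using assms
proof (induction p arbitrary: e)
  case (FEq t u)
  then show ?case by (simp add: tm_val_N cls_eq_iff tm_val_seqs)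
next
  case (FLess t u)
  let ?v = "\<lambda>t j. tm_val M (map (\<lambda>f. f j) e) t"
  have tu: "tm_in (length e) t" "tm_in (length e) u" using FLess by auto
  then have "?v t \<in> seqs" "?v u \<in> seqs" using FLess by (auto intro: tm_val_seqs)
  note r = rep(2)[OF this(1)] rep(2)[OF this(2)]
  have "eventually (\<lambda>j. less_of M (rep (cls (?v t)) j) (rep (cls (?v u)) j) \<longleftrightarrow> less_of M (?v t j) (?v u j)) U"
    by (rule eventually_elim2[OF r]) simp
  then have "eventually (\<lambda>j. less_of M (rep (cls (?v t)) j) (rep (cls (?v u)) j)) U \<longleftrightarrow>
    eventually (\<lambda>j. less_of M (?v t j) (?v u j)) U" by (rule eventually_subst)
  then show ?case unfolding sat.simps tm_val_N[OF FLess.prems(1) tu(1)] tm_val_N[OF FLess.prems(1) tu(2)]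
    by (simp add: N_def)
next
  case (FNot p)
  then have "fm_in (length e) p" by simp
  from FNot.IH[OF FNot.prems(1) this] show ?case by (simp add: eventually_not)
next
  case (FAnd p q)
  then have "fm_in (length e) p" "fm_in (length e) q" by simp_all
  from FAnd.IH(1)[OF FAnd.prems(1) this(1)] FAnd.IH(2)[OF FAnd.prems(1) this(2)]
  show ?case by (simp add: eventually_conj_iff)
next
  case (FEx p)
  have IH: "sat N (map cls (f # e)) p \<longleftrightarrow> eventually (\<lambda>j. sat M (map (\<lambda>f. f j) (f # e)) p) U"
    if "f \<in> seqs" for f
    using that FEx.prems by (intro FEx.IH) auto
  have "sat N (map cls e) (FEx p) \<longleftrightarrow> (\<exists>f\<in>seqs. sat N (map cls (f # e)) p)"
    by (simp add: N_def)
  also have "\<dots> \<longleftrightarrow> (\<exists>f\<in>seqs. eventually (\<lambda>j. sat M (map (\<lambda>f. f j) (f # e)) p) U)"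
    by (rule bex_cong[OF refl IH])
  also have "\<dots> \<longleftrightarrow> eventually (\<lambda>j. sat M (map (\<lambda>f. f j) e) (FEx p)) U"
  proof
    assume "\<exists>f\<in>seqs. eventually (\<lambda>j. sat M (map (\<lambda>f. f j) (f # e)) p) U"
    then obtain f where f: "f \<in> seqs" "eventually (\<lambda>j. sat M (map (\<lambda>f. f j) (f # e)) p) U" ..
    from f(2) show "eventually (\<lambda>j. sat M (map (\<lambda>f. f j) e) (FEx p)) U"
      by (rule eventually_mono) (use seqs_Dom[OF f(1)] in auto)
  next
    assume *: "eventually (\<lambda>j. sat M (map (\<lambda>f. f j) e) (FEx p)) U"
    \<comment> \<open>A full ultrapower would choose the witnesses arbitrarily; here they must form
      a Skolem sequence.\<close>
    let ?f = "\<lambda>j. witness M p (map (\<lambda>f. f j) e)"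
    have "eventually (\<lambda>j. sat M (map (\<lambda>f. f j) (?f # e)) p) U"
      using * by (rule eventually_mono) (auto intro: witness(2)[OF M])
    then show "\<exists>f\<in>seqs. eventually (\<lambda>j. sat M (map (\<lambda>f. f j) (f # e)) p) U"
      using witness_seqs[OF FEx.prems(1)] by blast
  qed
  finally show ?case .
qed

lemma is_lstruct_N: "is_lstruct N"
proof -
  have z: "(\<lambda>_. zero_of M) \<in> seqs" using M by (intro const_seqs) (simp add: is_lstruct_def)
  have "cls (\<lambda>j. plus_of M (rep a j) (rep b j)) \<in> cls ` seqs"
    if "a \<in> cls ` seqs" "b \<in> cls ` seqs" for a b
  proof -
    have "rep a \<in> seqs" "rep b \<in> seqs" using that rep(1) by auto
    then show ?thesis using tm_val_seqs[of "[rep a, rep b]" "TPlus (TVar 0) (TVar 1)"]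
      by (intro imageI) simp
  qed
  moreover have "cls (\<lambda>j. neg_of M (rep a j)) \<in> cls ` seqs" if "a \<in> cls ` seqs" for a
  proof -
    have "rep a \<in> seqs" using that rep(1) by auto
    then show ?thesis using tm_val_seqs[of "[rep a]" "TNeg (TVar 0)"]
      by (intro imageI) simp
  qed
  ultimately show ?thesis using z by (simp add: is_lstruct_def N_def)
qed

lemma elementary_extension_N: "elementary_extension M (\<lambda>x. cls (\<lambda>_. x)) N"
proof -
  have "sat M e p \<longleftrightarrow> sat N (map (\<lambda>x. cls (\<lambda>_. x)) e) p" if "fm_in k p" "e \<in> tuples M k" for k p e
  proof -
    have "set (map (\<lambda>x _. x) e) \<subseteq> seqs" "length e = k"
      using that(2) const_seqs by (auto simp: tuples_def)
    then have "sat N (map cls (map (\<lambda>x _. x) e)) p \<longleftrightarrow> eventually (\<lambda>j. sat M (map (\<lambda>f. f j) (map (\<lambda>x _. x) e)) p) U"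
      using that(1) by (intro los) simp_all
    also have "\<dots> \<longleftrightarrow> sat M e p" using U_bot by (simp add: o_def)
    finally show ?thesis by (simp add: o_def)
  qed
  moreover have "(\<lambda>x. cls (\<lambda>_. x)) ` Dom M \<subseteq> Dom N"
    using const_seqs by (auto simp: N_def)
  ultimately show ?thesis using M is_lstruct_N unfolding elementary_extension_def by blast
qed

end

text \<open>The class of \<open>s\<close> realises the cut: \<open>D\<close> consists of the
  elements below it, because both assumptions on \<open>D\<close> concern all large \<open>j\<close>
  and the ultrafilter refines \<open>sequentially\<close>. Stable embeddedness, applied to the
  formula \<open>x < y\<close> at this one element, defines \<open>D\<close>.\<close>

theorem stably_embedded_cut_definable:
  fixes M :: "'u lstruct"
  assumes "is_lstruct M" "infinite (Dom M)" "stably_embedded TYPE('u) M"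
    and s: "\<And>j. s j \<in> Dom M"
    and D: "\<And>x. x \<in> Dom M \<Longrightarrow> x \<in> D \<Longrightarrow> eventually (\<lambda>j. less_of M x (s j)) sequentially"
      "\<And>x. x \<in> Dom M \<Longrightarrow> x \<notin> D \<Longrightarrow> eventually (\<lambda>j. \<not> less_of M x (s j)) sequentially"
  shows "\<exists>l p. \<exists>b\<in>tuples M l. fm_in (Suc l) p \<and> (\<forall>x\<in>Dom M. x \<in> D \<longleftrightarrow> sat M (x # b) p)"
proof -
  obtain U :: "nat filter" where U: "U \<le> sequentially" "U \<noteq> bot"
    "\<And>P. eventually P U \<or> eventually (\<lambda>x. \<not> P x) U" using free_ultrafilter_exists by blast
  have "infinite (UNIV :: 'u set)" using assms(2) finite_subset subset_UNIV by blast
  then obtain code :: "'u sk \<Rightarrow> 'u" where code: "inj code" using sk_inj_exists by blast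
  interpret skolem_ultrapower M s U code
    by unfold_locales (use assms(1) s U code in auto)
  let ?h = "\<lambda>x. cls (\<lambda>_. x)"
  let ?p = "FLess (TVar 0) (TVar 1)"
  have "stably_embedded_in M ?h N"
    using assms(3) elementary_extension_N unfolding stably_embedded_def by blast
  moreover have "fm_in (1 + 1) ?p" by simp
  moreover have "[cls s] \<in> tuples N 1" using generic_seqs by (simp add: tuples_def N_def)
  ultimately obtain l p b where p: "fm_in (1 + l) p" "b \<in> tuples M l"
    "trace 1 M ?h N ?p [cls s] = definable_set 1 M p b"
    unfolding stably_embedded_in_def by meson
  have "x \<in> D \<longleftrightarrow> sat M (x # b) p" if x: "x \<in> Dom M" for x
  proof -
    have "sat N (map cls [\<lambda>_. x, s]) ?p \<longleftrightarrow> eventually (\<lambda>j. sat M (map (\<lambda>f. f j) [\<lambda>_. x, s]) ?p) U"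
      using x const_seqs generic_seqs by (intro los) simp_all
    then have "sat N [?h x, cls s] ?p \<longleftrightarrow> eventually (\<lambda>j. less_of M x (s j)) U" by simp
    also have "\<dots> \<longleftrightarrow> x \<in> D"
    proof (cases "x \<in> D")
      case True
      then show ?thesis using filter_leD[OF U(1) D(1)[OF x]] by simp
    next
      case False
      then show ?thesis using filter_leD[OF U(1) D(2)[OF x]] eventually_not by simp
    qed
    finally have "x \<in> D \<longleftrightarrow> [x] \<in> trace 1 M ?h N ?p [cls s]"
      using x by (simp add: trace_def tuples_def)
    also have "\<dots> \<longleftrightarrow> sat M (x # b) p" unfolding p(3) using x by (simp add: definable_set_def tuples_def)
    finally show ?thesis .
  qed
  then show ?thesis using p(1,2) by (metis plus_1_eq_Suc)
qed


section \<open>Frames\<close>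

text \<open>
  Parameters \<open>e\<^sub>0, \<dots>, e\<^sub>n\<^sub>-\<^sub>1\<close> define a chain of subsets by \<open>K\<^sub>0 = M\<close>,
  \<open>K\<^sub>i\<^sub>+\<^sub>1 = {x. -e\<^sub>i < 2x < e\<^sub>i}\<close> for \<open>i < n\<close> and \<open>K\<^sub>n\<^sub>+\<^sub>1 = {0}\<close>. They form a frame if this is a chain of
  convex subgroups and \<open>e\<^sub>i\<close> is minimal positive in \<open>K\<^sub>i\<close> modulo \<open>K\<^sub>i\<^sub>+\<^sub>1\<close>, where the last
  group \<open>K\<^sub>n\<close> is nonzero and 2-divisible or zero, according to the flag \<open>r\<close>.
\<close>

definition lev :: "'a lstruct \<Rightarrow> 'a list \<Rightarrow> nat \<Rightarrow> 'a \<Rightarrow> bool" where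
  "lev M es i x \<longleftrightarrow> (case i of 0 \<Rightarrow> True
    | Suc j \<Rightarrow> if j < length es
        then less_of M (neg_of M (es ! j)) (plus_of M x x) \<and> less_of M (plus_of M x x) (es ! j)
        else x = zero_of M)"

definition frame :: "bool \<Rightarrow> 'a lstruct \<Rightarrow> 'a list \<Rightarrow> bool" where
  "frame r M es \<longleftrightarrow>
     (\<forall>i<length es. less_of M (zero_of M) (es ! i) \<and> lev M es i (es ! i) \<and>
       (\<forall>x\<in>Dom M. \<forall>y\<in>Dom M. lev M es (Suc i) x \<longrightarrow> lev M es (Suc i) y \<longrightarrow>
         lev M es (Suc i) (plus_of M x y)) \<and>
       (\<forall>x\<in>Dom M. less_of M (zero_of M) x \<longrightarrow> less_of M x (es ! i) \<longrightarrow>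
         lev M es (Suc i) x \<or> lev M es (Suc i) (plus_of M (es ! i) (neg_of M x)))) \<and>
     (if r then (\<exists>x\<in>Dom M. lev M es (length es) x \<and> x \<noteq> zero_of M) \<and>
         (\<forall>x\<in>Dom M. lev M es (length es) x \<longrightarrow>
           (\<exists>y\<in>Dom M. lev M es (length es) y \<and> plus_of M y y = x))
      else (\<forall>x\<in>Dom M. lev M es (length es) x \<longrightarrow> x = zero_of M))"

text \<open>On either side of \<open>c\<close>, only elements of the coset of \<open>c\<close>
  modulo level \<open>i + 1\<close> may violate the expected value of \<open>P\<close>. A genuine
  supremum cannot be expected, as the cut may run along such a coset. Being a cut is a premise, so
  that the statement can be formed for every formula.\<close>

definition has_cut_sup :: "'a lstruct \<Rightarrow> 'a list \<Rightarrow> ('a \<Rightarrow> bool) \<Rightarrow> nat \<Rightarrow> bool" where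
  "has_cut_sup M es P i \<longleftrightarrow>
     ((\<forall>x\<in>Dom M. \<forall>y\<in>Dom M. P x \<longrightarrow> less_of M y x \<longrightarrow> P y) \<longrightarrow>
      (\<exists>x\<in>Dom M. lev M es i x \<and> P x) \<longrightarrow>
      (\<exists>x\<in>Dom M. lev M es i x \<and> \<not> P x) \<longrightarrow>
      (\<exists>c\<in>Dom M. lev M es i c \<and> (\<forall>x\<in>Dom M. lev M es i x \<longrightarrow>
        (less_of M x c \<longrightarrow> P x \<or> lev M es (Suc i) (plus_of M x (neg_of M c))) \<and>
        (less_of M c x \<longrightarrow> \<not> P x \<or> lev M es (Suc i) (plus_of M x (neg_of M c))))))"

text \<open>\<open>p\<close> counts the quantifiers passed: they move the frame parameters from
  variable 0 to variable \<open>p\<close>.\<close>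

definition lev_fm :: "nat \<Rightarrow> nat \<Rightarrow> nat \<Rightarrow> tm \<Rightarrow> fm" where
  "lev_fm n p i t = (case i of 0 \<Rightarrow> FEq TZero TZero
    | Suc j \<Rightarrow> if j < n
        then FAnd (FLess (TNeg (TVar (p + j))) (TPlus t t)) (FLess (TPlus t t) (TVar (p + j)))
        else FEq t TZero)"

lemma sat_lev_fm:
  assumes "\<And>j. j < length es \<Longrightarrow> e ! (p + j) = es ! j"
  shows "sat M e (lev_fm (length es) p i t) \<longleftrightarrow> lev M es i (tm_val M e t)"
  using assms by (simp add: lev_fm_def lev_def split: nat.split)

lemma fm_in_lev_fm: "tm_in k t \<Longrightarrow> p + n \<le> k \<Longrightarrow> fm_in k (lev_fm n p i t)"
  by (auto simp: lev_fm_def split: nat.split)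

definition frame_fm :: "bool \<Rightarrow> nat \<Rightarrow> fm" where
  "frame_fm r n = FAnd
     (FConj (map (\<lambda>i. FConj
       [FLess TZero (TVar i),
        lev_fm n 0 i (TVar i),
        FAll (FAll (FImp (lev_fm n 2 (Suc i) (TVar 1)) (FImp (lev_fm n 2 (Suc i) (TVar 0))
          (lev_fm n 2 (Suc i) (TPlus (TVar 1) (TVar 0)))))),
        FAll (FImp (FLess TZero (TVar 0)) (FImp (FLess (TVar 0) (TVar (Suc i)))
          (FOr (lev_fm n 1 (Suc i) (TVar 0))
            (lev_fm n 1 (Suc i) (TPlus (TVar (Suc i)) (TNeg (TVar 0)))))))])
       [0..<n]))
     (if r then FAnd (FEx (FAnd (lev_fm n 1 n (TVar 0)) (FNot (FEq (TVar 0) TZero))))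
         (FAll (FImp (lev_fm n 1 n (TVar 0))
           (FEx (FAnd (lev_fm n 2 n (TVar 0)) (FEq (TPlus (TVar 0) (TVar 0)) (TVar 1))))))
      else FAll (FImp (lev_fm n 1 n (TVar 0)) (FEq (TVar 0) TZero)))"

lemma fm_in_frame_fm: "n \<le> k \<Longrightarrow> fm_in k (frame_fm r n)"
  by (auto simp: frame_fm_def intro!: fm_in_lev_fm)

lemma sat_frame_fm: "sat M (es @ b) (frame_fm r (length es)) \<longleftrightarrow> frame r M es"
proof -
  have 0: "sat M (es @ b) (lev_fm (length es) 0 i t) \<longleftrightarrow> lev M es i (tm_val M (es @ b) t)" for i t
    by (rule sat_lev_fm) (simp add: nth_append)
  have 1: "sat M (x # es @ b) (lev_fm (length es) (Suc 0) i t) \<longleftrightarrow> lev M es i (tm_val M (x # es @ b) t)" for x i t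
    by (rule sat_lev_fm) (simp add: nth_append)
  have 2: "sat M (y # x # es @ b) (lev_fm (length es) 2 i t) \<longleftrightarrow> lev M es i (tm_val M (y # x # es @ b) t)" for x y i t
    by (rule sat_lev_fm) (simp add: nth_append)
  have upt: "(\<forall>i\<in>set [0..<length es]. Q i) \<longleftrightarrow> (\<forall>i<length es. Q i)" for Q by auto
  show ?thesis
    unfolding frame_fm_def frame_def
    by (simp add: 0 1 2 nth_append upt del: set_upt cong: all_cong1)
qed

text \<open>\<open>P p v\<close> is \<open>q\<close> under \<open>p\<close> quantifiers with
  variable \<open>v\<close> as its distinguished variable. The parameters of \<open>q\<close> follow
  the \<open>n\<close> frame parameters, as in \<open>es @ b\<close>.\<close>

definition cut_sup_fm :: "nat \<Rightarrow> fm \<Rightarrow> nat \<Rightarrow> fm" where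
  "cut_sup_fm n q i = (let P = (\<lambda>p v. ren (case_nat v (\<lambda>j. p + n + j)) q);
       d = TPlus (TVar 0) (TNeg (TVar 1)) in
     FImp (FAll (FAll (FImp (P 2 1) (FImp (FLess (TVar 0) (TVar 1)) (P 2 0)))))
     (FImp (FEx (FAnd (lev_fm n 1 i (TVar 0)) (P 1 0)))
     (FImp (FEx (FAnd (lev_fm n 1 i (TVar 0)) (FNot (P 1 0))))
     (FEx (FAnd (lev_fm n 1 i (TVar 0)) (FAll (FImp (lev_fm n 2 i (TVar 0))
       (FAnd (FImp (FLess (TVar 0) (TVar 1)) (FOr (P 2 0) (lev_fm n 2 (Suc i) d)))
         (FImp (FLess (TVar 1) (TVar 0)) (FOr (FNot (P 2 0)) (lev_fm n 2 (Suc i) d)))))))))))"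

lemma fm_in_cut_sup_fm: "fm_in (Suc l) q \<Longrightarrow> fm_in (n + l) (cut_sup_fm n q i)"
  unfolding cut_sup_fm_def Let_def
  by (auto intro!: fm_in_lev_fm fm_in_ren[of "Suc l"] split: nat.splits)

lemma sat_cut_sup_fm:
  assumes "fm_in (Suc (length b)) q"
  shows "sat M (es @ b) (cut_sup_fm (length es) q i) \<longleftrightarrow> has_cut_sup M es (\<lambda>x. sat M (x # b) q) i"
proof -
  have 1: "sat M (x # es @ b) (lev_fm (length es) (Suc 0) i t) \<longleftrightarrow> lev M es i (tm_val M (x # es @ b) t)" for x i t
    by (rule sat_lev_fm) (simp add: nth_append)
  have 2: "sat M (y # x # es @ b) (lev_fm (length es) 2 i t) \<longleftrightarrow> lev M es i (tm_val M (y # x # es @ b) t)" for x y i t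
    by (rule sat_lev_fm) (simp add: nth_append)
  have P1: "sat M (x # es @ b) (ren (case_nat 0 (\<lambda>j. Suc 0 + length es + j)) q) \<longleftrightarrow> sat M (x # b) q" for x
    by (rule sat_ren[OF assms]) (simp add: nth_append split: nat.split)
  have P2: "sat M (y # x # es @ b) (ren (case_nat 0 (\<lambda>j. 2 + length es + j)) q) \<longleftrightarrow> sat M (y # b) q"
    "sat M (y # x # es @ b) (ren (case_nat (Suc 0) (\<lambda>j. 2 + length es + j)) q) \<longleftrightarrow> sat M (x # b) q" for x y
    by (rule sat_ren[OF assms]; simp add: nth_append split: nat.split)+
  show ?thesis
    unfolding cut_sup_fm_def has_cut_sup_def Let_def One_nat_def
    by (simp only: sat.simps 1 2 P1 P2 tm_val.simps nth_Cons_0 nth_Cons_Suc not_not de_Morgan_conj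
        disj_not1 imp_conjL bex_simps ball_simps) blast
qed

section \<open>Frames and suprema of cuts in the standard group\<close>

lemma lexless_neg: "lexless (\<lambda>i. - x i) (\<lambda>i. - y i) \<longleftrightarrow> lexless y x"
  by (auto simp: lexless_def)

lemma lexless_minus: "lexless (\<lambda>i. - x i) y \<longleftrightarrow> lexless (\<lambda>i. - y i) x"
  using lexless_neg[of x "\<lambda>i. - y i"] by simp

text \<open>Once the earlier coordinates vanish, coordinate \<open>j\<close> decides the comparison,
  and a nonzero \<open>x j\<close> has a multiple exceeding \<open>e j\<close> in absolute
  value.\<close>

lemma infinitesimal_zero:
  assumes e: "e m > 0" "\<And>j. j < m \<Longrightarrow> e j = 0"
    and x: "\<And>k::nat. lexless (\<lambda>i. real k * x i) e" "\<And>k::nat. lexless (\<lambda>i. - e i) (\<lambda>i. real k * x i)"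
  shows "j \<le> m \<Longrightarrow> x j = 0"
proof (induction j rule: less_induct)
  case (less j)
  have x0: "x i = 0" if "i < j" for i using less that by simp
  have le: "real k * x j \<le> e j" for k
  proof (rule ccontr)
    assume "\<not> real k * x j \<le> e j"
    then have "lexless e (\<lambda>i. real k * x i)"
      unfolding lexless_def using x0 e(2) less(2) by (intro exI[of _ j]) auto
    then show False using x(1)[of k] lexless_not_sym by blast
  qed
  have ge: "- e j \<le> real k * x j" for k
  proof (rule ccontr)
    assume "\<not> - e j \<le> real k * x j"
    then have "lexless (\<lambda>i. real k * x i) (\<lambda>i. - e i)"
      unfolding lexless_def using x0 e(2) less(2) by (intro exI[of _ j]) auto
    then show False using x(2)[of k] lexless_not_sym by blast
  qed
  show "x j = 0"
  proof (rule ccontr)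
    assume "x j \<noteq> 0"
    then obtain k :: nat where k: "e j < real k * \<bar>x j\<bar>"
      using ex_less_of_nat_mult[of "\<bar>x j\<bar>" "e j"] by auto
    show False using le[of k] ge[of k] k by (auto simp: abs_if split: if_splits)
  qed
qed

lemma lex_leading:
  assumes "pos x"
  obtains m where "x m > 0" "\<And>j. j < m \<Longrightarrow> x j = 0"
  using assms unfolding lexless_def by metis

lemma lev_lex_grp_multiple:
  assumes es: "i < length es" "\<forall>x\<in>Dom (lex_grp n T). \<forall>y\<in>Dom (lex_grp n T).
      lev (lex_grp n T) es (Suc i) x \<longrightarrow> lev (lex_grp n T) es (Suc i) y \<longrightarrow> lev (lex_grp n T) es (Suc i) (\<lambda>i. x i + y i)"
    and T: "T = {0} \<or> T = UNIV" and pos: "pos (es ! i)"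
    and x: "x \<in> Dom (lex_grp n T)" "lev (lex_grp n T) es (Suc i) x"
  shows "(\<lambda>i. real k * x i) \<in> Dom (lex_grp n T) \<and> lev (lex_grp n T) es (Suc i) (\<lambda>i. real k * x i)"
proof (induction k)
  case 0
  have "lexless (\<lambda>j. - (es ! i) j) (\<lambda>_. 0)" using pos by (auto simp: lexless_def)
  then show ?case using pos es(1) T by (auto simp: lev_def Dom_lex_grp)
next
  case (Suc k)
  have eq: "(\<lambda>i. real (Suc k) * x i) = (\<lambda>i. x i + real k * x i)" by (auto simp: algebra_simps)
  show ?case unfolding eq using Suc x es(2) add_in_Dom(1)[OF T x(1)] by blast
qed

lemma lexless_half:
  assumes "pos e" "lexless (\<lambda>i. y i + y i) e"
  shows "lexless y e"
proof (rule ccontr)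
  assume "\<not> lexless y e"
  then have ey: "y = e \<or> lexless e y" using lexless_linear[of y e] by blast
  then have "pos y" using assms(1) lexless_trans by blast
  then have "lexless y (\<lambda>i. y i + y i)" by (simp add: lexless_def)
  then have "lexless e (\<lambda>i. y i + y i)" using ey lexless_trans by blast
  then show False using assms(2) lexless_not_sym by blast
qed

lemma lev_Suc_if_zero:
  assumes "i < length es" "(es ! i) i > 0" "\<And>j. j < i \<Longrightarrow> (es ! i) j = 0" "\<And>j. j \<le> i \<Longrightarrow> x j = 0"
  shows "lev (lex_grp n T) es (Suc i) x"
proof -
  have "lexless (\<lambda>j. - (es ! i) j) (\<lambda>j. x j + x j)" "lexless (\<lambda>j. x j + x j) (es ! i)"
    unfolding lexless_def using assms by (intro exI[of _ i]; simp)+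
  then show ?thesis using assms(1) by (simp add: lev_def)
qed

text \<open>A frame need not consist of unit vectors, yet it always defines the standard convex
  subgroups. Let \<open>m i\<close> be the leading coordinate of \<open>es ! i\<close>. Level
  \<open>i + 1\<close> is closed under addition, so all multiples of its elements stay below
  \<open>es ! i\<close>, and the elements vanish up to \<open>m i\<close>. As
  \<open>es ! (i + 1)\<close> is one of them, \<open>m\<close> increases strictly; all its values
  are below \<open>n\<close>, hence \<open>m i = i\<close>.\<close>

lemma lev_lex_grp:
  assumes T: "T = {0} \<or> T = UNIV" and len: "length es = n" and D: "set es \<subseteq> Dom (lex_grp n T)"
    and fr: "frame (T = UNIV) (lex_grp n T) es"
    and x: "x \<in> Dom (lex_grp n T)" and i: "i \<le> Suc n"
  shows "lev (lex_grp n T) es i x \<longleftrightarrow> (\<forall>j<i. x j = 0)"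
proof -
  let ?G = "lex_grp n T"
  have eD: "es ! i \<in> Dom ?G" if "i < n" for i using D that len by auto
  have pos: "pos (es ! i)" if "i < n" for i using fr that len by (simp add: frame_def)
  have in_lev: "lev ?G es i (es ! i)" if "i < n" for i using fr that len by (simp add: frame_def)
  have closed: "\<forall>x\<in>Dom ?G. \<forall>y\<in>Dom ?G. lev ?G es (Suc i) x \<longrightarrow> lev ?G es (Suc i) y \<longrightarrow>
    lev ?G es (Suc i) (\<lambda>i. x i + y i)" if "i < n" for i
    using fr that len by (simp add: frame_def)
  have "\<exists>m. (es ! i) m > 0 \<and> (\<forall>j<m. (es ! i) j = 0)" if "i < n" for i
    using lex_leading[OF pos[OF that]] by metis
  then obtain m where m: "\<And>i. i < n \<Longrightarrow> (es ! i) (m i) > 0" "\<And>i j. i < n \<Longrightarrow> j < m i \<Longrightarrow> (es ! i) j = 0"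
    by metis
  have zero: "x j = 0" if i: "i < n" and x: "x \<in> Dom ?G" "lev ?G es (Suc i) x" and j: "j \<le> m i" for i x j
  proof (rule infinitesimal_zero[of "es ! i" "m i" x j, OF m(1)[OF i] m(2)[OF i] _ _ j])
    fix k :: nat
    let ?y = "\<lambda>i. real k * x i"
    have "lev ?G es (Suc i) ?y"
      using lev_lex_grp_multiple[OF _ closed[OF i] T pos[OF i] x, of k] i len by simp
    then have y: "lexless (\<lambda>j. - (es ! i) j) (\<lambda>i. ?y i + ?y i)" "lexless (\<lambda>i. ?y i + ?y i) (es ! i)"
      using i len by (simp_all add: lev_def)
    show "lexless ?y (es ! i)" by (rule lexless_half[OF pos[OF i] y(2)])
    have "(\<lambda>i. - ?y i + - ?y i) = (\<lambda>i. - (?y i + ?y i))" by simp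
    then have "lexless (\<lambda>i. - ?y i + - ?y i) (es ! i)"
      using y(1) lexless_minus[of "\<lambda>i. ?y i + ?y i" "es ! i"] by simp
    then have "lexless (\<lambda>i. - ?y i) (es ! i)" by (rule lexless_half[OF pos[OF i]])
    then show "lexless (\<lambda>j. - (es ! i) j) ?y" using lexless_minus[of ?y "es ! i"] by simp
  qed
  have mono: "m i < m (Suc i)" if "Suc i < n" for i
  proof (rule ccontr)
    assume "\<not> m i < m (Suc i)"
    then have "(es ! Suc i) (m (Suc i)) = 0" using that eD[OF that] in_lev[OF that] by (intro zero[of i]) auto
    then show False using m(1)[OF that] by simp
  qed
  have ge: "i \<le> m i" if "i < n" for i
    using that
  proof (induction i)
    case (Suc i)
    then show ?case using mono[of i] by simp
  qed simp
  \<comment> \<open>Coordinate \<open>n\<close> cannot be the leading one: for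
    \<open>T = {0}\<close> it vanishes, and for \<open>T = UNIV\<close> level \<open>n\<close> would
    be zero, which a frame with this flag excludes.\<close>
  have top: "m (n - 1) < n" if n: "n > 0"
  proof (rule ccontr)
    assume "\<not> m (n - 1) < n"
    moreover have "m (n - 1) \<le> n"
      using m(1)[of "n - 1"] eD[of "n - 1"] n by (cases "m (n - 1) \<le> n") (auto simp: Dom_lex_grp)
    ultimately have mn: "m (n - 1) = n" by simp
    show False
    proof (cases "T = {0}")
      case True
      then show ?thesis using m(1)[of "n - 1"] eD[of "n - 1"] n mn by (simp add: Dom_lex_grp)
    next
      case False
      then have "T = UNIV" using T by blast
      then obtain d where d: "d \<in> Dom ?G" "lev ?G es n d" "d \<noteq> (\<lambda>_. 0)"
        using fr len by (auto simp: frame_def)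
      have "d j = 0" if "j \<le> n" for j using zero[of "n - 1" d j] d(1,2) n mn that by simp
      moreover have "d j = 0" if "j > n" for j using d(1) that by (simp add: Dom_lex_grp)
      ultimately have "d = (\<lambda>_. 0)" by (intro ext) (metis linorder_not_le)
      then show False using d(3) by blast
    qed
  qed
  have le: "m i \<le> i" if "i < n" for i
  proof -
    have "i \<le> n - 1" using that by simp
    then show ?thesis
    proof (induction rule: inc_induct)
      case base
      then show ?case using top that by simp
    next
      case (step k)
      then have "Suc k < n" by simp
      from mono[OF this] step show ?case by simp
    qed
  qed
  have mi: "m i = i" if "i < n" for i using le[OF that] ge[OF that] by simp
  show ?thesis
  proof (cases i)
    case 0
    then show ?thesis by (simp add: lev_def)
  next
    case (Suc k)
    show ?thesis
    proof (cases "k < n")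
      case True
      have "lev ?G es (Suc k) x" if "\<forall>j\<le>k. x j = 0"
        using that True len m mi by (intro lev_Suc_if_zero) auto
      moreover have "\<forall>j\<le>k. x j = 0" if "lev ?G es (Suc k) x"
        using zero[OF True x that] mi[OF True] by simp
      ultimately show ?thesis unfolding Suc by (auto simp: less_Suc_eq_le)
    next
      case False
      then have k: "k = n" using i Suc by simp
      have "x = (\<lambda>_. 0)" if "\<forall>j\<le>n. x j = 0"
      proof
        fix j show "x j = 0" using that x by (cases "j \<le> n") (simp_all add: Dom_lex_grp)
      qed
      then show ?thesis unfolding Suc k using len by (auto simp: lev_def less_Suc_eq_le)
    qed
  qed
qed

lemma Ints_Max_exists:
  fixes A :: "real set"
  assumes "A \<subseteq> \<int>" "A \<noteq> {}" "\<And>a. a \<in> A \<Longrightarrow> a \<le> b"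
  shows "\<exists>c\<in>A. \<forall>a\<in>A. a \<le> c"
proof -
  obtain a0 where a0: "a0 \<in> A" using assms(2) by blast
  obtain c where c: "c \<in> A" "\<And>a. a \<in> A \<Longrightarrow> nat (\<lfloor>b\<rfloor> - \<lfloor>c\<rfloor>) \<le> nat (\<lfloor>b\<rfloor> - \<lfloor>a\<rfloor>)"
    using ex_has_least_nat[of "\<lambda>x. x \<in> A" a0 "\<lambda>x. nat (\<lfloor>b\<rfloor> - \<lfloor>x\<rfloor>)"] a0 by blast
  have "a \<le> c" if a: "a \<in> A" for a
  proof -
    obtain k l where kl: "a = of_int k" "c = of_int l" using assms(1) a c(1) by (metis Ints_cases subsetD)
    have "k \<le> \<lfloor>b\<rfloor>" "l \<le> \<lfloor>b\<rfloor>" using assms(3)[OF a] assms(3)[OF c(1)] by (simp_all add: kl le_floor_iff)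
    then show ?thesis using c(2)[OF a] by (simp add: kl)
  qed
  then show ?thesis using c(1) by blast
qed

text \<open>Coordinate \<open>i\<close> maps level \<open>i\<close> to the integers, or to the reals
  if \<open>i = n\<close>, with kernel level \<open>i + 1\<close>; the supremum is taken there.
  \<open>P\<close> is arbitrary: definability enters only when the statement is carried over to
  models, one formula at a time.\<close>

lemma has_cut_sup_lex_grp:
  assumes T: "T = {0} \<or> T = UNIV" and len: "length es = n" and D: "set es \<subseteq> Dom (lex_grp n T)"
    and fr: "frame (T = UNIV) (lex_grp n T) es" and i: "i < n \<or> i = n \<and> T = UNIV"
  shows "has_cut_sup (lex_grp n T) es P i"
  unfolding has_cut_sup_def lex_grp_simps
proof (intro impI)
  let ?D = "Dom (lex_grp n T)"
  assume down: "\<forall>x\<in>?D. \<forall>y\<in>?D. P x \<longrightarrow> lexless y x \<longrightarrow> P y"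
    and "\<exists>x\<in>?D. lev (lex_grp n T) es i x \<and> P x" "\<exists>x\<in>?D. lev (lex_grp n T) es i x \<and> \<not> P x"
  moreover have lev: "lev (lex_grp n T) es k x \<longleftrightarrow> (\<forall>j<k. x j = 0)" if "x \<in> ?D" "k \<le> Suc n" for x k
    using lev_lex_grp[OF T len D fr that] .
  moreover have "i \<le> Suc n" using i by auto
  ultimately obtain x0 x1 where x0: "x0 \<in> ?D" "\<forall>j<i. x0 j = 0" "P x0" and x1: "x1 \<in> ?D" "\<forall>j<i. x1 j = 0" "\<not> P x1"
    by auto
  define A where "A = (\<lambda>x. x i) ` {x \<in> ?D. (\<forall>j<i. x j = 0) \<and> P x}"
  have less: "lexless x y" if "\<forall>j<i. x j = 0" "\<forall>j<i. y j = 0" "x i < y i" for x y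
    unfolding lexless_def using that by (intro exI[of _ i]) simp
  have upper: "a \<le> x1 i" if "a \<in> A" for a
  proof (rule ccontr)
    assume "\<not> a \<le> x1 i"
    then obtain x where "x \<in> ?D" "\<forall>j<i. x j = 0" "P x" "x1 i < x i" using \<open>a \<in> A\<close> by (auto simp: A_def)
    then show False using less[of x1 x] down x1 by blast
  qed
  have ne: "A \<noteq> {}" using x0 by (auto simp: A_def)
  have "\<exists>c. (\<forall>a\<in>A. a \<le> c) \<and> (\<forall>t<c. \<exists>a\<in>A. t < a) \<and> (i < n \<longrightarrow> c \<in> \<int>)"
  proof (cases "i < n")
    case True
    then have "A \<subseteq> \<int>" by (auto simp: A_def Dom_lex_grp)
    then show ?thesis using Ints_Max_exists[OF _ ne upper] by (metis subsetD)
  next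
    case False
    have bdd: "bdd_above A" using upper by (rule bdd_aboveI)
    have "\<forall>a\<in>A. a \<le> Sup A" using bdd by (auto intro: cSup_upper)
    moreover have "\<forall>t<Sup A. \<exists>a\<in>A. t < a" using less_cSup_iff[OF ne bdd] by blast
    ultimately show ?thesis using False by blast
  qed
  then obtain c where c: "\<And>a. a \<in> A \<Longrightarrow> a \<le> c" "\<And>t. t < c \<Longrightarrow> \<exists>a\<in>A. t < a" "i < n \<Longrightarrow> c \<in> \<int>" by blast
  define z where "z = (\<lambda>j. if j = i then c else 0)"
  have zD: "z \<in> ?D" using c(3) T i by (auto simp: Dom_lex_grp z_def)
  have z: "\<forall>j<i. z j = 0" "z i = c" by (simp_all add: z_def)
  have "(lexless x z \<longrightarrow> P x \<or> lev (lex_grp n T) es (Suc i) (\<lambda>j. x j + - z j)) \<and>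
    (lexless z x \<longrightarrow> \<not> P x \<or> lev (lex_grp n T) es (Suc i) (\<lambda>j. x j + - z j))"
    if x: "x \<in> ?D" "\<forall>j<i. x j = 0" for x
  proof (cases "x i = c")
    case True
    have "(\<lambda>j. x j + - z j) \<in> ?D" using add_in_Dom(2)[OF T x(1) zD] by simp
    then have "lev (lex_grp n T) es (Suc i) (\<lambda>j. x j + - z j)"
      using True x z i by (subst lev) (auto simp: less_Suc_eq)
    then show ?thesis by blast
  next
    case False
    have "P x" if lt: "x i < c"
    proof -
      obtain y where "y \<in> ?D" "\<forall>j<i. y j = 0" "P y" "x i < y i" using c(2)[OF lt] by (auto simp: A_def)
      then show ?thesis using less[of x y] down x by blast
    qed
    moreover have "x i \<le> c" if "P x" using c(1)[of "x i"] that x by (auto simp: A_def)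
    moreover have "\<not> lexless x z" if "c < x i" using less[of z x] z x that lexless_not_sym by blast
    moreover have "\<not> lexless z x" if "x i < c" using less[of x z] z x that lexless_not_sym by blast
    ultimately show ?thesis using False by (metis linorder_neqE not_less)
  qed
  then show "\<exists>c\<in>?D. lev (lex_grp n T) es i c \<and> (\<forall>x\<in>?D. lev (lex_grp n T) es i x \<longrightarrow>
    (lexless x c \<longrightarrow> P x \<or> lev (lex_grp n T) es (Suc i) (\<lambda>j. x j + - c j)) \<and>
    (lexless c x \<longrightarrow> \<not> P x \<or> lev (lex_grp n T) es (Suc i) (\<lambda>j. x j + - c j)))"
    using zD z(1) lev \<open>i \<le> Suc n\<close> by (intro bexI[of _ z]) simp_all
qed

text \<open>The unit vectors form a frame. A nonzero leading integer coordinate exceeds 1 in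
  absolute value after doubling. The doubling in \<open>lev\<close> is what keeps elements with
  coordinate \<open>i\<close> equal to 1 and a negative tail out of level
  \<open>i + 1\<close>.\<close>

lemma frame_exists_lex_grp:
  assumes T: "T = {0} \<or> T = UNIV"
  shows "\<exists>es\<in>tuples (lex_grp n T) n. frame (T = UNIV) (lex_grp n T) es"
proof -
  let ?G = "lex_grp n T"
  define unit where "unit i = (\<lambda>j. if j = i then 1 else 0 :: real)" for i :: nat
  define es where "es = map unit [0..<n]"
  have len: "length es = n" by (simp add: es_def)
  have e: "es ! i = unit i" if "i < n" for i using that by (simp add: es_def)
  have D: "unit i \<in> Dom ?G" if "i < n" for i
    using that T by (auto simp: Dom_lex_grp unit_def)
  have es: "es \<in> tuples ?G n" using D by (auto simp: tuples_def es_def)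
  have lev: "lev ?G es (Suc i) x \<longleftrightarrow> (\<forall>j\<le>i. x j = 0)" if i: "i < n" and x: "x \<in> Dom ?G" for i x
  proof
    assume l: "lev ?G es (Suc i) x"
    then have 1: "lexless (\<lambda>j. - unit i j) (\<lambda>j. x j + x j)" "lexless (\<lambda>j. x j + x j) (unit i)"
      using i len e[OF i] by (simp_all add: lev_def)
    show "\<forall>j\<le>i. x j = 0"
    proof (rule ccontr)
      assume "\<not> (\<forall>j\<le>i. x j = 0)"
      then obtain k where k: "k \<le> i" "x k \<noteq> 0" by blast
      define p where "p = (LEAST j. x j \<noteq> 0)"
      have p: "x p \<noteq> 0" "p \<le> k" unfolding p_def using k(2) by (rule LeastI, rule Least_le)
      have p0: "x j = 0" if "j < p" for j using not_less_Least[of j "\<lambda>j. x j \<noteq> 0"] that by (auto simp: p_def)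
      have pi: "p \<le> i" "p < n" using p k i by auto
      then have "x p \<in> \<int>" using x by (simp add: Dom_lex_grp)
      then obtain a where a: "x p = of_int a" by (elim Ints_cases)
      then have "a \<ge> 1 \<or> a \<le> -1" using p(1) by simp linarith
      then have "(of_int a :: real) \<ge> 1 \<or> (of_int a :: real) \<le> -1" by linarith
      then show False
      proof
        assume "(of_int a :: real) \<ge> 1"
        then have "lexless (unit i) (\<lambda>j. x j + x j)"
          unfolding lexless_def using p0 a pi by (intro exI[of _ p]) (auto simp: unit_def)
        then show False using 1(2) lexless_not_sym by blast
      next
        assume "(of_int a :: real) \<le> -1"
        then have "lexless (\<lambda>j. x j + x j) (\<lambda>j. - unit i j)"
          unfolding lexless_def using p0 a pi by (intro exI[of _ p]) (auto simp: unit_def)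
        then show False using 1(1) lexless_not_sym by blast
      qed
    qed
  next
    assume "\<forall>j\<le>i. x j = 0"
    then show "lev ?G es (Suc i) x" using i len e[OF i] by (intro lev_Suc_if_zero) (auto simp: unit_def)
  qed
  have lev': "lev ?G es i x \<longleftrightarrow> (\<forall>j<i. x j = 0)" if "i \<le> n" "x \<in> Dom ?G" for i x
    using that lev[of "i - 1" x] by (cases i) (auto simp: lev_def less_Suc_eq_le)
  have min: "lev ?G es (Suc i) x \<or> lev ?G es (Suc i) (\<lambda>j. unit i j + - x j)"
    if i: "i < n" and x: "x \<in> Dom ?G" "pos x" "lexless x (unit i)" for i x
  proof -
    obtain p where p: "x p > 0" "\<And>j. j < p \<Longrightarrow> x j = 0" using lex_leading[OF x(2)] by blast
    have x0: "x j = 0" if "j < i" for j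
    proof (cases "p < i")
      case True
      then have "lexless (unit i) x" unfolding lexless_def using p by (intro exI[of _ p]) (auto simp: unit_def)
      then show ?thesis using x(3) lexless_not_sym by blast
    next
      case False
      then show ?thesis using p(2) that by simp
    qed
    have "\<not> x i < 0"
    proof
      assume "x i < 0"
      then have "lexless x (\<lambda>_. 0)" unfolding lexless_def using x0 by (intro exI[of _ i]) simp
      then show False using x(2) lexless_not_sym by blast
    qed
    moreover have "\<not> 1 < x i"
    proof
      assume "1 < x i"
      then have "lexless (unit i) x" unfolding lexless_def using x0 by (intro exI[of _ i]) (simp add: unit_def)
      then show False using x(3) lexless_not_sym by blast
    qed
    moreover have "x i \<in> \<int>" using x(1) i by (simp add: Dom_lex_grp)
    ultimately have xi: "x i = 0 \<or> x i = 1" by (auto elim!: Ints_cases)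
    have d: "(\<lambda>j. unit i j + - x j) \<in> Dom ?G" using add_in_Dom(2)[OF T D[OF i] x(1)] by simp
    show ?thesis unfolding lev[OF i x(1)] lev[OF i d] using xi x0 by (auto simp: unit_def le_less)
  qed
  have "frame (T = UNIV) ?G es"
    unfolding frame_def len lex_grp_simps
  proof (intro conjI allI impI ballI)
    fix i assume i: "i < n"
    show "pos (es ! i)" unfolding e[OF i] lexless_def by (intro exI[of _ i]) (simp add: unit_def)
    show "lev ?G es i (es ! i)" unfolding e[OF i] using lev'[of i "unit i"] D[OF i] i by (simp add: unit_def)
    show "lev ?G es (Suc i) x \<or> lev ?G es (Suc i) (\<lambda>j. (es ! i) j + - x j)"
      if "x \<in> Dom ?G" "pos x" "lexless x (es ! i)" for x
      using min[OF i that(1,2)] that(3) unfolding e[OF i] by blast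
    fix x y assume "x \<in> Dom ?G" "y \<in> Dom ?G" "lev ?G es (Suc i) x" "lev ?G es (Suc i) y"
    then show "lev ?G es (Suc i) (\<lambda>j. x j + y j)"
      using lev[OF i] add_in_Dom(1)[OF T, of x n y] by simp
  next
    show "if T = UNIV then (\<exists>x\<in>Dom ?G. lev ?G es n x \<and> x \<noteq> (\<lambda>_. 0)) \<and>
      (\<forall>x\<in>Dom ?G. lev ?G es n x \<longrightarrow> (\<exists>y\<in>Dom ?G. lev ?G es n y \<and> (\<lambda>i. y i + y i) = x))
      else \<forall>x\<in>Dom ?G. lev ?G es n x \<longrightarrow> x = (\<lambda>_. 0)"
    proof (cases "T = UNIV")
      case True
      have u: "unit n \<in> Dom ?G" "unit n \<noteq> (\<lambda>_. 0)"
        by (auto simp: Dom_lex_grp unit_def True fun_eq_iff)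
      then have "lev ?G es n (unit n)" using lev'[of n "unit n"] by (simp add: unit_def)
      moreover have "\<exists>y\<in>Dom ?G. lev ?G es n y \<and> (\<lambda>i. y i + y i) = x"
        if x: "x \<in> Dom ?G" "lev ?G es n x" for x
      proof -
        have x0: "\<forall>j<n. x j = 0" using lev'[OF _ x(1), of n] x(2) by simp
        then have "(\<lambda>j. x j / 2) \<in> Dom ?G" using x(1) by (simp add: Dom_lex_grp True)
        then show ?thesis using lev'[of n "\<lambda>j. x j / 2"] x0 by (intro bexI[of _ "\<lambda>j. x j / 2"]) auto
      qed
      ultimately show ?thesis using True u by auto
    next
      case False
      then have T0: "T = {0}" using T by blast
      have "x = (\<lambda>_. 0)" if x: "x \<in> Dom ?G" "lev ?G es n x" for x
      proof
        fix j
        have "\<forall>j<n. x j = 0" using lev'[OF _ x(1), of n] x(2) by simp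
        then show "x j = 0" using x(1) T0 by (cases j n rule: linorder_cases) (simp_all add: Dom_lex_grp)
      qed
      then show ?thesis using False by auto
    qed
  qed
  then show ?thesis using es by blast
qed

section \<open>Transfer to the models of the theory\<close>

lemma model_frame:
  assumes T: "T = {0} \<or> T = UNIV" and M: "is_model M (Th (lex_grp n T))"
  shows "\<exists>es\<in>tuples M n. frame (T = UNIV) M es"
proof -
  have sat: "sat N es (frame_fm r n) \<longleftrightarrow> frame r N es" if "es \<in> tuples N n" for r es and N :: "'c lstruct"
    using sat_frame_fm[of N es "[]" r] that by (simp add: tuples_def)
  have sat': "sat M es (frame_fm r n) \<longleftrightarrow> frame r M es" if "es \<in> tuples M n" for r es
    using sat_frame_fm[of M es "[]" r] that by (simp add: tuples_def)
  have "fm_in n (frame_fm (T = UNIV) n)" by (rule fm_in_frame_fm) simp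
  from model_Th_ex[OF M this] frame_exists_lex_grp[OF T, of n] show ?thesis
    using sat sat' by metis
qed

text \<open>For fixed \<open>p\<close> this is one universal sentence of the theory, quantified over
  all frames and all parameters of \<open>p\<close>.\<close>

lemma model_has_cut_sup:
  assumes T: "T = {0} \<or> T = UNIV" and M: "is_model M (Th (lex_grp n T))"
    and es: "es \<in> tuples M n" "frame (T = UNIV) M es" and i: "i < n \<or> i = n \<and> T = UNIV"
    and p: "fm_in (Suc l) p" "b \<in> tuples M l"
  shows "has_cut_sup M es (\<lambda>x. sat M (x # b) p) i"
proof -
  let ?f = "FImp (frame_fm (T = UNIV) n) (cut_sup_fm n p i)"
  have "sat M (es @ b) ?f"
  proof (rule model_Th_all[OF M])
    show "fm_in (n + l) ?f" using p(1) by (simp add: fm_in_frame_fm fm_in_cut_sup_fm)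
    show "es @ b \<in> tuples M (n + l)" using es(1) p(2) by (rule tuples_append)
    fix e assume "e \<in> tuples (lex_grp n T) (n + l)"
    then obtain es b where e: "e = es @ b" "length es = n" "length b = l" "set es \<subseteq> Dom (lex_grp n T)"
      unfolding tuples_def
      by (metis (mono_tags, lifting) append_take_drop_id le_add1 length_append length_take mem_Collect_eq
          min.absorb2 add_left_cancel set_take_subset subset_trans)
    show "sat (lex_grp n T) e ?f"
      using sat_frame_fm[of "lex_grp n T" es b "T = UNIV"] sat_cut_sup_fm[of b p "lex_grp n T" es i]
        has_cut_sup_lex_grp[OF T e(2,4) _ i] e p(1) by auto
  qed
  moreover have "length es = n" "length b = l" using es p by (simp_all add: tuples_def)
  ultimately show ?thesis
    using sat_frame_fm[of M es b "T = UNIV"] sat_cut_sup_fm[of b p M es i] es(2) p(1) by auto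
qed


section \<open>Ordered abelian groups\<close>

text \<open>Written multiplicatively, as in \<open>HOL-Algebra\<close>.\<close>

locale ordered_comm_group = comm_group G for G :: "('a, 'b) monoid_scheme" (structure) +
  fixes lt :: "'a \<Rightarrow> 'a \<Rightarrow> bool" (infix "\<prec>" 50)
  assumes lt_irrefl: "x \<in> carrier G \<Longrightarrow> \<not> x \<prec> x"
    and lt_trans: "x \<in> carrier G \<Longrightarrow> y \<in> carrier G \<Longrightarrow> z \<in> carrier G \<Longrightarrow> x \<prec> y \<Longrightarrow> y \<prec> z \<Longrightarrow> x \<prec> z"
    and lt_linear: "x \<in> carrier G \<Longrightarrow> y \<in> carrier G \<Longrightarrow> x \<prec> y \<or> x = y \<or> y \<prec> x"
    and lt_mono: "x \<in> carrier G \<Longrightarrow> y \<in> carrier G \<Longrightarrow> z \<in> carrier G \<Longrightarrow> x \<prec> y \<Longrightarrow> x \<otimes> z \<prec> y \<otimes> z"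
begin

lemma lt_not_sym: "x \<in> carrier G \<Longrightarrow> y \<in> carrier G \<Longrightarrow> x \<prec> y \<Longrightarrow> \<not> y \<prec> x"
  using lt_trans lt_irrefl by blast

lemma le_lt_trans:
  "x \<in> carrier G \<Longrightarrow> y \<in> carrier G \<Longrightarrow> z \<in> carrier G \<Longrightarrow> \<not> y \<prec> x \<Longrightarrow> y \<prec> z \<Longrightarrow> x \<prec> z"
  using lt_trans lt_linear by metis

lemma lt_le_trans:
  "x \<in> carrier G \<Longrightarrow> y \<in> carrier G \<Longrightarrow> z \<in> carrier G \<Longrightarrow> x \<prec> y \<Longrightarrow> \<not> z \<prec> y \<Longrightarrow> x \<prec> z"
  using lt_trans lt_linear by metis

lemma lt_mult_iff:
  assumes "x \<in> carrier G" "y \<in> carrier G" "z \<in> carrier G"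
  shows "x \<otimes> z \<prec> y \<otimes> z \<longleftrightarrow> x \<prec> y"
proof
  assume "x \<otimes> z \<prec> y \<otimes> z"
  then have "x \<otimes> z \<otimes> inv z \<prec> y \<otimes> z \<otimes> inv z"
    by (rule lt_mono[rotated 3]) (use assms in auto)
  then show "x \<prec> y" using assms by (simp add: m_assoc)
qed (use assms lt_mono in auto)

lemma lt_iff_pos:
  assumes "x \<in> carrier G" "y \<in> carrier G"
  shows "x \<prec> y \<longleftrightarrow> \<one> \<prec> y \<otimes> inv x"
  using lt_mult_iff[of x y "inv x"] assms by simp

lemma mult_less:
  assumes "x \<in> carrier G" "y \<in> carrier G" "x' \<in> carrier G" "y' \<in> carrier G" "x \<prec> y" "x' \<prec> y'"
  shows "x \<otimes> x' \<prec> y \<otimes> y'"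
proof -
  have "x \<otimes> x' \<prec> y \<otimes> x'" using assms by (intro lt_mono)
  moreover have "x' \<otimes> y \<prec> y' \<otimes> y" using assms by (intro lt_mono)
  then have "y \<otimes> x' \<prec> y \<otimes> y'" using assms by (simp add: m_comm)
  ultimately show ?thesis using assms by (intro lt_trans[of "x \<otimes> x'" "y \<otimes> x'" "y \<otimes> y'"]) auto
qed

lemma inv_less_iff:
  assumes "x \<in> carrier G" "y \<in> carrier G"
  shows "inv x \<prec> inv y \<longleftrightarrow> y \<prec> x"
  using lt_iff_pos[of "inv x" "inv y"] lt_iff_pos[of y x] assms by (simp add: m_comm)

lemma pow_less:
  assumes "x \<in> carrier G" "y \<in> carrier G" "x \<prec> y"
  shows "x [^] Suc k \<prec> y [^] Suc k"
proof (induction k)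
  case (Suc k)
  have "x [^] Suc k \<otimes> x \<prec> y [^] Suc k \<otimes> y" using Suc assms by (intro mult_less) auto
  then show ?case by simp
qed (use assms in simp)

lemma int_pow_less:
  assumes "x \<in> carrier G" "\<one> \<prec> x"
  shows "x [^] a \<prec> x [^] b \<longleftrightarrow> a < (b::int)"
proof -
  have less: "x [^] a \<prec> x [^] b" if ab: "a < b" for a b :: int
  proof -
    obtain k where "b = a + int (Suc k)" using ab zless_iff_Suc_zadd[of a b] by blast
    then have k: "b - a = int (Suc k)" by simp
    have "\<one> [^] Suc k \<prec> x [^] Suc k" using assms by (intro pow_less) auto
    then have "\<one> \<prec> x [^] Suc k" by simp
    then have "\<one> \<prec> x [^] (b - a)" unfolding k int_pow_int .
    then have "\<one> \<prec> x [^] b \<otimes> inv (x [^] a)" using assms by (simp add: int_pow_diff)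
    then show ?thesis using assms lt_iff_pos[of "x [^] a" "x [^] b"] by simp
  qed
  then show ?thesis
    using assms lt_irrefl[of "x [^] a"] lt_not_sym[of "x [^] a" "x [^] b"]
    by (cases a b rule: linorder_cases) auto
qed

lemma int_pow_less_base:
  assumes "x \<in> carrier G" "y \<in> carrier G" "x \<prec> y" "k > (0::int)"
  shows "x [^] k \<prec> y [^] k"
proof -
  obtain l where "k = int (Suc l)" using assms(4) by (metis zero_less_imp_eq_int gr0_implies_Suc)
  then show ?thesis using pow_less[OF assms(1-3), of l] by (simp only: int_pow_int)
qed

lemma half_less:
  assumes "x \<in> carrier G" "e \<in> carrier G" "\<one> \<prec> e" "x \<otimes> x \<prec> e"
  shows "x \<prec> e"
proof (rule ccontr)
  assume "\<not> x \<prec> e"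
  then have ex: "\<not> x \<prec> e" .
  then have "\<one> \<prec> x" using assms lt_le_trans[of \<one> e x] by simp
  then have "\<one> \<otimes> x \<prec> x \<otimes> x" using assms by (intro lt_mono) auto
  then have "x \<prec> x \<otimes> x" using assms by simp
  then have "x \<prec> e" using assms lt_trans[of x "x \<otimes> x" e] by simp
  then show False using ex by simp
qed

lemma floor_exists:
  assumes "u \<in> carrier G" "x \<in> carrier G" "\<one> \<prec> u" "x \<prec> u [^] (a::nat)" "inv x \<prec> u [^] (b::nat)"
  shows "\<exists>k::int. \<not> x \<prec> u [^] k \<and> x \<prec> u [^] (k + 1)"
proof -
  \<comment> \<open>Shifting exponents by \<open>b\<close> turns the least power above
    \<open>x\<close> into a least natural number. It is not 0, because \<open>x\<close> lies above
    the inverse of \<open>u [^] b\<close>.\<close>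
  define Q where "Q j \<longleftrightarrow> x \<prec> u [^] (int j - int b)" for j
  have "Q (a + b)" using assms(4) by (simp add: Q_def int_pow_int)
  define j where "j = (LEAST j. Q j)"
  have j: "Q j" unfolding j_def using \<open>Q (a + b)\<close> by (rule LeastI)
  have "inv (u [^] b) \<prec> x" using inv_less_iff[of "u [^] b" "inv x"] assms by simp
  then have "\<not> x \<prec> inv (u [^] b)" using assms lt_not_sym by simp
  then have "\<not> Q 0" using assms by (simp add: Q_def int_pow_neg int_pow_int)
  then obtain l where l: "j = Suc l" using j by (cases j) auto
  have "\<not> Q l" using l not_less_Least[of l Q] unfolding j_def by simp
  then show ?thesis using j unfolding l Q_def by (intro exI[of _ "int l - int b"]) (simp add: algebra_simps)
qed

lemma floor_unique:
  assumes "u \<in> carrier G" "x \<in> carrier G" "\<one> \<prec> u" "\<not> x \<prec> u [^] (k::int)" "x \<prec> u [^] (l::int)"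
  shows "k < l"
  using le_lt_trans[of "u [^] k" x "u [^] l"] int_pow_less[of u k l] assms by simp

text \<open>On a linear order, strict monotonicity in one direction already makes the bijection an
  isomorphism. Stated for subsets of one group, it lets the induction run along the levels.\<close>

definition represented :: "'a set \<Rightarrow> nat \<Rightarrow> real set \<Rightarrow> bool" where
  "represented S n T \<longleftrightarrow> (\<exists>f. bij_betw f S (Dom (lex_grp n T)) \<and>
     (\<forall>x\<in>S. \<forall>y\<in>S. f (x \<otimes> y) = (\<lambda>i. f x i + f y i)) \<and>
     (\<forall>x\<in>S. \<forall>y\<in>S. x \<prec> y \<longrightarrow> lexless (f x) (f y)))"

text \<open>Modulo \<open>K\<close>, the element \<open>e\<close> is minimal positive and its powers
  are cofinal, so the quotient is infinite cyclic, generated by \<open>e\<close>. The powers of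
  \<open>e\<close> split the quotient map, and the exponent becomes the new dominant
  coordinate.\<close>

lemma represented_Suc:
  assumes S: "subgroup S G" and K: "subgroup K G" "K \<subseteq> S" and e: "e \<in> S" "\<one> \<prec> e"
    and Ke: "\<And>x. x \<in> K \<Longrightarrow> x \<prec> e"
    and minimal: "\<And>x. x \<in> S \<Longrightarrow> \<one> \<prec> x \<Longrightarrow> x \<prec> e \<Longrightarrow> x \<in> K \<or> e \<otimes> inv x \<in> K"
    and arch: "\<And>x. x \<in> S \<Longrightarrow> \<exists>k::nat. x \<prec> e [^] k"
    and rep: "represented K n T"
  shows "represented S (Suc n) T"
proof -
  have SG: "x \<in> S \<Longrightarrow> x \<in> carrier G" for x using subgroup.mem_carrier[OF S] .
  have KG: "x \<in> K \<Longrightarrow> x \<in> carrier G" for x using subgroup.mem_carrier[OF K(1)] .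
  have eG: "e \<in> carrier G" using SG e by blast
  have eS: "e [^] k \<in> S" for k :: int using subgroup_int_pow_closed[OF S e(1)] .
  have "\<exists>k::int. x \<otimes> e [^] (- k) \<in> K" if x: "x \<in> S" for x
  proof -
    obtain a b :: nat where "x \<prec> e [^] a" "inv x \<prec> e [^] b"
      using arch x subgroup.m_inv_closed[OF S x] by blast
    then obtain k :: int where k: "\<not> x \<prec> e [^] k" "x \<prec> e [^] (k + 1)"
      using floor_exists[of e x a b] x SG eG e(2) by blast
    define d where "d = x \<otimes> e [^] (- k)"
    have dS: "d \<in> S" unfolding d_def by (rule subgroup.m_closed[OF S x eS])
    have xd: "x = d \<otimes> e [^] k" using x SG eG by (simp add: d_def m_assoc int_pow_neg)
    have "\<not> d \<otimes> e [^] k \<prec> \<one> \<otimes> e [^] k" using k(1) eG xd by simp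
    then have d1: "\<not> d \<prec> \<one>" using SG[OF dS] eG by (subst (asm) lt_mult_iff) auto
    have "d \<otimes> e [^] k \<prec> e \<otimes> e [^] k" using k(2) eG xd by (simp add: int_pow_mult m_comm)
    then have d2: "d \<prec> e" using SG[OF dS] eG by (subst (asm) lt_mult_iff) auto
    show ?thesis
    proof (cases "d = \<one>")
      case True
      then show ?thesis using subgroup.one_closed[OF K(1)] unfolding d_def by metis
    next
      case False
      then have "\<one> \<prec> d" using d1 lt_linear[of d \<one>] SG[OF dS] by auto
      then have "d \<in> K \<or> e \<otimes> inv d \<in> K" by (rule minimal[OF dS _ d2])
      then show ?thesis
      proof
        assume "d \<in> K" then show ?thesis unfolding d_def by blast
      next
        \<comment> \<open>Here \<open>d\<close> equals \<open>e\<close> modulo \<open>K\<close>, so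
          the right exponent is \<open>k + 1\<close>.\<close>
        assume "e \<otimes> inv d \<in> K"
        then have "inv (e \<otimes> inv d) \<in> K" by (rule subgroup.m_inv_closed[OF K(1)])
        moreover have "inv (e \<otimes> inv d) = d \<otimes> inv e"
          using SG[OF dS] eG by (simp add: inv_mult m_comm)
        moreover have "e [^] (- (k + 1)) = e [^] (- k) \<otimes> inv e"
          using int_pow_mult[OF eG, of "- k" "- 1"] int_pow_neg[OF eG, of 1] eG by simp
        then have "d \<otimes> inv e = x \<otimes> e [^] (- (k + 1))"
          unfolding d_def using SG[OF x] eG by (simp add: m_assoc)
        ultimately show ?thesis by metis
      qed
    qed
  qed
  then obtain kk :: "'a \<Rightarrow> int" where kk: "\<And>x. x \<in> S \<Longrightarrow> x \<otimes> e [^] (- kk x) \<in> K" by metis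
  \<comment> \<open>Otherwise a positive power of \<open>e\<close> would lie in \<open>K\<close>,
    hence below \<open>e\<close>.\<close>
  have e_notin: "\<not> k < l" if "x \<in> S" "x \<otimes> e [^] (- k) \<in> K" "x \<otimes> e [^] (- l) \<in> K" for x and k l :: int
  proof
    assume "k < l"
    have "(x \<otimes> e [^] (- k)) \<otimes> inv (x \<otimes> e [^] (- l)) \<in> K"
      by (rule subgroup.m_closed[OF K(1) that(2) subgroup.m_inv_closed[OF K(1) that(3)]])
    moreover have "(x \<otimes> e [^] (- k)) \<otimes> inv (x \<otimes> e [^] (- l)) = e [^] (l - k)"
    proof -
      have "(x \<otimes> e [^] (- k)) \<otimes> inv (x \<otimes> e [^] (- l)) = (x \<otimes> inv x) \<otimes> (e [^] (- k) \<otimes> inv (e [^] (- l)))"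
        using SG[OF that(1)] eG by (simp only: inv_mult m_ac m_closed inv_closed int_pow_closed)
      also have "\<dots> = e [^] (- k) \<otimes> e [^] l" using SG[OF that(1)] eG by (simp add: int_pow_neg)
      also have "\<dots> = e [^] (- k + l)" using int_pow_mult[OF eG, of "- k" l] by simp
      finally show ?thesis by simp
    qed
    ultimately have "e [^] (l - k) \<prec> e [^] (1::int)" using Ke eG by simp
    then show False using int_pow_less[OF eG e(2)] \<open>k < l\<close> by simp
  qed
  then have kk_unique: "kk x = k" if "x \<in> S" "x \<otimes> e [^] (- k) \<in> K" for x k
    using kk[OF that(1)] that by (metis linorder_neqE)
  define rr where "rr x = x \<otimes> e [^] (- kk x)" for x
  have rrK: "rr x \<in> K" if "x \<in> S" for x using kk[OF that] by (simp add: rr_def)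
  have dec: "x = rr x \<otimes> e [^] kk x" if "x \<in> S" for x
    using SG[OF that] eG by (simp add: rr_def m_assoc int_pow_neg)
  have kk_rr: "r \<otimes> e [^] k \<in> S \<and> kk (r \<otimes> e [^] k) = k \<and> rr (r \<otimes> e [^] k) = r" if r: "r \<in> K" for r and k :: int
  proof -
    have rS: "r \<otimes> e [^] k \<in> S" using K(2) r eS by (intro subgroup.m_closed[OF S]) auto
    have eq: "(r \<otimes> e [^] k) \<otimes> e [^] (- k) = r" using KG[OF r] eG by (simp add: m_assoc int_pow_neg)
    then have "kk (r \<otimes> e [^] k) = k" using rS r by (intro kk_unique) simp_all
    then show ?thesis using rS eq by (simp add: rr_def)
  qed
  have mult: "kk (x \<otimes> y) = kk x + kk y \<and> rr (x \<otimes> y) = rr x \<otimes> rr y" if "x \<in> S" "y \<in> S" for x y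
  proof -
    have "x \<otimes> y = (rr x \<otimes> e [^] kk x) \<otimes> (rr y \<otimes> e [^] kk y)" using dec that by metis
    also have "\<dots> = (rr x \<otimes> rr y) \<otimes> e [^] (kk x + kk y)"
      using KG rrK that eG by (simp add: int_pow_mult m_ac)
    finally show ?thesis
      using kk_rr[OF subgroup.m_closed[OF K(1) rrK[OF that(1)] rrK[OF that(2)]]] by simp
  qed
  obtain f where f: "bij_betw f K (Dom (lex_grp n T))"
    "\<And>x y. x \<in> K \<Longrightarrow> y \<in> K \<Longrightarrow> f (x \<otimes> y) = (\<lambda>i. f x i + f y i)"
    "\<And>x y. x \<in> K \<Longrightarrow> y \<in> K \<Longrightarrow> x \<prec> y \<Longrightarrow> lexless (f x) (f y)"
    using rep unfolding represented_def by metis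
  define g where "g x = case_nat (of_int (kk x)) (f (rr x))" for x
  have g0: "g x 0 = of_int (kk x)" and gS: "g x (Suc i) = f (rr x) i" for x i by (simp_all add: g_def)
  have "bij_betw g S (Dom (lex_grp (Suc n) T))"
    unfolding bij_betw_def
  proof (intro conjI equalityI subsetI)
    show "inj_on g S"
    proof (rule inj_onI)
      fix x y assume xy: "x \<in> S" "y \<in> S" "g x = g y"
      have "kk x = kk y" using xy(3) g0[of x] g0[of y] by simp
      moreover have "f (rr x) = f (rr y)" using xy(3) gS[of x] gS[of y] by (intro ext) metis
      then have "rr x = rr y" using f(1) rrK xy by (auto simp: bij_betw_def inj_on_def)
      ultimately show "x = y" using dec xy by metis
    qed
    fix h
    {
      assume "h \<in> g ` S"
      then obtain x where x: "x \<in> S" "h = g x" by blast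
      have "f (rr x) \<in> Dom (lex_grp n T)" using f(1) rrK[OF x(1)] by (auto simp: bij_betw_def)
      then show "h \<in> Dom (lex_grp (Suc n) T)" unfolding x(2)
        by (auto simp: Dom_lex_grp g_def split: nat.split)
    next
      assume h: "h \<in> Dom (lex_grp (Suc n) T)"
      then have "h 0 \<in> \<int>" by (simp add: Dom_lex_grp)
      then obtain k where k: "h 0 = of_int k" by (elim Ints_cases)
      have "(\<lambda>i. h (Suc i)) \<in> Dom (lex_grp n T)" using h by (simp add: Dom_lex_grp)
      then have "(\<lambda>i. h (Suc i)) \<in> f ` K" using f(1) by (simp add: bij_betw_def)
      then obtain r where r: "r \<in> K" "f r = (\<lambda>i. h (Suc i))" by (metis imageE)
      have "g (r \<otimes> e [^] k) = h"
        using kk_rr[OF r(1), of k] r(2) k by (intro ext) (simp add: g_def split: nat.split)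
      then show "h \<in> g ` S" using kk_rr[OF r(1), of k] by blast
    }
  qed
  moreover have "g (x \<otimes> y) = (\<lambda>i. g x i + g y i)" if "x \<in> S" "y \<in> S" for x y
    using mult[OF that] f(2)[OF rrK rrK, OF that] by (intro ext) (simp add: g_def split: nat.split)
  moreover have "lexless (g x) (g y)" if "x \<in> S" "y \<in> S" "x \<prec> y" for x y
  proof -
    have C: "rr x \<in> carrier G" "rr y \<in> carrier G" using KG rrK that by auto
    consider "kk x < kk y" | "kk x = kk y" | "kk y < kk x" by linarith
    then show ?thesis
    proof cases
      case 1
      then show ?thesis by (subst lexless_Suc) (simp add: g_def)
    next
      case 2
      have "rr x \<otimes> e [^] kk x \<prec> rr y \<otimes> e [^] kk x" using that dec 2 by metis
      then have "rr x \<prec> rr y" using C eG by (subst (asm) lt_mult_iff) auto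
      then show ?thesis using 2 f(3) rrK that by (subst lexless_Suc) (simp add: g_def)
    next
      case 3
      \<comment> \<open>The remainders differ by \<open>q\<close>, which lies below \<open>e\<close>
        and cannot make up for the larger power of \<open>e\<close> in \<open>x\<close>. So
        \<open>y\<close> would be below \<open>x\<close>.\<close>
      define q where "q = rr y \<otimes> inv (rr x)"
      have q: "q \<in> K" unfolding q_def using rrK that
        by (intro subgroup.m_closed[OF K(1)] subgroup.m_inv_closed[OF K(1)])
      have qG: "q \<in> carrier G" by (rule KG[OF q])
      have "q \<otimes> e [^] kk y \<prec> e \<otimes> e [^] kk y" using Ke[OF q] qG eG by (intro lt_mono) auto
      then have "q \<otimes> e [^] kk y \<prec> e [^] (kk y + 1)" using eG by (simp add: int_pow_mult m_comm)
      moreover have "\<not> e [^] kk x \<prec> e [^] (kk y + 1)" using int_pow_less[OF eG e(2)] 3 by simp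
      ultimately have "q \<otimes> e [^] kk y \<prec> e [^] kk x"
        using qG eG lt_le_trans[of "q \<otimes> e [^] kk y" "e [^] (kk y + 1)" "e [^] kk x"] by simp
      then have "q \<otimes> e [^] kk y \<otimes> rr x \<prec> e [^] kk x \<otimes> rr x" using qG eG C by (intro lt_mono) auto
      moreover have "q \<otimes> e [^] kk y \<otimes> rr x = (inv (rr x) \<otimes> rr x) \<otimes> (rr y \<otimes> e [^] kk y)"
        unfolding q_def using C eG by (simp only: m_ac m_closed inv_closed int_pow_closed)
      then have "q \<otimes> e [^] kk y \<otimes> rr x = y"
        using C dec[OF that(2)] SG[OF that(2)] by (metis l_inv l_one)
      moreover have "e [^] kk x \<otimes> rr x = x" using C eG dec[OF that(1)] by (simp add: m_comm)
      ultimately have "y \<prec> x" by simp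
      then show ?thesis using lt_not_sym SG that by blast
    qed
  qed
  ultimately show ?thesis unfolding represented_def by blast
qed

lemma represented_trivial: "represented {\<one>} 0 {0}"
proof -
  have "Dom (lex_grp 0 {0}) = {\<lambda>_. 0}"
  proof (intro equalityI subsetI)
    fix x assume x: "x \<in> Dom (lex_grp 0 {0})"
    have "x i = 0" for i using x by (cases i) (simp_all add: Dom_lex_grp)
    then show "x \<in> {\<lambda>_. 0}" by auto
  qed (simp add: Dom_lex_grp)
  then show ?thesis unfolding represented_def
    by (intro exI[of _ "\<lambda>_ _. 0"]) (auto simp: lt_irrefl bij_betw_def)
qed

text \<open>Hoelder's embedding into the reals with unit \<open>u\<close>; halving supplies
  arbitrarily small elements, and completeness makes the embedding onto. Completeness is asked for
  increasing sequences, since these give the cuts that stable embeddedness controls.\<close>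

lemma represented_real:
  assumes K: "subgroup K G" and u: "u \<in> K" "\<one> \<prec> u"
    and half: "\<And>x. x \<in> K \<Longrightarrow> \<exists>y\<in>K. y \<otimes> y = x"
    and arch: "\<And>x y. x \<in> K \<Longrightarrow> y \<in> K \<Longrightarrow> \<one> \<prec> x \<Longrightarrow> \<exists>k::nat. y \<prec> x [^] k"
    and complete: "\<And>s b. (\<And>j::nat. s j \<in> K) \<Longrightarrow> (\<And>i j. i \<le> j \<Longrightarrow> \<not> s j \<prec> s i) \<Longrightarrow>
      b \<in> K \<Longrightarrow> (\<And>j. \<not> b \<prec> s j) \<Longrightarrow>
      \<exists>c\<in>K. \<forall>x\<in>K. (x \<prec> c \<longrightarrow> (\<exists>j. x \<prec> s j)) \<and> (c \<prec> x \<longrightarrow> (\<forall>j. \<not> x \<prec> s j))"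
  shows "represented K 0 UNIV"
proof -
  have KG: "x \<in> K \<Longrightarrow> x \<in> carrier G" for x using subgroup.mem_carrier[OF K] .
  have uG: "u \<in> carrier G" using KG u by blast
  note Km = subgroup.m_closed[OF K] and Ki = subgroup.m_inv_closed[OF K]
  have Kp: "x [^] (k::int) \<in> K" if "x \<in> K" for x k using subgroup_int_pow_closed[OF K that] .
  have "\<exists>k::int. \<not> x \<prec> u [^] k \<and> x \<prec> u [^] (k + 1)" if x: "x \<in> K" for x
  proof -
    obtain a b :: nat where "x \<prec> u [^] a" "inv x \<prec> u [^] b"
      using arch[OF u(1) x u(2)] arch[OF u(1) Ki[OF x] u(2)] by blast
    then show ?thesis by (rule floor_exists[OF uG KG[OF x] u(2)])
  qed
  then obtain fl :: "'a \<Rightarrow> int" where fl: "\<And>x. x \<in> K \<Longrightarrow> \<not> x \<prec> u [^] fl x"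
    "\<And>x. x \<in> K \<Longrightarrow> x \<prec> u [^] (fl x + 1)" by metis
  have fl_ge: "k \<le> fl x" if "x \<in> K" "\<not> x \<prec> u [^] k" for x k
    using floor_unique[OF uG KG[OF that(1)] u(2) that(2) fl(2)[OF that(1)]] by simp
  have fl_less: "fl x < k" if "x \<in> K" "x \<prec> u [^] k" for x k
    using floor_unique[OF uG KG[OF that(1)] u(2) fl(1)[OF that(1)] that(2)] .
  have fl_mult: "fl x + fl y \<le> fl (x \<otimes> y)" "fl (x \<otimes> y) \<le> fl x + fl y + 1" if "x \<in> K" "y \<in> K" for x y
  proof -
    note C = KG[OF that(1)] KG[OF that(2)]
    have "\<not> x \<otimes> y \<prec> u [^] fl x \<otimes> u [^] fl y"
    proof
      assume a: "x \<otimes> y \<prec> u [^] fl x \<otimes> u [^] fl y"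
      have 1: "\<not> x \<otimes> y \<prec> u [^] fl x \<otimes> y" using fl(1)[OF that(1)] C uG by (subst lt_mult_iff) auto
      have "\<not> y \<otimes> u [^] fl x \<prec> u [^] fl y \<otimes> u [^] fl x"
        using fl(1)[OF that(2)] C uG by (subst lt_mult_iff) auto
      then have 2: "\<not> u [^] fl x \<otimes> y \<prec> u [^] fl x \<otimes> u [^] fl y" using C uG by (simp add: m_comm)
      show False using 1 2 a C uG le_lt_trans[of "u [^] fl x \<otimes> y" "x \<otimes> y" "u [^] fl x \<otimes> u [^] fl y"] by simp
    qed
    then show "fl x + fl y \<le> fl (x \<otimes> y)" using uG by (intro fl_ge Km that) (simp add: int_pow_mult)
    have "x \<otimes> y \<prec> u [^] (fl x + 1) \<otimes> u [^] (fl y + 1)"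
      using fl(2) that C uG by (intro mult_less) auto
    then have "x \<otimes> y \<prec> u [^] (fl x + fl y + 2)"
      using uG by (simp add: int_pow_mult[symmetric] algebra_simps)
    then show "fl (x \<otimes> y) \<le> fl x + fl y + 1" using fl_less[OF Km[OF that]] by fastforce
  qed
  \<comment> \<open>Both sides estimate \<open>x [^] (p * q)\<close>, one from below and one from
    above. Hence the slopes \<open>fl (x [^] q) / q\<close> are bounded by
    \<open>(fl (x [^] p) + 1) / p\<close>, and their supremum is approximated up to
    \<open>1 / p\<close>.\<close>
  have cross: "p * fl (x [^] q) \<le> q * (fl (x [^] p) + 1)" if x: "x \<in> K" "p > 0" "q > 0" for x and p q :: int
  proof -
    note C = KG[OF x(1)]
    let ?a = "u [^] fl (x [^] q)" and ?b = "u [^] (fl (x [^] p) + 1)"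
    have "x [^] p \<prec> ?b" by (rule fl(2)[OF Kp[OF x(1)]])
    then have b: "(x [^] p) [^] q \<prec> ?b [^] q" using C uG x by (intro int_pow_less_base) auto
    have "\<not> (x [^] q) [^] p \<prec> ?a [^] p"
    proof (cases "?a = x [^] q")
      case False
      then have "?a \<prec> x [^] q" using fl(1)[OF Kp[OF x(1)], of q] lt_linear[of ?a "x [^] q"] C uG by auto
      then have "?a [^] p \<prec> (x [^] q) [^] p" using C uG x by (intro int_pow_less_base) auto
      then show ?thesis using C uG by (intro lt_not_sym) auto
    qed (use C lt_irrefl in simp)
    then have "u [^] (fl (x [^] q) * p) \<prec> u [^] ((fl (x [^] p) + 1) * q)"
      using b C uG le_lt_trans[of "?a [^] p" "x [^] (p * q)" "?b [^] q"]
      by (simp add: int_pow_pow mult.commute)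
    then have "fl (x [^] q) * p < (fl (x [^] p) + 1) * q" using int_pow_less[OF uG u(2)] by blast
    then show ?thesis by (simp add: algebra_simps)
  qed
  define \<rho> where "\<rho> x = (SUP q\<in>{0<..}. of_int (fl (x [^] q)) / of_int q :: real)" for x
  have ub: "of_int (fl (x [^] q)) / of_int q \<le> (of_int (fl (x [^] p) + 1) / of_int p :: real)"
    if "x \<in> K" "p > 0" "q > 0" for x and p q :: int
  proof -
    have "(of_int (p * fl (x [^] q)) :: real) \<le> of_int (q * (fl (x [^] p) + 1))"
      using cross[OF that] by (simp only: of_int_le_iff)
    then show ?thesis using that by (simp add: divide_simps mult.commute)
  qed
  have \<rho>_lower: "of_int (fl (x [^] q)) \<le> of_int q * \<rho> x"
    and \<rho>_upper: "of_int q * \<rho> x \<le> of_int (fl (x [^] q)) + 1" if x: "x \<in> K" "q > 0" for x and q :: int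
  proof -
    have bdd: "bdd_above ((\<lambda>q. of_int (fl (x [^] q)) / of_int q :: real) ` {0<..})"
      using ub[OF x] by (intro bdd_aboveI2[where M = "of_int (fl (x [^] q) + 1) / of_int q"]) simp
    have "of_int (fl (x [^] q)) / of_int q \<le> \<rho> x"
      unfolding \<rho>_def using x(2) by (intro cSUP_upper bdd) simp
    then show "of_int (fl (x [^] q)) \<le> of_int q * \<rho> x" using x(2) by (simp add: divide_simps mult.commute)
    have "\<rho> x \<le> of_int (fl (x [^] q) + 1) / of_int q"
      unfolding \<rho>_def using ub[OF x] by (intro cSUP_least) auto
    then show "of_int q * \<rho> x \<le> of_int (fl (x [^] q)) + 1" using x(2) by (simp add: divide_simps mult.commute)
  qed
  have \<rho>_mult: "\<rho> (x \<otimes> y) = \<rho> x + \<rho> y" if "x \<in> K" "y \<in> K" for x y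
  proof (rule ccontr)
    assume "\<rho> (x \<otimes> y) \<noteq> \<rho> x + \<rho> y"
    then have "\<bar>\<rho> (x \<otimes> y) - \<rho> x - \<rho> y\<bar> > 0" by simp
    \<comment> \<open>At exponent \<open>q\<close> the rounding errors stay below a constant, for
      which 4 is a safe choice, while a defect of additivity is multiplied by
      \<open>q\<close>.\<close>
    then obtain n :: nat where n: "4 < of_nat n * \<bar>\<rho> (x \<otimes> y) - \<rho> x - \<rho> y\<bar>"
      using ex_less_of_nat_mult by blast
    then have "n > 0" by (cases n) auto
    define q where "q = int n"
    have q: "q > 0" "4 < of_int q * \<bar>\<rho> (x \<otimes> y) - \<rho> x - \<rho> y\<bar>" using n \<open>n > 0\<close> by (simp_all add: q_def)
    have "(x \<otimes> y) [^] q = x [^] q \<otimes> y [^] q" using KG that by (simp add: int_pow_distrib)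
    then have f: "fl (x [^] q) + fl (y [^] q) \<le> fl ((x \<otimes> y) [^] q)"
      "fl ((x \<otimes> y) [^] q) \<le> fl (x [^] q) + fl (y [^] q) + 1"
      using fl_mult[OF Kp[OF that(1), of q] Kp[OF that(2), of q]] by simp_all
    have f1: "of_int (fl (x [^] q)) + of_int (fl (y [^] q)) \<le> (of_int (fl ((x \<otimes> y) [^] q)) :: real)"
      using f(1) by linarith
    have f2: "of_int (fl ((x \<otimes> y) [^] q)) \<le> (of_int (fl (x [^] q)) + of_int (fl (y [^] q)) + 1 :: real)"
      using f(2) by linarith
    note b = \<rho>_lower[OF that(1) q(1)] \<rho>_lower[OF that(2) q(1)] \<rho>_lower[OF Km[OF that] q(1)]
      \<rho>_upper[OF that(1) q(1)] \<rho>_upper[OF that(2) q(1)] \<rho>_upper[OF Km[OF that] q(1)]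
    have "of_int q * \<bar>\<rho> (x \<otimes> y) - \<rho> x - \<rho> y\<bar> = \<bar>of_int q * \<rho> (x \<otimes> y) - of_int q * \<rho> x - of_int q * \<rho> y\<bar>"
      using q(1) by (simp add: abs_mult flip: right_diff_distrib)
    also have "\<dots> \<le> 4" using b f1 f2 by (simp add: abs_le_iff)
    finally show False using q(2) by simp
  qed
  have \<rho>_one: "\<rho> \<one> = 0" using \<rho>_mult[OF subgroup.one_closed[OF K] subgroup.one_closed[OF K]] by simp
  have \<rho>_inv: "\<rho> (inv x) = - \<rho> x" if "x \<in> K" for x
    using \<rho>_mult[OF that Ki[OF that]] KG[OF that] \<rho>_one by simp
  have \<rho>_pos: "\<rho> x > 0" if x: "x \<in> K" "\<one> \<prec> x" for x
  proof -
    obtain k :: nat where k: "u \<prec> x [^] k" using arch[OF x(1) u(1) x(2)] by blast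
    have "k > 0" using k u(2) uG lt_not_sym by (cases k) auto
    have "\<not> x [^] (int k) \<prec> u [^] (1::int)" using k uG KG[OF x(1)] lt_not_sym by (simp add: int_pow_int)
    then have "1 \<le> fl (x [^] int k)" by (rule fl_ge[OF Kp[OF x(1)]])
    then have "1 \<le> of_int (int k) * \<rho> x" using \<rho>_lower[OF x(1), of "int k"] \<open>k > 0\<close> by linarith
    then show ?thesis using \<open>k > 0\<close> by (metis less_le_trans zero_less_one of_int_of_nat_eq of_nat_0_le_iff zero_less_mult_pos of_nat_0_less_iff)
  qed
  have \<rho>_less: "\<rho> x < \<rho> y" if "x \<in> K" "y \<in> K" "x \<prec> y" for x y
    using \<rho>_pos[OF Km[OF that(2) Ki[OF that(1)]]] lt_iff_pos[OF KG KG, OF that(1,2)] that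
      \<rho>_mult[OF that(2) Ki[OF that(1)]] \<rho>_inv[OF that(1)] by simp
  have \<rho>_le: "\<not> y \<prec> x" if "x \<in> K" "y \<in> K" "\<rho> x \<le> \<rho> y" for x y
    using \<rho>_less[OF that(2,1)] that(3) by linarith
  have \<rho>_nat: "\<rho> (x [^] (k::nat)) = real k * \<rho> x" if x: "x \<in> K" for x k
  proof (induction k)
    case (Suc k)
    have "x [^] k \<in> K" using Kp[OF x, of "int k"] by (simp add: int_pow_int)
    then show ?case using \<rho>_mult[OF _ x, of "x [^] k"] Suc by (simp add: algebra_simps)
  qed (simp add: \<rho>_one)
  have \<rho>_pow: "\<rho> (x [^] (k::int)) = of_int k * \<rho> x" if x: "x \<in> K" for x k
  proof (cases "k \<ge> 0")
    case True
    then obtain l where "k = int l" using nonneg_int_cases by blast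
    then show ?thesis using \<rho>_nat[OF x, of l] by (simp add: int_pow_int)
  next
    case False
    then obtain l where l: "k = - int l" by (metis int_cases2 linear neg_0_le_iff_le of_nat_0_le_iff)
    have "x [^] l \<in> K" using Kp[OF x, of "int l"] by (simp add: int_pow_int)
    then show ?thesis using \<rho>_nat[OF x, of l] \<rho>_inv[of "x [^] l"] KG[OF x] l by (simp add: int_pow_neg int_pow_int)
  qed
  obtain hf where hf: "\<And>x. x \<in> K \<Longrightarrow> hf x \<in> K" "\<And>x. x \<in> K \<Longrightarrow> hf x \<otimes> hf x = x" using half by metis
  \<comment> \<open>\<open>u\<close> halved \<open>j\<close> times: the grid in which a given real
    is approximated.\<close>
  define v where "v j = (hf ^^ j) u" for j
  have vK: "v j \<in> K" for j by (induction j) (simp_all add: v_def u hf)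
  have v_Suc: "\<rho> (v (Suc j)) = \<rho> (v j) / 2" for j
    using \<rho>_mult[OF hf(1)[OF vK] hf(1)[OF vK], of j j] hf(2)[OF vK, of j] by (simp add: v_def)
  have \<rho>_v: "\<rho> (v j) = \<rho> u / 2 ^ j" for j
    by (induction j) (simp add: v_def, simp add: v_Suc)
  have \<rho>_v_pos: "\<rho> (v j) > 0" for j using \<rho>_pos[OF u] by (simp add: \<rho>_v)
  have v_pos: "\<one> \<prec> v j" for j
    using lt_linear[of \<one> "v j"] KG[OF vK] \<rho>_v_pos[of j] \<rho>_one \<rho>_less[OF vK subgroup.one_closed[OF K], of j] by force
  have small: "\<exists>j. \<rho> (v j) < \<epsilon>" if "\<epsilon> > 0" for \<epsilon>
  proof -
    obtain j :: nat where "\<rho> u / \<epsilon> < 2 ^ j" using real_arch_pow[of 2] by auto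
    then show ?thesis using that by (intro exI[of _ j]) (simp add: \<rho>_v divide_simps mult.commute)
  qed
  have surj: "\<exists>c\<in>K. \<rho> c = r" for r
  proof -
    \<comment> \<open>The largest integer with \<open>k j * \<rho> (v j)\<close> strictly below
      \<open>r\<close>. Its double is admissible for the next, halved grid, so the
      \<open>s j\<close> increase.\<close>
    define k where "k j = \<lceil>r / \<rho> (v j)\<rceil> - 1" for j
    define s where "s j = v j [^] k j" for j
    have sK: "s j \<in> K" for j unfolding s_def by (rule Kp[OF vK])
    have \<rho>_s: "\<rho> (s j) = of_int (k j) * \<rho> (v j)" for j unfolding s_def by (rule \<rho>_pow[OF vK])
    have s_less: "\<rho> (s j) < r" for j
    proof -
      have "of_int (k j) < r / \<rho> (v j)" unfolding k_def by linarith
      then show ?thesis using \<rho>_v_pos[of j] by (simp add: \<rho>_s divide_simps)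
    qed
    have s_ge: "r \<le> \<rho> (s j) + \<rho> (v j)" for j
    proof -
      have "r / \<rho> (v j) \<le> of_int (k j) + 1" unfolding k_def by linarith
      then show ?thesis using \<rho>_v_pos[of j] by (simp add: \<rho>_s divide_simps algebra_simps)
    qed
    have "\<rho> (s j) \<le> \<rho> (s (Suc j))" for j
    proof -
      have "of_int (2 * k j) * \<rho> (v (Suc j)) < r" using s_less[of j] by (simp add: \<rho>_s v_Suc)
      then have "of_int (2 * k j) < r / \<rho> (v (Suc j))" using \<rho>_v_pos[of "Suc j"] by (simp add: divide_simps)
      then have "2 * k j \<le> k (Suc j)" unfolding k_def[of "Suc j"] by linarith
      then have "of_int (2 * k j) * \<rho> (v (Suc j)) \<le> of_int (k (Suc j)) * \<rho> (v (Suc j))"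
        using \<rho>_v_pos[of "Suc j"] by (intro mult_right_mono) linarith+
      then show ?thesis by (simp add: \<rho>_s v_Suc)
    qed
    then have s_mono: "\<rho> (s i) \<le> \<rho> (s j)" if "i \<le> j" for i j
      using that lift_Suc_mono_le[of "\<lambda>j. \<rho> (s j)"] by blast
    obtain l :: nat where l: "r < real l * \<rho> u" using ex_less_of_nat_mult[OF \<rho>_pos[OF u]] by blast
    define b where "b = u [^] int l"
    have bK: "b \<in> K" unfolding b_def by (rule Kp[OF u(1)])
    have \<rho>_b: "\<rho> b = real l * \<rho> u" unfolding b_def using \<rho>_pow[OF u(1), of "int l"] by simp
    have "\<exists>c\<in>K. \<forall>x\<in>K. (x \<prec> c \<longrightarrow> (\<exists>j. x \<prec> s j)) \<and> (c \<prec> x \<longrightarrow> (\<forall>j. \<not> x \<prec> s j))"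
    proof (rule complete[OF sK _ bK])
      show "\<not> s j \<prec> s i" if "i \<le> j" for i j by (rule \<rho>_le[OF sK sK s_mono[OF that]])
      show "\<not> b \<prec> s j" for j using s_less[of j] l by (intro \<rho>_le[OF sK bK]) (simp add: \<rho>_b)
    qed
    then obtain c where c: "c \<in> K" "\<And>x. x \<in> K \<Longrightarrow> x \<prec> c \<Longrightarrow> \<exists>j. x \<prec> s j"
      "\<And>x j. x \<in> K \<Longrightarrow> c \<prec> x \<Longrightarrow> \<not> x \<prec> s j" by blast
    \<comment> \<open>The test points: if \<open>\<rho> c\<close> were not \<open>r\<close>, then
      \<open>c\<close> moved towards \<open>r\<close> by a small \<open>v j\<close> would stay on
      the same side of \<open>r\<close>, against the choice of \<open>c\<close>.\<close>
    have shift: "c \<prec> c \<otimes> v j" "c \<otimes> inv (v j) \<prec> c" for j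
    proof -
      note C = KG[OF c(1)] KG[OF vK, of j]
      have "\<one> \<otimes> c \<prec> v j \<otimes> c" using v_pos C by (intro lt_mono) auto
      then show "c \<prec> c \<otimes> v j" using C by (simp add: m_comm)
      have "inv (v j) \<prec> inv \<one>" using v_pos C inv_less_iff[of "v j" \<one>] by simp
      then have "inv (v j) \<otimes> c \<prec> \<one> \<otimes> c" using C by (intro lt_mono) auto
      then show "c \<otimes> inv (v j) \<prec> c" using C by (simp add: m_comm)
    qed
    have "\<rho> c = r"
    proof (rule ccontr)
      assume "\<rho> c \<noteq> r"
      then consider "\<rho> c < r" | "r < \<rho> c" by linarith
      then show False
      proof cases
        case 1
        then obtain j where j: "\<rho> (v j) < (r - \<rho> c) / 2" using small[of "(r - \<rho> c) / 2"] by auto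
        have xK: "c \<otimes> v j \<in> K" by (rule Km[OF c(1) vK])
        have "\<not> c \<otimes> v j \<prec> s j" by (rule c(3)[OF xK shift(1)])
        moreover have "\<rho> (c \<otimes> v j) < \<rho> (s j)" using s_ge[of j] j \<rho>_mult[OF c(1) vK, of j] by (simp add: field_simps)
        then have "c \<otimes> v j \<prec> s j"
          using lt_linear[of "c \<otimes> v j" "s j"] KG[OF xK] KG[OF sK, of j] \<rho>_less[OF sK xK, of j] by force
        ultimately show False by blast
      next
        case 2
        then obtain j where j: "\<rho> (v j) < \<rho> c - r" using small[of "\<rho> c - r"] by auto
        have xK: "c \<otimes> inv (v j) \<in> K" by (rule Km[OF c(1) Ki[OF vK]])
        obtain i where "c \<otimes> inv (v j) \<prec> s i" using c(2)[OF xK shift(2)] by blast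
        from \<rho>_less[OF xK sK this] show False
          using s_less[of i] j \<rho>_mult[OF c(1) Ki[OF vK], of j] \<rho>_inv[OF vK, of j] by simp
      qed
    qed
    then show ?thesis using c(1) by blast
  qed
  define f where "f x = case_nat (\<rho> x) (\<lambda>_. 0)" for x
  have "bij_betw f K (Dom (lex_grp 0 UNIV))"
    unfolding bij_betw_def
  proof (intro conjI equalityI subsetI)
    show "inj_on f K"
    proof (rule inj_onI)
      fix x y assume xy: "x \<in> K" "y \<in> K" "f x = f y"
      then have "\<rho> x = \<rho> y" by (metis f_def old.nat.simps(4))
      then show "x = y" using lt_linear[OF KG KG, OF xy(1,2)] \<rho>_less xy by force
    qed
    show "h \<in> Dom (lex_grp 0 UNIV)" if "h \<in> f ` K" for h
      using that by (auto simp: Dom_lex_grp f_def split: nat.split)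
    fix h assume h: "h \<in> Dom (lex_grp 0 UNIV)"
    obtain c where "c \<in> K" "\<rho> c = h 0" using surj by blast
    moreover have "h (Suc i) = 0" for i using h by (simp add: Dom_lex_grp)
    ultimately show "h \<in> f ` K" by (intro image_eqI[of _ _ c]) (auto simp: f_def fun_eq_iff split: nat.split)
  qed
  moreover have "f (x \<otimes> y) = (\<lambda>i. f x i + f y i)" if "x \<in> K" "y \<in> K" for x y
    using \<rho>_mult[OF that] by (auto simp: f_def fun_eq_iff split: nat.split)
  moreover have "lexless (f x) (f y)" if "x \<in> K" "y \<in> K" "x \<prec> y" for x y
    using \<rho>_less[OF that] by (subst lexless_Suc) (simp add: f_def)
  ultimately show ?thesis unfolding represented_def by blast
qed

end


section \<open>Stably embedded models\<close>

definition grp_of :: "'a lstruct \<Rightarrow> 'a monoid" where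
  "grp_of M = \<lparr>carrier = Dom M, mult = plus_of M, one = zero_of M\<rparr>"

lemma ordered_comm_group_model:
  assumes T: "T = {0} \<or> T = UNIV" and M: "is_model M (Th (lex_grp n T))"
  shows "ordered_comm_group (grp_of M) (less_of M)"
    and "x \<in> Dom M \<Longrightarrow> inv\<^bsub>grp_of M\<^esub> x = neg_of M x"
proof -
  have ls: "zero_of M \<in> Dom M" "\<And>x y. x \<in> Dom M \<Longrightarrow> y \<in> Dom M \<Longrightarrow> plus_of M x y \<in> Dom M"
    "\<And>x. x \<in> Dom M \<Longrightarrow> neg_of M x \<in> Dom M"
    using M by (simp_all add: is_model_def is_lstruct_def)
  note ax = model_Th_all[OF M]
  have assoc: "plus_of M (plus_of M x y) z = plus_of M x (plus_of M y z)"
    if "x \<in> Dom M" "y \<in> Dom M" "z \<in> Dom M" for x y z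
    using ax[of 3 "FEq (TPlus (TPlus (TVar 0) (TVar 1)) (TVar 2)) (TPlus (TVar 0) (TPlus (TVar 1) (TVar 2)))" "[x, y, z]"]
      that by (simp add: tuples_def add.assoc)
  have comm: "plus_of M x y = plus_of M y x" if "x \<in> Dom M" "y \<in> Dom M" for x y
    using ax[of 2 "FEq (TPlus (TVar 0) (TVar 1)) (TPlus (TVar 1) (TVar 0))" "[x, y]"]
      that by (simp add: tuples_def add.commute)
  have zero: "plus_of M (zero_of M) x = x" if "x \<in> Dom M" for x
    using ax[of 1 "FEq (TPlus TZero (TVar 0)) (TVar 0)" "[x]"] that by (simp add: tuples_def)
  have neg: "plus_of M (neg_of M x) x = zero_of M" if "x \<in> Dom M" for x
    using ax[of 1 "FEq (TPlus (TNeg (TVar 0)) (TVar 0)) TZero" "[x]"] that by (simp add: tuples_def)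
  have irrefl: "\<not> less_of M x x" if "x \<in> Dom M" for x
    using ax[of 1 "FNot (FLess (TVar 0) (TVar 0))" "[x]"] that by (simp add: tuples_def)
  have trans: "less_of M x z" if "x \<in> Dom M" "y \<in> Dom M" "z \<in> Dom M" "less_of M x y" "less_of M y z" for x y z
    using ax[of 3 "FImp (FLess (TVar 0) (TVar 1)) (FImp (FLess (TVar 1) (TVar 2)) (FLess (TVar 0) (TVar 2)))" "[x, y, z]"]
      that lexless_trans by (auto simp: tuples_def)
  have linear: "less_of M x y \<or> x = y \<or> less_of M y x" if "x \<in> Dom M" "y \<in> Dom M" for x y
    using ax[of 2 "FOr (FLess (TVar 0) (TVar 1)) (FOr (FEq (TVar 0) (TVar 1)) (FLess (TVar 1) (TVar 0)))" "[x, y]"]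
      that lexless_linear by (auto simp: tuples_def)
  have lex_mono: "lexless (\<lambda>i. x i + z i) (\<lambda>i. y i + z i) \<longleftrightarrow> lexless x y" for x y z
    by (simp add: lexless_def)
  have mono: "less_of M (plus_of M x z) (plus_of M y z)"
    if "x \<in> Dom M" "y \<in> Dom M" "z \<in> Dom M" "less_of M x y" for x y z
    using ax[of 3 "FImp (FLess (TVar 0) (TVar 1)) (FLess (TPlus (TVar 0) (TVar 2)) (TPlus (TVar 1) (TVar 2)))" "[x, y, z]"]
      that by (simp add: tuples_def lex_mono)
  have "comm_group (grp_of M)"
  proof (rule comm_groupI)
    show "\<exists>y\<in>carrier (grp_of M). y \<otimes>\<^bsub>grp_of M\<^esub> x = \<one>\<^bsub>grp_of M\<^esub>" if "x \<in> carrier (grp_of M)" for x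
      using that ls(3) neg by (intro bexI[of _ "neg_of M x"]) (simp_all add: grp_of_def)
  qed (use ls assoc comm zero in \<open>simp_all add: grp_of_def\<close>)
  then interpret comm_group "grp_of M" .
  show "ordered_comm_group (grp_of M) (less_of M)"
  proof unfold_locales
    have c: "carrier (grp_of M) = Dom M" and m: "x \<otimes>\<^bsub>grp_of M\<^esub> y = plus_of M x y" for x y
      by (simp_all add: grp_of_def)
    fix x y z assume C: "x \<in> carrier (grp_of M)" "y \<in> carrier (grp_of M)" "z \<in> carrier (grp_of M)"
    show "less_of M x y \<Longrightarrow> less_of M y z \<Longrightarrow> less_of M x z" using C unfolding c by (rule trans)
    show "less_of M x y \<Longrightarrow> less_of M (x \<otimes>\<^bsub>grp_of M\<^esub> z) (y \<otimes>\<^bsub>grp_of M\<^esub> z)"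
      using C unfolding c m by (rule mono)
  qed (simp_all add: grp_of_def irrefl linear)
  show "inv\<^bsub>grp_of M\<^esub> x = neg_of M x" if "x \<in> Dom M"
    using inv_equality[of "neg_of M x" x] neg that ls by (simp add: grp_of_def)
qed

lemma model_represented:
  fixes M :: "'u lstruct" and G (structure)
  defines "G \<equiv> grp_of M"
  assumes T: "T = {0} \<or> T = UNIV" and M: "is_model M (Th (lex_grp n T))"
    and se: "stably_embedded TYPE('u) M"
  shows "ordered_comm_group.represented G (less_of M) (Dom M) n T"
proof -
  interpret ordered_comm_group G "less_of M" unfolding G_def by (rule ordered_comm_group_model[OF T M])
  have carrier: "carrier G = Dom M" and plus: "plus_of M x y = x \<otimes> y" and zero: "zero_of M = \<one>" for x y
    by (simp_all add: G_def grp_of_def)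
  have neg: "neg_of M x = inv x" if "x \<in> carrier G" for x
    unfolding G_def using ordered_comm_group_model(2)[OF T M, of x] that by (simp add: carrier)
  have ls: "is_lstruct M" using M by (simp add: is_model_def)
  obtain es where es: "es \<in> tuples M n" "frame (T = UNIV) M es" using model_frame[OF T M] by blast
  have len: "length es = n" using es by (simp add: tuples_def)
  have eG: "es ! i \<in> carrier G" if "i < n" for i using es that by (auto simp: tuples_def carrier)
  define lv where "lv i = {x \<in> carrier G. lev M es i x}" for i
  have lvG: "x \<in> lv i \<Longrightarrow> x \<in> carrier G" for x i by (simp add: lv_def)
  have lv_0: "lv 0 = carrier G" by (simp add: lv_def lev_def)
  have lv_Suc: "x \<in> lv (Suc i) \<longleftrightarrow> x \<in> carrier G \<and> less_of M (inv (es ! i)) (x \<otimes> x) \<and> less_of M (x \<otimes> x) (es ! i)"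
    if "i < n" for i x
    using that len neg[OF eG[OF that]] by (simp add: lv_def lev_def plus)
  have lv_top: "lv (Suc n) = {\<one>}" using len by (auto simp: lv_def lev_def zero)
  have e_pos: "less_of M \<one> (es ! i)" and e_lv: "es ! i \<in> lv i" if "i < n" for i
    using es(2) that len eG[OF that] by (simp_all add: frame_def zero lv_def)
  have lv_closed: "x \<otimes> y \<in> lv (Suc i)" if "i < n" "x \<in> lv (Suc i)" "y \<in> lv (Suc i)" for i x y
    using es(2) that len by (simp add: frame_def lv_def plus carrier[symmetric])
  have minimal: "x \<in> lv (Suc i) \<or> es ! i \<otimes> inv x \<in> lv (Suc i)"
    if i: "i < n" and x: "x \<in> carrier G" "less_of M \<one> x" "less_of M x (es ! i)" for i x
  proof -
    have "lev M es (Suc i) x \<or> lev M es (Suc i) (plus_of M (es ! i) (neg_of M x))"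
      using es(2) i x len by (simp add: frame_def zero carrier)
    then show ?thesis using x eG[OF i] by (simp add: lv_def plus neg)
  qed
  have lv_less: "less_of M x (es ! i)" if "i < n" "x \<in> lv (Suc i)" for i x
    using half_less[of x "es ! i"] that eG e_pos lv_Suc by simp
  have sub: "subgroup (lv i) G" if i: "i \<le> Suc n" for i
  proof -
    consider "i = 0" | "i = Suc n" | j where "i = Suc j" "j < n" using i by (cases i) (auto simp: le_less)
    then show ?thesis
    proof cases
      case 1
      then show ?thesis using subgroup_self by (simp add: lv_0)
    next
      case 2
      then show ?thesis by (simp add: lv_top triv_subgroup)
    next
      case (3 j)
      have "inv x \<in> lv (Suc j)" if x: "x \<in> lv (Suc j)" for x
      proof -
        have xG: "x \<in> carrier G" using x by (rule lvG)
        have "inv x \<otimes> inv x = inv (x \<otimes> x)" using xG by (simp add: inv_mult)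
        moreover have "less_of M (inv (es ! j)) (inv (x \<otimes> x))"
          using x lv_Suc[OF 3(2), of x] xG eG[OF 3(2)] by (subst inv_less_iff) auto
        moreover have "less_of M (inv (x \<otimes> x)) (inv (inv (es ! j)))"
          using x lv_Suc[OF 3(2), of x] xG eG[OF 3(2)] by (subst inv_less_iff) auto
        ultimately show ?thesis using lv_Suc[OF 3(2)] xG eG[OF 3(2)] by simp
      qed
      moreover have "\<one> \<in> lv (Suc j)"
        using lv_Suc[OF 3(2)] e_pos[OF 3(2)] eG[OF 3(2)] inv_less_iff[of "es ! j" "\<one>"] by simp
      ultimately show ?thesis unfolding 3(1) using lv_closed[OF 3(2)] lvG
        by (intro subgroup.intro) auto
    qed
  qed
  have lv_mono: "lv (Suc i) \<subseteq> lv i" if i: "i < n" for i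
  proof (cases i)
    case 0
    then show ?thesis using lvG lv_0 by auto
  next
    case (Suc j)
    then have j: "j < n" using i by simp
    have ee: "less_of M (es ! i) (es ! j)" using lv_less[OF j] e_lv[OF i] Suc by simp
    then have ee': "less_of M (inv (es ! j)) (inv (es ! i))" using eG i j by (subst inv_less_iff) auto
    show ?thesis
    proof
      fix x assume x: "x \<in> lv (Suc i)"
      then have xG: "x \<in> carrier G" by (rule lvG)
      have "less_of M (x \<otimes> x) (es ! j)"
        by (rule lt_trans[of _ "es ! i"]) (use x lv_Suc[OF i, of x] xG eG i j ee in auto)
      moreover have "less_of M (inv (es ! j)) (x \<otimes> x)"
        by (rule lt_trans[of _ "inv (es ! i)"]) (use x lv_Suc[OF i, of x] xG eG i j ee' in auto)
      ultimately show "x \<in> lv i" unfolding Suc using lv_Suc[OF j] xG by simp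
    qed
  qed
  \<comment> \<open>Coding the Skolem terms asks for an infinite domain; the powers of any positive
    element provide it.\<close>
  have infinite: "infinite (Dom M)" if u: "u \<in> carrier G" "less_of M \<one> u" for u
  proof -
    have "inj (\<lambda>k::int. u [^] k)"
    proof (rule injI)
      fix a b :: int assume "u [^] a = u [^] b"
      then show "a = b"
        using int_pow_less[OF u, of a b] int_pow_less[OF u, of b a] lt_irrefl[of "u [^] b"] u
        by (cases a b rule: linorder_cases) auto
    qed
    then have "infinite (range (\<lambda>k::int. u [^] k))" by (simp add: finite_image_iff)
    moreover have "range (\<lambda>k::int. u [^] k) \<subseteq> Dom M" using u by (auto simp flip: carrier)
    ultimately show ?thesis using finite_subset by blast
  qed
  text \<open>
    A cut of countable cofinality is externally definable, hence definable, hence has a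
    supremum modulo the next level, because definable cuts in the standard model do.
  \<close>
  have cut: "\<exists>c\<in>lv i. \<forall>x\<in>lv i.
      (less_of M x c \<longrightarrow> (\<exists>j. less_of M x (s j)) \<or> x \<otimes> inv c \<in> lv (Suc i)) \<and>
      (less_of M c x \<longrightarrow> (\<forall>j. \<not> less_of M x (s j)) \<or> x \<otimes> inv c \<in> lv (Suc i))"
    if inf: "infinite (Dom M)" and i: "i < n \<or> i = n \<and> T = UNIV" and s: "\<And>j. s j \<in> carrier G"
      "\<And>i j. i \<le> j \<Longrightarrow> \<not> less_of M (s j) (s i)"
      and d: "d0 \<in> lv i" "less_of M d0 (s 0)" "d1 \<in> lv i" "\<And>j. \<not> less_of M d1 (s j)"
    for i d0 d1 and s :: "nat \<Rightarrow> 'u"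
  proof -
    define D where "D = {x. \<exists>j. less_of M x (s j)}"
    have "\<exists>l p. \<exists>b\<in>tuples M l. fm_in (Suc l) p \<and> (\<forall>x\<in>Dom M. x \<in> D \<longleftrightarrow> sat M (x # b) p)"
    proof (rule stably_embedded_cut_definable[OF ls inf se])
      show "s j \<in> Dom M" for j using s(1) by (simp add: carrier)
      fix x assume x: "x \<in> Dom M"
      {
        assume "x \<in> D"
        then obtain j where j: "less_of M x (s j)" by (auto simp: D_def)
        have "less_of M x (s k)" if "k \<ge> j" for k
          using lt_le_trans[of x "s j" "s k"] j s(1) s(2)[OF that] x by (simp add: carrier)
        then show "eventually (\<lambda>j. less_of M x (s j)) sequentially"
          unfolding eventually_sequentially by blast
      next
        assume "x \<notin> D"
        then show "eventually (\<lambda>j. \<not> less_of M x (s j)) sequentially" by (simp add: D_def)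
      }
    qed
    then obtain l p b where b: "b \<in> tuples M l" and p: "fm_in (Suc l) p"
      and Dp: "\<And>x. x \<in> Dom M \<Longrightarrow> x \<in> D \<longleftrightarrow> sat M (x # b) p" by blast
    have sup: "has_cut_sup M es (\<lambda>x. sat M (x # b) p) i"
      by (rule model_has_cut_sup[OF T M es i p b])
    have down: "\<forall>x\<in>Dom M. \<forall>y\<in>Dom M. sat M (x # b) p \<longrightarrow> less_of M y x \<longrightarrow> sat M (y # b) p"
    proof (intro ballI impI)
      fix x y assume xy: "x \<in> Dom M" "y \<in> Dom M" "sat M (x # b) p" "less_of M y x"
      then obtain j where "less_of M x (s j)" using Dp by (auto simp: D_def)
      then have "less_of M y (s j)" using lt_trans[of y x "s j"] xy s(1) by (simp add: carrier)
      then show "sat M (y # b) p" using Dp[OF xy(2)] by (auto simp: D_def)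
    qed
    have dD: "d0 \<in> Dom M" "d1 \<in> Dom M" "lev M es i d0" "lev M es i d1"
      using d by (simp_all add: lv_def carrier)
    have "sat M (d0 # b) p" using Dp[OF dD(1)] d(2) by (auto simp: D_def)
    moreover have "\<not> sat M (d1 # b) p" using Dp[OF dD(2)] d(4) by (auto simp: D_def)
    ultimately have "\<exists>c\<in>Dom M. lev M es i c \<and> (\<forall>x\<in>Dom M. lev M es i x \<longrightarrow>
        (less_of M x c \<longrightarrow> sat M (x # b) p \<or> lev M es (Suc i) (plus_of M x (neg_of M c))) \<and>
        (less_of M c x \<longrightarrow> \<not> sat M (x # b) p \<or> lev M es (Suc i) (plus_of M x (neg_of M c))))"
      using sup down dD unfolding has_cut_sup_def by blast
    then obtain c where c: "c \<in> Dom M" "lev M es i c"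
      and cx: "\<And>x. x \<in> Dom M \<Longrightarrow> lev M es i x \<Longrightarrow>
        (less_of M x c \<longrightarrow> sat M (x # b) p \<or> lev M es (Suc i) (plus_of M x (neg_of M c))) \<and>
        (less_of M c x \<longrightarrow> \<not> sat M (x # b) p \<or> lev M es (Suc i) (plus_of M x (neg_of M c)))"
      by blast
    show ?thesis
    proof (intro bexI[of _ c] ballI)
      show cl: "c \<in> lv i" using c by (simp add: lv_def carrier)
      fix x assume x: "x \<in> lv i"
      then have xD: "x \<in> Dom M" "lev M es i x" by (simp_all add: lv_def carrier)
      have "lev M es (Suc i) (plus_of M x (neg_of M c)) \<longleftrightarrow> x \<otimes> inv c \<in> lv (Suc i)"
        using lvG[OF x] lvG[OF cl] by (simp add: lv_def plus neg)
      then show "(less_of M x c \<longrightarrow> (\<exists>j. less_of M x (s j)) \<or> x \<otimes> inv c \<in> lv (Suc i)) \<and>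
        (less_of M c x \<longrightarrow> (\<forall>j. \<not> less_of M x (s j)) \<or> x \<otimes> inv c \<in> lv (Suc i))"
        using cx[OF xD] Dp[OF xD(1)] by (auto simp: D_def)
    qed
  qed
  have arch: "\<exists>k::nat. less_of M y (u [^] k)"
    if i: "i < n \<or> i = n \<and> T = UNIV" and u: "u \<in> lv i" "less_of M \<one> u" "u \<notin> lv (Suc i)" and y: "y \<in> lv i"
    for i u y
  proof (rule ccontr)
    assume no: "\<nexists>k::nat. less_of M y (u [^] k)"
    have iS: "i \<le> Suc n" "Suc i \<le> Suc n" using i by auto
    note S = sub[OF iS(1)]
    have uG: "u \<in> carrier G" using u(1) by (rule lvG)
    \<comment> \<open>Starting with \<open>u\<close>, so that the neutral element lies below the
      cut; \<open>y\<close> is the point above it.\<close>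
    define s where "s j = u [^] (Suc j)" for j
    have sG: "s j \<in> carrier G" for j using uG by (simp add: s_def)
    have s_less: "less_of M (s i) (s j) \<longleftrightarrow> i < j" for i j
      using int_pow_less[OF uG u(2), of "int (Suc i)" "int (Suc j)"] unfolding int_pow_int s_def by simp
    have s0: "less_of M \<one> (s 0)" using u(2) uG by (simp add: s_def)
    have sm: "\<not> less_of M (s j) (s i)" if "i \<le> j" for i j using s_less that by simp
    have ny: "\<not> less_of M y (s j)" for j using no unfolding s_def by blast
    from cut[where s = s, OF infinite[OF uG u(2)] i sG sm subgroup.one_closed[OF S] s0 y ny]
    obtain c where c: "c \<in> lv i" and cx: "\<And>x. x \<in> lv i \<Longrightarrow>
      (less_of M x c \<longrightarrow> (\<exists>j. less_of M x (s j)) \<or> x \<otimes> inv c \<in> lv (Suc i)) \<and>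
      (less_of M c x \<longrightarrow> (\<forall>j. \<not> less_of M x (s j)) \<or> x \<otimes> inv c \<in> lv (Suc i))"
      by blast
    have cG: "c \<in> carrier G" using c by (rule lvG)
    have iu: "inv u \<notin> lv (Suc i)"
      using subgroup.m_inv_closed[OF sub[OF iS(2)], of "inv u"] u(3) uG by auto
    have lo: "c \<otimes> inv u \<in> lv i" "c \<otimes> u \<in> lv i"
      using c u(1) by (auto intro: subgroup.m_closed[OF S] subgroup.m_inv_closed[OF S])
    \<comment> \<open>Moving \<open>c\<close> by \<open>u\<close> in either direction leaves its
      coset modulo level \<open>i + 1\<close>, which rules out the exceptional clause of
      \<open>cut\<close>.\<close>
    have e1: "c \<otimes> inv u \<otimes> inv c = inv u" "c \<otimes> u \<otimes> inv c = u"
      using cG uG m_comm[of c "inv u"] m_comm[of c u] by (simp_all add: m_assoc)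
    have l1: "less_of M c (c \<otimes> u)" using lt_iff_pos[of c "c \<otimes> u"] cG uG e1(2) u(2) by simp
    have l2: "less_of M (c \<otimes> inv u) c"
      using lt_mult_iff[of "c \<otimes> inv u" c u] cG uG l1 by (simp add: m_assoc)
    \<comment> \<open>The quotient of \<open>c\<close> by \<open>u\<close> lies below some power of
      \<open>u\<close>. Multiplying twice by \<open>u\<close> puts \<open>c \<otimes> u\<close>
      below a power too, although it lies above the supremum \<open>c\<close>.\<close>
    obtain j where j: "less_of M (c \<otimes> inv u) (s j)" using cx[OF lo(1)] l2 iu by (auto simp: e1)
    have "less_of M (c \<otimes> inv u \<otimes> u) (s j \<otimes> u)" using j cG uG sG by (subst lt_mult_iff) auto
    then have "less_of M c (s (Suc j))" using cG uG by (simp add: m_assoc s_def)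
    then have "less_of M (c \<otimes> u) (s (Suc j) \<otimes> u)" using cG uG sG by (subst lt_mult_iff) auto
    then have "less_of M (c \<otimes> u) (s (Suc (Suc j)))" by (simp add: s_def)
    then show False using cx[OF lo(2)] l1 u(3) by (auto simp: e1)
  qed
  have base: "represented (lv n) 0 T"
  proof (cases "T = {0}")
    case True
    then have "T \<noteq> UNIV" by (metis UNIV_I singletonD zero_neq_one)
    then have "x = \<one>" if "x \<in> lv n" for x
      using es(2) that len by (simp add: frame_def lv_def carrier zero)
    moreover have "\<one> \<in> lv n" by (rule subgroup.one_closed[OF sub]) simp
    ultimately have "lv n = {\<one>}" by blast
    then show ?thesis using represented_trivial True by simp
  next
    case False
    then have TU: "T = UNIV" using T by blast
    have Sn: "subgroup (lv n) G" by (rule sub) simp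
    have fr: "\<exists>x\<in>lv n. x \<noteq> \<one>" "\<forall>x\<in>lv n. \<exists>y\<in>lv n. y \<otimes> y = x"
      using es(2) len TU by (simp_all add: frame_def lv_def carrier zero plus Bex_def Ball_def conj_assoc)
    then obtain x where x: "x \<in> lv n" "x \<noteq> \<one>" by blast
    have half: "\<exists>y\<in>lv n. y \<otimes> y = x" if "x \<in> lv n" for x using fr(2) that by blast
    have "\<exists>u\<in>lv n. less_of M \<one> u"
    proof (cases "less_of M \<one> x")
      case False
      then have "less_of M x \<one>" using lt_linear[of x "\<one>"] x lvG by auto
      then have "less_of M \<one> (inv x)" using inv_less_iff[of "\<one>" x] lvG[OF x(1)] by simp
      then show ?thesis using subgroup.m_inv_closed[OF Sn x(1)] by blast
    qed (use x in blast)
    then obtain u where u: "u \<in> lv n" "less_of M \<one> u" by blast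
    have "represented (lv n) 0 UNIV"
    proof (rule represented_real[OF Sn u half])
      show "\<exists>k::nat. less_of M y (x [^] k)" if "x \<in> lv n" "y \<in> lv n" "less_of M \<one> x" for x y
      proof -
        have "x \<notin> lv (Suc n)" using that(3) lt_irrefl[of "\<one>"] by (auto simp: lv_top)
        then show ?thesis using arch[of n x y] that TU by simp
      qed
      fix s :: "nat \<Rightarrow> 'u" and b
      assume s: "\<And>j. s j \<in> lv n" "\<And>i j. i \<le> j \<Longrightarrow> \<not> less_of M (s j) (s i)" and b: "b \<in> lv n" "\<And>j. \<not> less_of M b (s j)"
      note C = lvG[OF s(1), of 0] lvG[OF u(1)]
      \<comment> \<open>\<open>cut\<close> asks for a point of the level strictly below
        \<open>s 0\<close>.\<close>
      have d0: "s 0 \<otimes> inv u \<in> lv n"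
        by (rule subgroup.m_closed[OF Sn s(1) subgroup.m_inv_closed[OF Sn u(1)]])
      have l0: "less_of M (s 0 \<otimes> inv u) (s 0)"
        using lt_iff_pos[of "s 0 \<otimes> inv u" "s 0"] C u(2) by (simp add: inv_mult m_assoc[symmetric])
      have nT: "n < n \<or> n = n \<and> T = UNIV" using TU by simp
      from cut[where s = s, OF infinite[OF C(2) u(2)] nT lvG[OF s(1)] s(2) d0 l0 b]
      obtain c where c: "c \<in> lv n" and cx: "\<And>x. x \<in> lv n \<Longrightarrow>
        (less_of M x c \<longrightarrow> (\<exists>j. less_of M x (s j)) \<or> x \<otimes> inv c \<in> lv (Suc n)) \<and>
        (less_of M c x \<longrightarrow> (\<forall>j. \<not> less_of M x (s j)) \<or> x \<otimes> inv c \<in> lv (Suc n))"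
        by blast
      have cG: "c \<in> carrier G" using c by (rule lvG)
      \<comment> \<open>Level \<open>n + 1\<close> is trivial, so here the supremum modulo the next
        level is a genuine one.\<close>
      have ne: "x = c" if "x \<in> lv n" "x \<otimes> inv c \<in> lv (Suc n)" for x
      proof -
        have "x \<otimes> inv c = \<one>" using that(2) by (simp add: lv_top)
        then show ?thesis using inv_equality[of x "inv c"] lvG[OF that(1)] cG by simp
      qed
      show "\<exists>c\<in>lv n. \<forall>x\<in>lv n. (less_of M x c \<longrightarrow> (\<exists>j. less_of M x (s j))) \<and>
        (less_of M c x \<longrightarrow> (\<forall>j. \<not> less_of M x (s j)))"
        using c cx ne lt_irrefl[OF cG] by (intro bexI[of _ c]) metis+
    qed
    then show ?thesis by (simp add: TU)
  qed
  \<comment> \<open>From the last level upwards, each step adds one dominant integer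
    coordinate.\<close>
  have "represented (lv (n - j)) j T" if "j \<le> n" for j
    using that
  proof (induction j)
    case (Suc j)
    define i where "i = n - Suc j"
    have i: "i < n" "Suc i = n - j" using Suc.prems by (simp_all add: i_def)
    have "represented (lv i) (Suc j) T"
    proof (rule represented_Suc)
      show "subgroup (lv i) G" "subgroup (lv (Suc i)) G" using i by (simp_all add: sub)
      show "lv (Suc i) \<subseteq> lv i" by (rule lv_mono[OF i(1)])
      show "es ! i \<in> lv i" "less_of M \<one> (es ! i)" using e_lv e_pos i by auto
      show "less_of M x (es ! i)" if "x \<in> lv (Suc i)" for x by (rule lv_less[OF i(1) that])
      show "x \<in> lv (Suc i) \<or> es ! i \<otimes> inv x \<in> lv (Suc i)"
        if "x \<in> lv i" "less_of M \<one> x" "less_of M x (es ! i)" for x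
        by (rule minimal[OF i(1) lvG[OF that(1)] that(2,3)])
      have "es ! i \<notin> lv (Suc i)" using lv_less[OF i(1), of "es ! i"] lt_irrefl[OF eG[OF i(1)]] by blast
      then show "\<exists>k::nat. less_of M x (es ! i [^] k)" if "x \<in> lv i" for x
        using arch[of i "es ! i" x] i e_lv e_pos that by blast
      show "represented (lv (Suc i)) j T" using Suc i by simp
    qed
    then show ?case by (simp add: i_def)
  qed (simp add: base)
  from this[of n] show ?thesis by (simp add: lv_0 carrier)
qed

lemma model_isomorphic_lex_grp:
  fixes M :: "'u lstruct"
  assumes T: "T = {0} \<or> T = UNIV" and M: "is_model M (Th (lex_grp n T))"
    and se: "stably_embedded TYPE('u) M"
  shows "\<exists>f. struct_iso f M (lex_grp n T)"
proof -
  interpret ordered_comm_group "grp_of M" "less_of M" by (rule ordered_comm_group_model[OF T M])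
  have ls: "zero_of M \<in> Dom M" "\<And>x. x \<in> Dom M \<Longrightarrow> neg_of M x \<in> Dom M"
    using M by (simp_all add: is_model_def is_lstruct_def)
  have carrier: "carrier (grp_of M) = Dom M" by (simp add: grp_of_def)
  obtain f where bij: "bij_betw f (Dom M) (Dom (lex_grp n T))"
    and add: "\<And>x y. x \<in> Dom M \<Longrightarrow> y \<in> Dom M \<Longrightarrow> f (plus_of M x y) = (\<lambda>i. f x i + f y i)"
    and less: "\<And>x y. x \<in> Dom M \<Longrightarrow> y \<in> Dom M \<Longrightarrow> less_of M x y \<Longrightarrow> lexless (f x) (f y)"
    using model_represented[OF T M se] unfolding represented_def by (auto simp: grp_of_def)
  have "plus_of M (zero_of M) (zero_of M) = zero_of M"
    using l_one[of "zero_of M"] ls by (simp add: grp_of_def)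
  then have "f (zero_of M) i = f (zero_of M) i + f (zero_of M) i" for i
    using add[OF ls(1) ls(1)] by (metis (mono_tags))
  then have zero: "f (zero_of M) = (\<lambda>_. 0)" by (intro ext) simp
  have neg: "f (neg_of M x) = (\<lambda>i. - f x i)" if x: "x \<in> Dom M" for x
  proof -
    have "plus_of M x (neg_of M x) = zero_of M"
      using r_inv[of x] ordered_comm_group_model(2)[OF T M x] x by (simp add: grp_of_def)
    then have "(\<lambda>i. f x i + f (neg_of M x) i) = (\<lambda>_. 0)" using add[OF x ls(2)[OF x]] zero by simp
    then show ?thesis by (intro ext) (metis add_eq_0_iff)
  qed
  have "less_of M x y \<longleftrightarrow> lexless (f x) (f y)" if "x \<in> Dom M" "y \<in> Dom M" for x y
    using less[OF that] less[OF that(2,1)] lt_linear[of x y] that lexless_not_sym lexless_irrefl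
    by (metis carrier)
  then have "struct_iso f M (lex_grp n T)" unfolding struct_iso_def using bij zero add neg by simp
  then show ?thesis by blast
qed

lemma stably_embedded_models_isomorphic:
  fixes M :: "'u lstruct"
  assumes T: "T = {0} \<or> T = UNIV" and f: "struct_iso f N (lex_grp n T)" and N: "is_lstruct N"
    and M: "is_model M (Th N)" "stably_embedded TYPE('u) M"
  shows "isomorphic M N"
proof -
  have "is_model M (Th (lex_grp n T))" using M(1) Th_iso[OF f N] by simp
  then obtain g where g: "struct_iso g M (lex_grp n T)" using model_isomorphic_lex_grp[OF T _ M(2)] by blast
  show ?thesis unfolding isomorphic_iff using struct_iso_comp[OF g struct_iso_inv[OF f N]] by blast
qed

theorem corollary2p6:
  fixes n :: nat
  shows
    "(uniformly_stably_embedded TYPE('u) (Z_pow n) \<and>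
      uniformly_stably_embedded TYPE('u) (lex_times (Z_pow n) R_grp)) \<and>
     (stably_embedded TYPE('u) (Z_pow n) \<and>
      (\<forall>M :: 'u lstruct.
         is_model M (Th (Z_pow n)) \<and> stably_embedded TYPE('u) M \<longrightarrow>
         isomorphic M (Z_pow n))) \<and>
     (stably_embedded TYPE('u) (lex_times (Z_pow n) R_grp) \<and>
      (\<forall>M :: 'u lstruct.
         is_model M (Th (lex_times (Z_pow n) R_grp)) \<and> stably_embedded TYPE('u) M \<longrightarrow>
         isomorphic M (lex_times (Z_pow n) R_grp)))"
proof -
  have Z: "uniformly_stably_embedded TYPE('u) (Z_pow n)"
    by (rule uniformly_stably_embedded_iso[OF struct_iso_Z_pow is_lstruct_Z_pow])
      (simp add: uniformly_stably_embedded_lex_grp)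
  have ZR: "uniformly_stably_embedded TYPE('u) (lex_times (Z_pow n) R_grp)"
    by (rule uniformly_stably_embedded_iso[OF struct_iso_lex_times is_lstruct_lex_times])
      (simp add: uniformly_stably_embedded_lex_grp)
  have "isomorphic M (Z_pow n)"
    if "is_model M (Th (Z_pow n))" "stably_embedded TYPE('u) M" for M :: "'u lstruct"
    by (rule stably_embedded_models_isomorphic[OF _ struct_iso_Z_pow is_lstruct_Z_pow that]) simp
  moreover have "isomorphic M (lex_times (Z_pow n) R_grp)"
    if "is_model M (Th (lex_times (Z_pow n) R_grp))" "stably_embedded TYPE('u) M" for M :: "'u lstruct"
    by (rule stably_embedded_models_isomorphic[OF _ struct_iso_lex_times is_lstruct_lex_times that]) simp
  ultimately show ?thesis
    using Z ZR stably_embedded_if_uniformly[OF Z] stably_embedded_if_uniformly[OF ZR] by blast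
qed

end
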